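(* Let $\alpha\in(0,1)$, $T,L,\varrho>0$, $f\in C([0,L]\times[0,T])$, $\varphi\in C[0,L]$, and let $u$ be a solution of $${}_CD_{0,t}^{\alpha}u(x,t)-\varrho\,\partial_x^2u(x,t)=f(x,t),\quad 0<x<L,\ 0<t\le T,$$ $$u(0,t)=u(L,t)=0,\ 0<t\le T,\qquad u(x,0)=\varphi(x),\ 0\le x\le L.$$ Assume that $u(x,\cdot)\in C[0,T]\cap C^4(0,T]$ for each $x$, that for some constant $C$ one has $\left|\frac{\partial^l u(x,t)}{\partial t^l}\right|\le C(1+t^{\alpha-l})$ for all $x\in[0,L]$, $t\in(0,T]$, $l=0,1,\ldots,4$, and that the central difference approximation of $\partial_x^2u$ is second-order accurate, i.e. $\partial_x^2u(x_i,t_n)=\frac{u(x_{i+1},t_n)-2u(x_i,t_n)+u(x_{i-1},t_n)}{h^2}+\mathcal{O}(h^2)$ uniformly over mesh points. For positive integers $K_t,K_x$ let $\tau=T/K_t$, $t_n=n\tau$ for $0\le n\le K_t$ (uniform mesh, i.e. grading parameter $r=1$), $h=L/K_x$, $x_i=ih$ for $0\le i\le K_x$, $f_i^n=f(x_i,t_n)$, and let $(u_i^n)$ be the solution of the finite difference scheme $$\frac{1}{\Gamma(2-\alpha)}\sum_{j=0}^{n}p_j^{(n)}u_i^{n-j}=\varrho\,\frac{u_{i+1}^n-2u_i^n+u_{i-1}^n}{h^2}+f_i^n,\qquad 1\le i\le K_x-1,\ 1\le n\le K_t,$$ $$u_0^n=0=u_{K_x}^n,\quad 0<n\le K_t,\qquad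 u_i^0=\varphi(x_i),\quad 0\le i\le K_x,$$ with the coefficients $p_j^{(n)}$ defined in the context. Put $e_i^n=u(x_i,t_n)-u_i^n$, $i=1,2,\ldots,K_x-1$. Then for sufficiently small $h$ and $\tau$, $$\|e^n\|_\infty=\mathcal{O}(h^2+\tau^{\alpha}),\qquad n=1,2,\ldots,K_t,$$ i.e. $\max_{i}|e_i^n|\le M(h^2+\tau^\alpha)$ for all $1\le n\le K_t$ with a constant $M$ independent of $h$, $\tau$ and $n$.
   Context: Caputo derivative of order $\alpha\in(0,1)$ in time: ${}_CD_{0,t}^{\alpha}u(x,t)=\frac{1}{\Gamma(1-\alpha)}\int_0^t (t-s)^{-\alpha}\,\partial_s u(x,s)\,ds$. The coefficients $p_j^{(n)}$ ($0\le j\le n$, depending on $n$, $\alpha$ and the temporal mesh) are the real numbers determined by the identity, for all mesh functions $v$ with $v^m=v(t_m)$, $$\frac{1}{\Gamma(2-\alpha)}\sum_{j=0}^{n}p_j^{(n)}v^{n-j}=\frac{1}{\Gamma(1-\alpha)}\Big[\int_{t_0}^{t_1}(t_n-s)^{-\alpha}(I_{11}v)'(s)\,ds+\int_{t_1}^{t_2}(t_n-s)^{-\alpha}(I_{22}v)'(s)\,ds+\sum_{k=3}^{n}\int_{t_{k-1}}^{t_k}(t_n-s)^{-\alpha}(I_{3k}v)'(s)\,ds\Big],$$ where for $n=1$ only the first integral is present and for $n=2$ only the first two. Here $I_{11}v$ is the linear polynomial interpolating $v$ at $t_0,t_1$; $I_{22}v$ is the quadratic polynomial interpolating $v$ at $t_0,t_1,t_2$;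 and for $k\ge3$, $I_{3k}v$ is the cubic polynomial interpolating $v$ at $t_{k-3},t_{k-2},t_{k-1},t_k$. *)

theory Defs
  imports "HOL-Analysis.Analysis"
begin

section \<open>Continuous problem\<close>

text \<open>Only the values of the derivative in the open interval from 0 to \<open>t\<close> matter.\<close>

definition caputo_deriv :: "real \<Rightarrow> (real \<Rightarrow> real) \<Rightarrow> real \<Rightarrow> real" where
  "caputo_deriv \<alpha> g t =
     1 / Gamma (1 - \<alpha>) * integral {0..t} (\<lambda>s. (t - s) powr (-\<alpha>) * deriv g s)"

text \<open>
  Derivatives relative to a set \<open>S\<close>; at an endpoint belonging to an interval \<open>S\<close> they are one-sided.
\<close>

definition higher_deriv_within :: "real set \<Rightarrow> nat \<Rightarrow> (real \<Rightarrow> real) \<Rightarrow> real \<Rightarrow> real" where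
  "higher_deriv_within S l g = ((\<lambda>w s. vector_derivative w (at s within S)) ^^ l) g"

definition C_k_on :: "nat \<Rightarrow> real set \<Rightarrow> (real \<Rightarrow> real) \<Rightarrow> bool" where
  "C_k_on k S g \<longleftrightarrow>
     (\<forall>l<k. higher_deriv_within S l g differentiable_on S) \<and>
     continuous_on S (higher_deriv_within S k g)"

definition second_deriv_x :: "(real \<Rightarrow> real \<Rightarrow> real) \<Rightarrow> real \<Rightarrow> real \<Rightarrow> real" where
  "second_deriv_x u x t = (deriv ^^ 2) (\<lambda>y. u y t) x"

definition subdiffusion_solution ::
  "real \<Rightarrow> real \<Rightarrow> real \<Rightarrow> real \<Rightarrow> (real \<Rightarrow> real \<Rightarrow> real) \<Rightarrow> (real \<Rightarrow> real) \<Rightarrow>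
   (real \<Rightarrow> real \<Rightarrow> real) \<Rightarrow> bool" where
  "subdiffusion_solution \<alpha> \<rho> L T f \<phi> u \<longleftrightarrow>
     (\<forall>x\<in>{0<..<L}. \<forall>t\<in>{0<..T}.
        (\<lambda>y. u y t) differentiable (at x) \<and>
        deriv (\<lambda>y. u y t) differentiable (at x) \<and>
        caputo_deriv \<alpha> (u x) t - \<rho> * second_deriv_x u x t = f x t) \<and>
     (\<forall>t\<in>{0<..T}. u 0 t = 0 \<and> u L t = 0) \<and>
     (\<forall>x\<in>{0..L}. u x 0 = \<phi> x)"

section \<open>Discretisation of the Caputo derivative\<close>

text \<open>The polynomial of degree at most \<open>b - a\<close> interpolating \<open>v\<close> at \<open>t a, \<dots>, t b\<close>.\<close>

definition interp_poly :: "(nat \<Rightarrow> real) \<Rightarrow> (nat \<Rightarrow> real) \<Rightarrow> nat \<Rightarrow> nat \<Rightarrow> real poly" where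
  "interp_poly t v a b =
     (THE q. degree q \<le> b - a \<and> (\<forall>k\<in>{a..b}. poly q (t k) = v k))"

text \<open>
  Truncated subtraction in \<open>k - 3\<close> is intended: the nodes on the interval from \<open>t (k - 1)\<close> to
  \<open>t k\<close> are \<open>t 0, t 1\<close> for \<open>k = 1\<close>, \<open>t 0, t 1, t 2\<close> for \<open>k = 2\<close>, and the last four for \<open>k \<ge> 3\<close>.
\<close>

definition discrete_caputo :: "real \<Rightarrow> (nat \<Rightarrow> real) \<Rightarrow> nat \<Rightarrow> (nat \<Rightarrow> real) \<Rightarrow> real" where
  "discrete_caputo \<alpha> t n v =
     1 / Gamma (1 - \<alpha>) *
       (\<Sum>k=1..n. integral {t (k - 1)..t k}
          (\<lambda>s. (t n - s) powr (-\<alpha>) * poly (pderiv (interp_poly t v (k - 3) k)) s))"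

definition is_caputo_coeffs :: "real \<Rightarrow> (nat \<Rightarrow> real) \<Rightarrow> nat \<Rightarrow> (nat \<Rightarrow> real) \<Rightarrow> bool" where
  "is_caputo_coeffs \<alpha> t n p \<longleftrightarrow>
     (\<forall>v. 1 / Gamma (2 - \<alpha>) * (\<Sum>j=0..n. p j * v (n - j)) = discrete_caputo \<alpha> t n v)"

text \<open>The identity determines \<open>p j\<close> only for \<open>j \<le> n\<close>; the remaining values are set to zero.\<close>

definition caputo_coeff :: "real \<Rightarrow> (nat \<Rightarrow> real) \<Rightarrow> nat \<Rightarrow> nat \<Rightarrow> real" where
  "caputo_coeff \<alpha> t n = (THE p. is_caputo_coeffs \<alpha> t n p \<and> (\<forall>j>n. p j = 0))"

subsection \<open>Well-definedness of the interpolant and of the coefficients\<close>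

definition lagrange_basis :: "(nat \<Rightarrow> real) \<Rightarrow> nat \<Rightarrow> nat \<Rightarrow> nat \<Rightarrow> real poly" where
  "lagrange_basis t a b k =
     (\<Prod>j\<in>{a..b} - {k}. smult (1 / (t k - t j)) [:- t j, 1:])"

lemma degree_lagrange_basis:
  assumes "k \<in> {a..b}"
  shows "degree (lagrange_basis t a b k) \<le> b - a"
proof -
  have "degree (lagrange_basis t a b k)
      \<le> (\<Sum>j\<in>{a..b} - {k}. degree (smult (1 / (t k - t j)) [:- t j, 1:]))"
    unfolding lagrange_basis_def by (rule order.trans[OF degree_prod_sum_le]) (simp_all add: o_def)
  also have "\<dots> \<le> (\<Sum>j\<in>{a..b} - {k}. 1)"
    by (intro sum_mono) simp
  also have "\<dots> = b - a"
    using assms by (simp add: card_Diff_singleton)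
  finally show ?thesis .
qed

lemma poly_lagrange_basis:
  assumes "inj_on t {a..b}" "k \<in> {a..b}" "m \<in> {a..b}"
  shows "poly (lagrange_basis t a b k) (t m) = (if m = k then 1 else 0)"
proof (cases "m = k")
  case True
  have "poly (smult (1 / (t k - t j)) [:- t j, 1:]) (t m) = 1" if "j \<in> {a..b} - {k}" for j
  proof -
    have "t k \<noteq> t j"
      using assms that by (auto dest: inj_onD)
    then show ?thesis
      using True by (simp flip: diff_divide_distrib)
  qed
  then show ?thesis
    using True unfolding lagrange_basis_def poly_prod by (simp add: prod.neutral)
next
  case False
  then show ?thesis
    using assms by (auto simp: lagrange_basis_def poly_prod intro!: bexI[of _ m])
qed

lemma interp_poly_unique:
  assumes "inj_on t {a..b}" "a \<le> b"
    and "degree p \<le> b - a" "\<forall>k\<in>{a..b}. poly p (t k) = v k"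
    and "degree q \<le> b - a" "\<forall>k\<in>{a..b}. poly q (t k) = (v k :: real)"
  shows "p = q"
proof (rule poly_eqI_degree[of "t ` {a..b}"])
  show "degree p < card (t ` {a..b})" "degree q < card (t ` {a..b})"
    using assms by (simp_all add: card_image)
qed (use assms in auto)

lemma interp_poly_eq:
  assumes "inj_on t {a..b}" "a \<le> b"
  shows "interp_poly t v a b = (\<Sum>k\<in>{a..b}. smult (v k) (lagrange_basis t a b k))" (is "_ = ?q")
  unfolding interp_poly_def
proof (rule the_equality)
  have deg: "degree ?q \<le> b - a"
    by (intro degree_sum_le order.trans[OF degree_smult_le degree_lagrange_basis]) auto
  have "poly ?q (t m) = v m" if "m \<in> {a..b}" for m
  proof -
    have "poly ?q (t m) = (\<Sum>k\<in>{a..b}. if m = k then v k else 0)"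
      unfolding poly_sum using assms that
      by (intro sum.cong) (simp_all add: poly_lagrange_basis)
    then show ?thesis using that by simp
  qed
  with deg show *: "degree ?q \<le> b - a \<and> (\<forall>k\<in>{a..b}. poly ?q (t k) = v k)" by blast
  show "q = ?q" if "degree q \<le> b - a \<and> (\<forall>k\<in>{a..b}. poly q (t k) = v k)" for q
    using interp_poly_unique[OF assms] that * by blast
qed

lemma integrable_powr_poly:
  fixes \<alpha> :: real
  assumes "\<alpha> < 1" "a \<le> b" "b \<le> c"
  shows "(\<lambda>s. (c - s) powr (-\<alpha>) * poly q s) integrable_on {a..b}"
proof -
  have "(\<lambda>x. x powr (-\<alpha>)) integrable_on cbox 0 (c - a)"
    using integrable_on_powr_from_0[of "-\<alpha>" "c - a"] assms by simp
  from integrable_affinity[OF this, of "-1" c]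
  have "(\<lambda>x. (c - x) powr (-\<alpha>)) integrable_on {a..c}"
    using assms by simp
  then have "(\<lambda>x. (c - x) powr (-\<alpha>)) absolutely_integrable_on {a..c}"
    by (intro nonnegative_absolutely_integrable_1) auto
  moreover have "poly q \<in> borel_measurable (lebesgue_on {a..c})"
    by (intro continuous_imp_measurable_on_sets_lebesgue) (auto intro: continuous_intros)
  moreover have "bounded (poly q ` {a..c})"
    by (intro compact_imp_bounded compact_continuous_image) (auto intro: continuous_intros)
  ultimately have "(\<lambda>s. poly q s * (c - s) powr (-\<alpha>)) absolutely_integrable_on {a..c}"
    by (intro absolutely_integrable_bounded_measurable_product_real) auto
  then have "(\<lambda>s. (c - s) powr (-\<alpha>) * poly q s) integrable_on {a..c}"
    using set_lebesgue_integral_eq_integral(1) by (simp add: mult.commute)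
  then show ?thesis
    by (rule integrable_on_subinterval) (use assms in auto)
qed

lemma discrete_caputo_linear:
  assumes "\<alpha> < 1" and t: "strict_mono_on {0..n} t"
  obtains W where "\<And>v. discrete_caputo \<alpha> t n v = (\<Sum>m=0..n. W m * v m)"
proof -
  define w where "w k m = integral {t (k - 1)..t k}
    (\<lambda>s. (t n - s) powr (-\<alpha>) * poly (pderiv (lagrange_basis t (k - 3) k m)) s)" for k m
  define W where "W m = 1 / Gamma (1 - \<alpha>) *
    (\<Sum>k=1..n. if m \<in> {k - 3..k} then w k m else 0)" for m
  have "discrete_caputo \<alpha> t n v = (\<Sum>m=0..n. W m * v m)" for v
  proof -
    have "integral {t (k - 1)..t k}
        (\<lambda>s. (t n - s) powr (-\<alpha>) * poly (pderiv (interp_poly t v (k - 3) k)) s)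
      = (\<Sum>m=0..n. (if m \<in> {k - 3..k} then w k m else 0) * v m)" if k: "k \<in> {1..n}" for k
    proof -
      have inj: "inj_on t {k - 3..k}"
        by (rule inj_on_subset[OF strict_mono_on_imp_inj_on[OF t]]) (use k in auto)
      have le: "t (k - 1) \<le> t k" "t k \<le> t n"
        using k by (auto intro!: strict_mono_on_leD[OF t])
      have "integral {t (k - 1)..t k}
          (\<lambda>s. (t n - s) powr (-\<alpha>) * poly (pderiv (interp_poly t v (k - 3) k)) s)
        = integral {t (k - 1)..t k} (\<lambda>s. \<Sum>m\<in>{k - 3..k}. v m *
           ((t n - s) powr (-\<alpha>) * poly (pderiv (lagrange_basis t (k - 3) k m)) s))"
        by (simp add: interp_poly_eq[OF inj] higher_pderiv_sum[of 1, simplified] pderiv_smult poly_sum sum_distrib_left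
            mult_ac)
      also have "\<dots> = (\<Sum>m\<in>{k - 3..k}. v m * w k m)"
        unfolding w_def using assms(1) le
        by (subst integral_sum) (auto intro!: integrable_on_mult_right integrable_powr_poly)
      also have "\<dots> = (\<Sum>m=0..n. (if m \<in> {k - 3..k} then w k m else 0) * v m)"
        by (rule sum.mono_neutral_cong_left) (use k in auto)
      finally show ?thesis .
    qed
    then have "discrete_caputo \<alpha> t n v = 1 / Gamma (1 - \<alpha>) *
        (\<Sum>k=1..n. \<Sum>m=0..n. (if m \<in> {k - 3..k} then w k m else 0) * v m)"
      unfolding discrete_caputo_def by simp
    also have "\<dots> = (\<Sum>m=0..n. W m * v m)"
      unfolding W_def by (subst sum.swap) (simp only: sum_distrib_left sum_distrib_right mult.assoc)
    finally show ?thesis .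
  qed
  then show ?thesis by (rule that)
qed

lemma is_caputo_coeffs_unique:
  assumes "\<alpha> < 1" "is_caputo_coeffs \<alpha> t n p" "is_caputo_coeffs \<alpha> t n q" "j \<le> n"
  shows "p j = q j"
proof -
  have pick: "(\<Sum>i=0..n. r i * (if n - i = n - j then 1 else 0)) = r j" for r :: "nat \<Rightarrow> real"
  proof -
    have "(\<Sum>i=0..n. r i * (if n - i = n - j then 1 else 0)) = (\<Sum>i=0..n. if i = j then r i else 0)"
      using \<open>j \<le> n\<close> by (intro sum.cong) auto
    then show ?thesis using \<open>j \<le> n\<close> by simp
  qed
  have "Gamma (2 - \<alpha>) \<noteq> 0"
    using Gamma_real_pos[of "2 - \<alpha>"] assms(1) by linarith
  moreover have "1 / Gamma (2 - \<alpha>) * (\<Sum>i=0..n. p i * (if n - i = n - j then 1 else 0))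
      = 1 / Gamma (2 - \<alpha>) * (\<Sum>i=0..n. q i * (if n - i = n - j then 1 else 0))"
    using assms(2,3)[unfolded is_caputo_coeffs_def, THEN spec, of "\<lambda>m. if m = n - j then 1 else 0"]
    by simp
  ultimately show ?thesis by (simp add: pick)
qed

lemma caputo_coeff:
  assumes "\<alpha> < 1" and "strict_mono_on {0..n} t"
  shows "is_caputo_coeffs \<alpha> t n (caputo_coeff \<alpha> t n)"
proof -
  obtain W where W: "\<And>v. discrete_caputo \<alpha> t n v = (\<Sum>m=0..n. W m * v m)"
    using discrete_caputo_linear[OF assms] by blast
  define p where "p j = (if j \<le> n then Gamma (2 - \<alpha>) * W (n - j) else 0)" for j
  have nz: "Gamma (2 - \<alpha>) \<noteq> 0"
    using Gamma_real_pos[of "2 - \<alpha>"] assms(1) by linarith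
  have "1 / Gamma (2 - \<alpha>) * (\<Sum>j=0..n. p j * v (n - j)) = discrete_caputo \<alpha> t n v" for v
  proof -
    have "1 / Gamma (2 - \<alpha>) * (\<Sum>j=0..n. p j * v (n - j)) = (\<Sum>j=0..n. W (n - j) * v (n - j))"
      unfolding sum_distrib_left using nz by (intro sum.cong) (auto simp: p_def)
    also have "\<dots> = (\<Sum>m=0..n. W m * v m)"
      by (rule sum.reindex_bij_witness[of _ "\<lambda>m. n - m" "\<lambda>m. n - m"]) auto
    finally show ?thesis by (simp add: W)
  qed
  then have p: "is_caputo_coeffs \<alpha> t n p \<and> (\<forall>j>n. p j = 0)"
    by (auto simp: is_caputo_coeffs_def p_def)
  have "caputo_coeff \<alpha> t n = p"
    unfolding caputo_coeff_def
  proof (rule the_equality[where P = "\<lambda>p. is_caputo_coeffs \<alpha> t n p \<and> (\<forall>j>n. p j = 0)", OF p])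
    fix q assume q: "is_caputo_coeffs \<alpha> t n q \<and> (\<forall>j>n. q j = 0)"
    show "q = p"
    proof
      show "q j = p j" for j
        using is_caputo_coeffs_unique[OF assms(1), of t n q p j] p q by (cases "j \<le> n") auto
    qed
  qed
  with p show ?thesis by simp
qed

section \<open>Finite difference scheme on uniform meshes\<close>

definition central_diff :: "(nat \<Rightarrow> real) \<Rightarrow> real \<Rightarrow> nat \<Rightarrow> real" where
  "central_diff w h i = (w (i + 1) - 2 * w i + w (i - 1)) / h\<^sup>2"

definition mesh :: "real \<Rightarrow> nat \<Rightarrow> nat \<Rightarrow> real" where
  "mesh A K k = real k * (A / real K)"

lemma strict_mono_on_mesh:
  assumes "0 < A" "0 < K"
  shows "strict_mono_on S (mesh A K)"
  using assms by (intro strict_mono_onI) (simp add: mesh_def divide_strict_right_mono)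

definition central_diff_second_order :: "real \<Rightarrow> real \<Rightarrow> (real \<Rightarrow> real \<Rightarrow> real) \<Rightarrow> bool" where
  "central_diff_second_order L T u \<longleftrightarrow>
     (\<exists>A h\<^sub>0. 0 < h\<^sub>0 \<and>
       (\<forall>K\<^sub>x K\<^sub>t. 0 < K\<^sub>x \<longrightarrow> 0 < K\<^sub>t \<longrightarrow> L / real K\<^sub>x \<le> h\<^sub>0 \<longrightarrow>
         (\<forall>i\<in>{1..K\<^sub>x - 1}. \<forall>n\<in>{1..K\<^sub>t}.
            \<bar>second_deriv_x u (mesh L K\<^sub>x i) (mesh T K\<^sub>t n)
              - central_diff (\<lambda>k. u (mesh L K\<^sub>x k) (mesh T K\<^sub>t n)) (L / real K\<^sub>x) i\<bar>
            \<le> A * (L / real K\<^sub>x)\<^sup>2)))"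

text \<open>The grid function is indexed as \<open>U i n\<close>, with the space index first.\<close>

definition scheme_solution ::
  "real \<Rightarrow> real \<Rightarrow> real \<Rightarrow> real \<Rightarrow> (real \<Rightarrow> real \<Rightarrow> real) \<Rightarrow> (real \<Rightarrow> real) \<Rightarrow>
   nat \<Rightarrow> nat \<Rightarrow> (nat \<Rightarrow> nat \<Rightarrow> real) \<Rightarrow> bool" where
  "scheme_solution \<alpha> \<rho> L T f \<phi> K\<^sub>x K\<^sub>t U \<longleftrightarrow>
     (\<forall>i\<in>{1..K\<^sub>x - 1}. \<forall>n\<in>{1..K\<^sub>t}.
        1 / Gamma (2 - \<alpha>) * (\<Sum>j=0..n. caputo_coeff \<alpha> (mesh T K\<^sub>t) n j * U i (n - j))
        = \<rho> * central_diff (\<lambda>k. U k n) (L / real K\<^sub>x) i + f (mesh L K\<^sub>x i) (mesh T K\<^sub>t n)) \<and>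
     (\<forall>n\<in>{1..K\<^sub>t}. U 0 n = 0 \<and> U K\<^sub>x n = 0) \<and>
     (\<forall>i\<in>{0..K\<^sub>x}. U i 0 = \<phi> (mesh L K\<^sub>x i))"

end

theory Submission
  imports Defs "HOL-Complex_Analysis.Complex_Analysis"
begin

text \<open>
  On the unit time mesh the scheme is a discrete convolution. Since
  \<open>t powr (-\<alpha>) = \<integral> x powr (\<alpha> - 1) exp (- t x) dx / \<Gamma>(\<alpha>)\<close>, its generating function \<open>\<omega> z\<close> is a mixture over
  \<open>x > 0\<close> of explicit rational functions of \<open>z\<close>. Each of them maps the upper half of the unit disc into one fixed
  sector, so \<open>\<omega>\<close> stays away from the negative axis, with \<open>|\<omega> z| \<ge> c |1 - z| powr \<alpha>\<close> and
  \<open>|\<omega>' z| \<le> C |\<omega> z| / |1 - z|\<close>. In the sector the discrete Laplacian has a resolvent bound in the maximum norm,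
  uniform in the space mesh. Hence the generating function of the response to a unit impulse is holomorphic in the
  disc, and Cauchy's formula bounds the response after \<open>m\<close> steps by \<open>C (m + 1) powr (\<alpha> - 1)\<close>. Summed over time,
  the spatial consistency error contributes \<open>O(h\<^sup>2)\<close>. The temporal consistency errors, although not small near
  \<open>t = 0\<close>, have a sum over the time levels that is bounded independently of the mesh, so they contribute
  \<open>O(\<tau> powr \<alpha>)\<close>. The two starting intervals only add summable multiples of the first two errors, which the
  first two steps control directly.
\<close>

section \<open>The resolvent of the discrete Laplacian\<close>

text \<open>Positivity survives in the Laplace variable \<open>x\<close>, where the densities
  belonging to the three backward differences are nonnegative and ordered, so every estimate of the
  symbol reduces to a real inequality at fixed \<open>x\<close>. The sector is not convex and cannot
  be integrated over directly; either half of it is a convex cone, hence the restriction to half of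
  the disc. The rate reflects a scale invariance. In the variable t / \<tau> the bounds t powr
  (\<alpha> - l) become s powr (\<alpha> - l) with one common factor \<tau> powr \<alpha>, which the
  discrete derivative divides out again. The bounds for the local errors thus depend on the level
  alone, and they are controlled by the convolution of the summable sequences n powr (-1 -
  \<alpha>), from the derivative of the kernel, and n powr (\<alpha> - 4), from the fourth
  derivative of the solution. Normalising the scheme multiplies its data by \<tau> powr \<alpha>,
  which is the rate.\<close>

text \<open>
  For \<open>\<alpha>\<close> near 1 the symbol of the scheme (close to that of BDF3) leaves the right half plane, so the
  maximum principle does not give the resolvent bound; a sector slightly larger than the half plane is needed.
\<close>

definition obtuse_sector :: "complex set" where
  "obtuse_sector = {w. - (7 / 6) * \<bar>Im w\<bar> \<le> Re w}"

text \<open>The equation for \<open>q\<close> is the characteristic equation of the three-term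
  recurrence with spectral parameter \<open>s\<close>. The Cayley variable w = (1 - q) / (1 + q)
  turns it into w^2 = s / (s + 4), so \<open>q\<close> comes from a square root with positive real
  part, and the Stolz angle for \<open>q\<close> from Im w being dominated by Re w.\<close>

lemma sector_root:
  fixes s :: complex
  assumes "s \<in> obtuse_sector" "s \<noteq> 0"
  obtains q where "norm q < 1" "q \<noteq> 0" "s = (1 - q)\<^sup>2 / q" "norm (1 - q) \<le> 10 * (1 - norm q)"
proof -
  have sec: "- (7 / 6) * \<bar>Im s\<bar> \<le> Re s" using assms by (simp add: obtuse_sector_def)
  \<comment> \<open>Keeps \<open>s\<close> away from -4, the pole of s / (s + 4); this leads to
    \<open>norm w \<le> 2\<close> below.\<close>
  have s4: "norm s \<le> 2 * norm (s + 4)"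
  proof (cases "Re s \<ge> 0")
    case True
    then have "(norm s)\<^sup>2 \<le> (norm (s + 4))\<^sup>2"
      unfolding cmod_power2 by (simp add: power2_eq_square algebra_simps)
    then show ?thesis by (smt (verit) norm_ge_zero power2_le_imp_le)
  next
    case False
    then have "\<bar>Re s\<bar> \<le> \<bar>(7/6) * Im s\<bar>" using sec by (simp add: abs_mult)
    then have "(Re s)\<^sup>2 \<le> ((7/6) * Im s)\<^sup>2" by (simp only: abs_le_square_iff)
    then have "(Re s)\<^sup>2 \<le> (49/36) * (Im s)\<^sup>2" by (simp add: power_mult_distrib power_divide)
    then have "(norm s)\<^sup>2 \<le> (2 * norm (s + 4))\<^sup>2"
      unfolding power_mult_distrib cmod_power2
      by (simp add: ) (smt (verit, best) zero_le_power2)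
    then show ?thesis by (smt (verit) norm_ge_zero power2_le_imp_le)
  qed
  have ns4: "s + 4 \<noteq> 0" using s4 assms(2) by auto
  define W where "W = s / (s + 4)"
  define w where "w = csqrt W"
  have ww: "w\<^sup>2 = W" by (simp add: w_def)
  have "W \<noteq> 0" using assms ns4 by (simp add: W_def)
  then have w0: "w \<noteq> 0" using ww by auto
  define a b where "a = Re w" and "b = Im w"
  have a0: "a \<ge> 0" using Re_csqrt by (simp add: a_def w_def)
  have Weq: "W = ((norm s)\<^sup>2 + 4 * s) / (norm (s + 4))\<^sup>2"
  proof -
    have "cnj (s + 4) \<noteq> 0" using ns4 by (metis complex_cnj_zero_iff)
    then have "W = s * cnj (s + 4) / ((s + 4) * cnj (s + 4))" unfolding W_def by (metis mult_divide_mult_cancel_right)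
    also have "\<dots> = ((norm s)\<^sup>2 + 4 * s) / (norm (s + 4))\<^sup>2"
      by (simp only: complex_norm_square) (simp add: algebra_simps)
    finally show ?thesis .
  qed
  have "Re W = ((norm s)\<^sup>2 + 4 * Re s) / (norm (s + 4))\<^sup>2" "Im W = 4 * Im s / (norm (s + 4))\<^sup>2"
    unfolding Weq by (simp_all flip: of_real_power)
  moreover have "- (7/6) * \<bar>4 * Im s\<bar> \<le> (norm s)\<^sup>2 + 4 * Re s" 
    using sec zero_le_power2[of "norm s"] unfolding abs_mult abs_numeral by linarith
  then have "- (7/6) * \<bar>4 * Im s\<bar> / (norm (s + 4))\<^sup>2 \<le> ((norm s)\<^sup>2 + 4 * Re s) / (norm (s + 4))\<^sup>2"
    by (intro divide_right_mono) auto
  ultimately have "- (7/6) * \<bar>Im W\<bar> \<le> Re W" by simp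
  then have "- (7/6) * \<bar>2 * a * b\<bar> \<le> a\<^sup>2 - b\<^sup>2"
    unfolding ww[symmetric] by (simp add: a_def b_def power2_eq_square mult_ac)
  \<comment> \<open>The sector condition for W = w^2, with real part a^2 - b^2 and imaginary part 2
    a b. It is a quadratic inequality for b / a and confines w to a fixed cone about the positive
    axis.\<close>
  then have ab: "b\<^sup>2 \<le> a\<^sup>2 + (7/3) * a * \<bar>b\<bar>" using a0 by (simp add: abs_mult)
  have b3: "\<bar>b\<bar> \<le> 3 * a"
  proof (rule ccontr)
    assume n: "\<not> ?thesis"
    then have "3 * a * \<bar>b\<bar> \<le> \<bar>b\<bar> * \<bar>b\<bar>" by (intro mult_right_mono) auto
    moreover have "a * (3 * a) \<le> a * \<bar>b\<bar>" using n a0 by (intro mult_left_mono) auto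
    ultimately have "a * a \<le> 0" using ab by (simp add: power2_eq_square)
    then have "a = 0" by (metis antisym mult_eq_0_iff zero_le_square)
    then have "b = 0" using ab by simp
    then show False using n a0 by simp
  qed
  have apos: "a > 0"
  proof (rule ccontr)
    assume "\<not> ?thesis"
    then have "a = 0" "b = 0" using a0 b3 by auto
    then show False using w0 by (simp add: a_def b_def complex_eq_iff)
  qed
  have "(norm w)\<^sup>2 \<le> (10/3*a)\<^sup>2"
  proof -
    have "\<bar>b\<bar>^2 \<le> (3*a)\<^sup>2" using b3 by (intro power_mono) auto
    moreover have "(norm w)\<^sup>2 = a\<^sup>2 + b\<^sup>2" by (simp add: cmod_power2 a_def b_def)
    moreover have "(10/3*a)\<^sup>2 = 100/9 * a\<^sup>2" "\<bar>b\<bar>\<^sup>2 = b\<^sup>2" "(3*a)\<^sup>2 = 9 * a\<^sup>2"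
      by (simp_all add: power_mult_distrib power_divide)
    ultimately show ?thesis using zero_le_power2[of a] by linarith
  qed
  then have wa: "norm w \<le> 10/3 * a" by (rule power2_le_imp_le) (use apos in simp)
  have "(norm w)\<^sup>2 = norm W" by (simp flip: ww add: norm_power)
  also have "\<dots> \<le> 2" using s4 ns4 by (simp add: W_def norm_divide field_simps)
  finally have "(norm w)\<^sup>2 \<le> 2\<^sup>2" by simp
  then have w2: "norm w \<le> 2" by (rule power2_le_imp_le) simp
  define q where "q = (1 - w) / (1 + w)"
  have nw1: "1 + w \<noteq> 0" using apos by (auto simp: a_def complex_eq_iff)
  have w1: "w \<noteq> 1" using ww ns4 by (auto simp: W_def field_simps)
  have q0: "q \<noteq> 0" using w1 nw1 by (simp add: q_def)
  have 1: "1 - q = 2 * w / (1 + w)" using nw1 by (simp add: q_def field_simps)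
  have "(1 - q)\<^sup>2 / q = 4 * w\<^sup>2 / ((1 + w) * (1 - w))"
  proof -
    have "(2 * w / u)\<^sup>2 / (v / u) = 4 * w\<^sup>2 / (u * v)" if "u \<noteq> 0" "v \<noteq> 0" for u v :: complex
      using that by (simp add: power2_eq_square)
    from this[of "1 + w" "1 - w"] show ?thesis unfolding 1 using nw1 w1 by (simp add: q_def)
  qed
  also have "\<dots> = 4 * W / (1 - W)" using ww by (simp add: power2_eq_square algebra_simps)
  also have "\<dots> = s"
  proof -
    have "1 - W = 4 / (s + 4)" using ns4 by (simp add: W_def field_simps)
    then show ?thesis using ns4 by (simp add: W_def)
  qed
  finally have s: "s = (1 - q)\<^sup>2 / q" by simp
  have nq: "1 - (norm q)\<^sup>2 = 4 * a / (norm (1 + w))\<^sup>2"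
  proof -
    have "(norm (1 + w))\<^sup>2 - (norm (1 - w))\<^sup>2 = 4 * a"
      unfolding cmod_power2 by (simp add: a_def power2_eq_square algebra_simps)
    then have "4 * a = (norm (1 + w))\<^sup>2 - (norm (1 - w))\<^sup>2" ..
    moreover have "(norm q)\<^sup>2 = (norm (1 - w))\<^sup>2 / (norm (1 + w))\<^sup>2"
      by (simp only: q_def norm_divide power_divide)
    ultimately show ?thesis using nw1 by (simp add: diff_divide_distrib)
  qed
  then have "(norm q)\<^sup>2 < 1\<^sup>2" using apos nw1 by (smt (verit) divide_pos_pos power_one zero_less_norm_iff zero_less_power)
  then have q1: "norm q < 1" by (rule power2_less_imp_less) simp
  have "2 * a / (norm (1 + w))\<^sup>2 \<le> 1 - norm q"
  proof -
    have "1 - (norm q)\<^sup>2 = (1 - norm q) * (1 + norm q)" by (simp add: power2_eq_square algebra_simps)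
    also have "\<dots> \<le> (1 - norm q) * 2" using q1 by (intro mult_left_mono) auto
    finally show ?thesis unfolding nq by simp
  qed
  \<comment> \<open>The constant is (10/3) * 3, from \<open>wa\<close> and
    \<open>norm (1 + w) \<le> 3\<close>.\<close>
  moreover have "norm (1 - q) \<le> 10 * (2 * a / (norm (1 + w))\<^sup>2)"
  proof -
    have "norm (1 + w) \<le> 3" using w2 norm_triangle_ineq[of 1 w] by simp
    then have "norm w * norm (1 + w) \<le> (10/3*a) * 3" using wa a0 by (intro mult_mono) auto
    then have "2 * norm w / norm (1 + w) \<le> 20 * a / (norm (1 + w))\<^sup>2"
      using nw1 by (simp add: field_simps power2_eq_square)
    then show ?thesis unfolding 1 by (simp add: norm_divide norm_mult)
  qed
  ultimately have "norm (1 - q) \<le> 10 * (1 - norm q)" by simp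
  with q1 q0 s show ?thesis by (rule that)
qed

text \<open>
  Odd reflection at both ends makes the problem \<open>2 K\<close>-periodic. With \<open>(1 - q)\<^sup>2 / q = \<omega> / \<mu>\<close> and the shift \<open>S\<close>,
  the operator is then \<open>\<mu> / q\<close> times \<open>(1 - q S) (1 - q S\<^sup>*)\<close>, so its inverse is at most \<open>|q| / (\<mu> (1 - |q|)\<^sup>2)\<close>,
  and the Stolz angle bound on \<open>q\<close> turns this into \<open>100 / |\<omega>|\<close>.
\<close>

lemma discrete_resolvent_bound:
  fixes E r :: "nat \<Rightarrow> complex"
  assumes sec: "\<omega> \<in> obtuse_sector" "\<omega> \<noteq> 0" and mu: "0 < \<mu>"
    and bc: "E 0 = 0" "E K = 0"
    and eq: "\<And>i. 1 \<le> i \<Longrightarrow> i < K \<Longrightarrow> \<omega> * E i + of_real \<mu> * (2 * E i - E (i + 1) - E (i - 1)) = r i"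
    and r: "\<And>i. 1 \<le> i \<Longrightarrow> i < K \<Longrightarrow> norm (r i) \<le> B" and B: "0 \<le> B"
    and i: "i \<le> K"
  shows "norm (E i) \<le> 100 * B / norm \<omega>"
proof (cases "K = 0")
  case True
  then show ?thesis using i bc B by simp
next
  case False
  define s where "s = \<omega> / of_real \<mu>"
  have "s \<in> obtuse_sector" "s \<noteq> 0"
    using sec mu by (auto simp: s_def obtuse_sector_def field_simps)
  then obtain q where q: "norm q < 1" "q \<noteq> 0" "s = (1 - q)\<^sup>2 / q" "norm (1 - q) \<le> 10 * (1 - norm q)"
    by (rule sector_root)
  define X where "X j = (if j \<le> K then E j else - E (2 * K - j))" for j
  \<comment> \<open>One factor, 1 - q S, applied to \<open>X\<close> over one period. The value at
    \<open>2 * K + 1\<close> repeats \<open>F 1\<close>, so that a maximum over one period closes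
    the recursion in \<open>step\<close>.\<close>
  define F where "F j = (if j \<le> 2 * K then X j - q * X (j - 1) else X 1 - q * X 0)" for j
  define c where "c = norm q * B / \<mu>"
  have base: "E j - q * E (j - 1) - q * (E (j + 1) - q * E j) = q * r j / \<mu>" if "1 \<le> j" "j < K" for j
  proof -
    have "\<omega> = \<mu> * s" using mu by (simp add: s_def)
    then have "of_real \<mu> * ((s + 2) * E j - E (j + 1) - E (j - 1)) = r j"
      using eq[OF that] by (simp add: algebra_simps)
    then have "(s + 2) * E j - E (j + 1) - E (j - 1) = r j / \<mu>" using mu by (simp add: field_simps)
    moreover have "q * (s + 2) = 1 + q\<^sup>2" using q by (simp add: power2_eq_square field_simps)
    ultimately have "(1 + q\<^sup>2) * E j - q * E (j + 1) - q * E (j - 1) = q * r j / \<mu>"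
      by (metis (no_types, opaque_lifting) mult.assoc right_diff_distrib times_divide_eq_right)
    then show ?thesis by (simp add: algebra_simps power2_eq_square)
  qed
  have step: "norm (F j) \<le> norm q * norm (F (j + 1)) + c" if j: "1 \<le> j" "j \<le> 2 * K" for j
  proof -
    have "norm (F j - q * F (j + 1)) \<le> c"
    proof -
      consider "j < K" | "j = K" | "K < j" "j < 2 * K" | "j = 2 * K" using j by linarith
      then show ?thesis
      proof cases
        case 1
        then have "X j = E j" "X (j + 1) = E (j + 1)" "X (j - 1) = E (j - 1)" by (auto simp: X_def)
        then have "F j - q * F (j + 1) = q * r j / \<mu>" using base[of j] j 1 by (simp add: F_def)
        then show ?thesis using r[of j] 1 j mu by (simp add: c_def norm_mult norm_divide divide_right_mono mult_left_mono)
      next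
        case 2
        \<comment> \<open>At the reflection points \<open>K\<close> and \<open>2 * K\<close> the odd
          extension solves the homogeneous equation.\<close>
        have "F j - q * F (j + 1) = 0" using 2 j bc False
          by (cases "K = 1") (auto simp: F_def X_def)
        then show ?thesis using B mu by (simp add: c_def)
      next
        case 3
        define l where "l = 2 * K - j"
        have l: "1 \<le> l" "l < K" using 3 by (auto simp: l_def)
        have x: "X j = - E l" "X (j + 1) = - E (l - 1)" "X (j - 1) = - E (l + 1)"
        proof -
          show "X j = - E l" "X (j + 1) = - E (l - 1)" using 3 by (auto simp: X_def l_def)
          show "X (j - 1) = - E (l + 1)"
          proof (cases "j - 1 = K")
            case True then have "l + 1 = K" using 3 by (auto simp: l_def)
            then show ?thesis using True bc by (simp add: X_def)
          next
            case False
            then have "\<not> j - 1 \<le> K" "2 * K - (j - 1) = l + 1" using 3 by (auto simp: l_def)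
            then show ?thesis unfolding X_def by simp
          qed
        qed
        have "F j - q * F (j + 1) = (X j - q * X (j - 1)) - q * (X (j + 1) - q * X j)"
          using 3 by (simp add: F_def)
        also have "\<dots> = - (E l - q * E (l - 1) - q * (E (l + 1) - q * E l))"
          unfolding x by (simp add: algebra_simps)
        also have "\<dots> = - (q * r l / \<mu>)" using base[OF l] by simp
        finally show ?thesis using r[OF l] mu by (simp add: c_def norm_mult norm_divide divide_right_mono mult_left_mono)
      next
        case 4
        have "X j = 0" "X (j - 1) = - X 1"
        proof -
          show "X j = 0" using 4 False bc by (simp add: X_def)
          show "X (j - 1) = - X 1"
            using 4 False bc by (cases "K = 1") (auto simp: X_def)
        qed
        then have "F j - q * F (j + 1) = 0" using 4 bc False by (simp add: F_def X_def)
        then show ?thesis using B mu by (simp add: c_def)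
      qed
    qed
    moreover have "norm (F j) \<le> norm (F j - q * F (j + 1)) + norm (q * F (j + 1))"
      by (metis norm_triangle_sub add.commute)
    ultimately show ?thesis by (simp add: norm_mult)
  qed
  \<comment> \<open>At an index where the norm is maximal the recursion reads S <= |q| S + c. The
    second factor is inverted in the same way with \<open>Y\<close>; each inversion costs 1 / (1 -
    |q|).\<close>
  define S where "S = Max ((\<lambda>j. norm (F j)) ` {1..2*K})"
  have S: "norm (F j) \<le> S" if "1 \<le> j" "j \<le> 2 * K" for j
    unfolding S_def using that by (intro Max_ge) auto
  have S': "norm (F (j + 1)) \<le> S" if "1 \<le> j" "j \<le> 2 * K" for j
  proof (cases "j = 2 * K")
    case True
    then have "F (j + 1) = F 1" using False by (simp add: F_def)
    then show ?thesis using S[of 1] False by simp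
  qed (use S[of "j+1"] that in auto)
  have "S \<in> (\<lambda>j. norm (F j)) ` {1..2*K}" unfolding S_def using False by (intro Max_in) auto
  then obtain j where j: "1 \<le> j" "j \<le> 2 * K" "S = norm (F j)" by auto
  have "S \<le> norm q * S + c" using step[OF j(1,2)] S'[OF j(1,2)] j(3)
    by (smt (verit) mult_left_mono norm_ge_zero)
  then have S1: "(1 - norm q) * S \<le> c" by (simp add: algebra_simps)
  define Y where "Y = Max ((\<lambda>j. norm (X j)) ` {0..2*K})"
  have Y: "norm (X j) \<le> Y" if "j \<le> 2 * K" for j
    unfolding Y_def using that by (intro Max_ge) auto
  have "Y \<in> (\<lambda>j. norm (X j)) ` {0..2*K}" unfolding Y_def by (intro Max_in) auto
  then obtain j where j: "j \<le> 2 * K" "Y = norm (X j)" by auto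
  have S0: "0 \<le> S" using S[of 1] False by (smt (verit) norm_ge_zero le_add2 mult_2 le_refl not_gr0 One_nat_def Suc_leI trans_le_add1)
  have "Y \<le> norm q * Y + S"
  proof (cases "j = 0")
    case True then show ?thesis using j bc S0 by (simp add: X_def)
  next
    case False
    then have "X j = F j + q * X (j - 1)" using j by (simp add: F_def)
    then have "Y \<le> norm (F j) + norm q * norm (X (j - 1))" using j(2) by (metis norm_mult norm_triangle_ineq)
    also have "\<dots> \<le> S + norm q * Y" using False j by (intro add_mono S mult_left_mono Y) auto
    finally show ?thesis by simp
  qed
  then have "(1 - norm q) * Y \<le> S" by (simp add: algebra_simps)
  then have "(1 - norm q) * ((1 - norm q) * Y) \<le> (1 - norm q) * S" using q by (intro mult_left_mono) auto
  with S1 have Y1: "(1 - norm q)\<^sup>2 * Y \<le> c" by (simp add: power2_eq_square mult.assoc)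
  have Y0: "0 \<le> Y" using Y[of 0] by (smt (verit) norm_ge_zero zero_le)
  have "norm \<omega> = \<mu> * norm s" using mu by (simp add: s_def norm_divide)
  also have "norm s = (norm (1 - q))\<^sup>2 / norm q" using q by (simp add: norm_divide norm_power)
  finally have "norm \<omega> * Y = \<mu> / norm q * ((norm (1 - q))\<^sup>2 * Y)" by simp
  also have "\<dots> \<le> \<mu> / norm q * ((10 * (1 - norm q))\<^sup>2 * Y)"
    using q mu Y0 by (intro mult_left_mono mult_right_mono power_mono) auto
  also have "\<dots> = 100 * \<mu> / norm q * ((1 - norm q)\<^sup>2 * Y)" unfolding power_mult_distrib by simp
  also have "\<dots> \<le> 100 * \<mu> / norm q * c" using Y1 mu by (intro mult_left_mono) auto
  also have "\<dots> = 100 * B" using q mu by (simp add: c_def)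
  finally have "Y \<le> 100 * B / norm \<omega>" using sec by (simp add: field_simps)
  moreover have "norm (E i) \<le> Y" using Y[of i] i by (simp add: X_def)
  ultimately show ?thesis by simp
qed

section \<open>The symbol of the scheme\<close>

text \<open>
  With \<open>d = 1 - Re z\<close>, \<open>s = Im z\<close> and \<open>\<epsilon> = 1 - |z|\<^sup>2\<close>, so that \<open>s\<^sup>2 = 2 d - d\<^sup>2 - \<epsilon>\<close>.
\<close>

lemma kernel_symbol_im:
  fixes A B C y d s \<epsilon> :: real
  assumes y: "0 \<le> y" "y < 1" and C: "0 \<le> C" "C \<le> B" and d: "0 \<le> d" and e: "0 \<le> \<epsilon>"
    and s: "s\<^sup>2 = 2 * d - d\<^sup>2 - \<epsilon>"
  shows "(1 - y) * A \<le> (1 - y) * A + B * (2 * d - y * \<epsilon>)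
      + C * (4 * d\<^sup>2 - 2 * d * (1 - y) + \<epsilon> * (1 - y) - 2 * d * y * \<epsilon>)"
proof -
  have e2: "\<epsilon> \<le> 2 * d" using s zero_le_power2[of s] zero_le_power2[of d] by linarith
  have ye: "y * \<epsilon> \<le> \<epsilon>" using y e by (simp add: mult_left_le_one_le)
  have yd: "y * \<epsilon> \<le> y * (2 * d)" using e2 y by (intro mult_left_mono) auto
  \<comment> \<open>The bracket multiplied by \<open>C\<close> may be negative because of - 2 d (1 -
    y). Since C <= B, the \<open>B\<close> term lends it the missing 2 d - y \<epsilon>.\<close>
  have "C * (2 * d - y * \<epsilon>) \<le> B * (2 * d - y * \<epsilon>)"
    using ye e2 C by (intro mult_right_mono) auto
  moreover have "0 \<le> C * (4 * d\<^sup>2 + 2 * d * y + \<epsilon> * (1 - 2 * y) - 2 * d * y * \<epsilon>)"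
  proof (rule mult_nonneg_nonneg)
    have "d * (y * \<epsilon>) \<le> d * (2 * d)" using d ye e2 by (intro mult_left_mono) auto
    then show "0 \<le> 4 * d\<^sup>2 + 2 * d * y + \<epsilon> * (1 - 2 * y) - 2 * d * y * \<epsilon>"
      using yd ye by (simp add: power2_eq_square algebra_simps)
  qed (rule C)
  ultimately show ?thesis by (simp add: algebra_simps)
qed

text \<open>The slope 7/6 of the sector originates here as 1/2 + 2/3. Facts \<open>1\<close> and
  \<open>2\<close> bound the negative terms with s^2 (1 - y), using B <= A / 2, C <= A / 3 and d <=
  2, by multiples of s (1 - y) A; this quantity is also the lower bound for the modulus of the
  imaginary part, so the sector tolerates it. The third negative term, with \<open>C\<close>, is
  absorbed by the \<open>A\<close> term.\<close>

lemma kernel_symbol_re: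
  fixes A B C y d s \<epsilon> :: real
  assumes y: "0 \<le> y" "y < 1" and C: "0 \<le> C" "C \<le> B" "B \<le> A / 2" "C \<le> A / 3"
    and d: "0 \<le> d" and e: "0 \<le> \<epsilon>" and s: "s\<^sup>2 = 2 * d - d\<^sup>2 - \<epsilon>" "0 \<le> s" "s \<le> 1"
  shows "A / 12 * ((2 * d - \<epsilon>) + d * (1 - y)) - (7 / 6) * s * (1 - y) * A
    \<le> A * (d * (1 + y) - y * \<epsilon>) + B * (d * (d * (1 + y) - y * \<epsilon>) - s\<^sup>2 * (1 - y))
      + C * (d\<^sup>2 * (d * (1 + y) - y * \<epsilon>) - d * s\<^sup>2 * (1 - y) - s\<^sup>2 * (2 * d - y * \<epsilon>))"
proof -
  have e2: "\<epsilon> \<le> 2 * d" using s(1) zero_le_power2[of s] zero_le_power2[of d] by linarith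
  have d2: "d \<le> 2"
  proof (rule ccontr)
    assume "\<not> d \<le> 2"
    then have "2 * d < d * d" by (intro mult_strict_right_mono) auto
    then show False using s(1) e zero_le_power2[of s] unfolding power2_eq_square by linarith
  qed
  have A: "0 \<le> A" using C by simp
  have ye: "y * \<epsilon> \<le> \<epsilon>" using y e by (simp add: mult_left_le_one_le)
  have s2: "s\<^sup>2 \<le> s" "s\<^sup>2 \<le> 1"
    unfolding power2_eq_square using s(2,3) by (simp_all add: mult_left_le_one_le mult_le_one)
  have q0: "0 \<le> d * (1 + y) - y * \<epsilon>"
  proof -
    have "y * \<epsilon> \<le> y * (2 * d)" using e2 y by (intro mult_left_mono) auto
    moreover have "y * d \<le> d" using y d by (simp add: mult_left_le_one_le)
    ultimately show ?thesis by (simp add: algebra_simps)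
  qed
  have 1: "B * (s\<^sup>2 * (1 - y)) \<le> (1 / 2) * s * (1 - y) * A"
  proof -
    have "B * (s\<^sup>2 * (1 - y)) \<le> (A / 2) * (s * (1 - y))"
      using C y s2 s(2,3) by (intro mult_mono mult_right_mono mult_nonneg_nonneg) auto
    then show ?thesis by (simp add: algebra_simps)
  qed
  have 2: "C * (d * s\<^sup>2 * (1 - y)) \<le> (2 / 3) * s * (1 - y) * A"
  proof -
    have "C * (d * s\<^sup>2 * (1 - y)) \<le> (A / 3) * (2 * s * (1 - y))"
      using C y s2 s(2,3) d d2 A by (intro mult_mono mult_right_mono mult_nonneg_nonneg) auto
    then show ?thesis by (simp add: algebra_simps)
  qed
  have 3: "C * (s\<^sup>2 * (2 * d - y * \<epsilon>)) \<le> A / 3 * (2 * d - y * \<epsilon>)"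
  proof -
    have "s\<^sup>2 * (2 * d - y * \<epsilon>) \<le> 2 * d - y * \<epsilon>"
      using s2 ye e2 by (intro mult_left_le_one_le) auto
    then show ?thesis using C ye e2 A by (intro mult_mono) auto
  qed
  have 4: "0 \<le> B * (d * (d * (1 + y) - y * \<epsilon>))" "0 \<le> C * (d\<^sup>2 * (d * (1 + y) - y * \<epsilon>))"
    using q0 C d by (intro mult_nonneg_nonneg; simp)+
  have 5: "A / 12 * ((2 * d - \<epsilon>) + d * (1 - y))
    \<le> A * (d * (1 + y) - y * \<epsilon>) - A / 3 * (2 * d - y * \<epsilon>)"
  proof -
    \<comment> \<open>For y >= 1/3 the part with 8 y dominates 2 d - \<epsilon>; for smaller y it is
      d (1 - y) >= 2 d / 3 that does.\<close>
    have "(2 * d - \<epsilon>) + d * (1 - y) \<le> 4 * d * (1 - y) + 8 * y * (2 * d - \<epsilon>)"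
    proof (cases "y \<ge> 1/3")
      case True
      then have "1 * (2 * d - \<epsilon>) \<le> (8 * y) * (2 * d - \<epsilon>)" using e2 by (intro mult_right_mono) auto
      moreover have "0 \<le> d * (1 - y)" using d y by simp
      ultimately show ?thesis by (simp add: algebra_simps)
    next
      case False
      then have "d * (2/3) \<le> d * (1 - y)" using d by (intro mult_left_mono) auto
      moreover have "0 \<le> 8 * y * (2 * d - \<epsilon>)" using y e2 by simp
      moreover have "4 * d * (1 - y) = 4 * (d * (1 - y))" by simp
      ultimately show ?thesis using e by linarith
    qed
    then have "A / 12 * ((2 * d - \<epsilon>) + d * (1 - y)) \<le> A / 12 * (4 * d * (1 - y) + 8 * y * (2 * d - \<epsilon>))"
      using A by (intro mult_left_mono) auto
    then show ?thesis by (simp add: algebra_simps)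
  qed
  define t where "t = s * (1 - y) * A"
  have t: "(1 / 2) * s * (1 - y) * A = t / 2" "(2 / 3) * s * (1 - y) * A = 2 * t / 3"
    "(7 / 6) * s * (1 - y) * A = 7 * t / 6" by (simp_all add: t_def)
  have "A * (d * (1 + y) - y * \<epsilon>) + B * (d * (d * (1 + y) - y * \<epsilon>) - s\<^sup>2 * (1 - y))
      + C * (d\<^sup>2 * (d * (1 + y) - y * \<epsilon>) - d * s\<^sup>2 * (1 - y) - s\<^sup>2 * (2 * d - y * \<epsilon>))
    = A * (d * (1 + y) - y * \<epsilon>) + B * (d * (d * (1 + y) - y * \<epsilon>)) - B * (s\<^sup>2 * (1 - y))
      + C * (d\<^sup>2 * (d * (1 + y) - y * \<epsilon>)) - C * (d * s\<^sup>2 * (1 - y)) - C * (s\<^sup>2 * (2 * d - y * \<epsilon>))"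
    by (simp only: right_diff_distrib)
  then show ?thesis using 1 2 3 4 5 unfolding t by linarith
qed

text \<open>The conclusions are linear inequalities in Re h and Im h and hence survive integration
  over \<open>y\<close>; the orderings of \<open>A\<close>, \<open>B\<close>, \<open>C\<close> are
  those of the Laplace densities. The functional Re h - 2 Im h is nonnegative on the cone of the
  first two conclusions and serves to keep the integral away from 0.\<close>

lemma kernel_symbol:
  fixes A B C y :: real and z :: complex
  defines "h \<equiv> (1 - z) * (of_real A + of_real B * (1 - z) + of_real C * (1 - z)\<^sup>2) / (1 - of_real y * z)"
  assumes y: "0 \<le> y" "y < 1" and C: "0 \<le> C" "C \<le> B" "B \<le> A / 2" "C \<le> A / 3"
    and z: "norm z \<le> 1" "0 \<le> Im z"
  shows "Im h \<le> 0" "(7 / 6) * Im h \<le> Re h"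
    "A / 24 * (norm (1 - z) / norm (1 - of_real y * z)) \<le> Re h - 2 * Im h"
proof -
  define d s \<epsilon> where "d = 1 - Re z" and "s = Im z" and "\<epsilon> = 1 - (norm z)\<^sup>2"
  have s: "s\<^sup>2 = 2 * d - d\<^sup>2 - \<epsilon>" "0 \<le> s" "s \<le> 1"
    using z abs_Im_le_cmod[of z] unfolding d_def s_def \<epsilon>_def cmod_power2
    by (auto simp: power2_eq_square algebra_simps)
  have d: "0 \<le> d" using z complex_Re_le_cmod[of z] by (simp add: d_def)
  have e: "0 \<le> \<epsilon>" using z by (simp add: \<epsilon>_def power_le_one)
  have e2: "\<epsilon> \<le> 2 * d" using s(1) zero_le_power2[of s] zero_le_power2[of d] by linarith
  define D where "D = (norm (1 - of_real y * z))\<^sup>2"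
  have nz: "1 - of_real y * z \<noteq> 0"
  proof
    assume "1 - of_real y * z = 0"
    then have "norm (of_real y * z) = 1" by (metis eq_iff_diff_eq_0 norm_one)
    moreover have "norm (of_real y * z) \<le> y * 1" unfolding norm_mult using y z by (intro mult_mono) auto
    ultimately show False using y by simp
  qed
  have D: "D > 0" using nz by (simp add: D_def)
  define N where "N = (1 - z) * (of_real A + of_real B * (1 - z) + of_real C * (1 - z)\<^sup>2) * cnj (1 - of_real y * z)"
  have hN: "h = N / of_real D"
  proof -
    have "of_real D = (1 - of_real y * z) * cnj (1 - of_real y * z)"
      unfolding D_def by (metis complex_norm_square)
    moreover have "cnj (1 - of_real y * z) \<noteq> 0" using nz by (metis complex_cnj_zero_iff)
    ultimately show ?thesis unfolding h_def N_def by (metis mult_divide_mult_cancel_right)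
  qed
  have z_eq: "z = Complex (1 - d) s" by (simp add: d_def s_def)
  have ImN: "Im N = - s * ((1 - y) * A + B * (2 * d - y * \<epsilon>)
      + C * (4 * d\<^sup>2 - 2 * d * (1 - y) + \<epsilon> * (1 - y) - 2 * d * y * \<epsilon>))"
  proof -
    have "\<epsilon> = 2 * d - d\<^sup>2 - s\<^sup>2" using s(1) by simp
    then show ?thesis unfolding N_def z_eq
      by (simp add: power2_eq_square) (simp add: algebra_simps)
  qed
  have ReN: "Re N = A * (d * (1 + y) - y * \<epsilon>) + B * (d * (d * (1 + y) - y * \<epsilon>) - s\<^sup>2 * (1 - y))
      + C * (d\<^sup>2 * (d * (1 + y) - y * \<epsilon>) - d * s\<^sup>2 * (1 - y) - s\<^sup>2 * (2 * d - y * \<epsilon>))"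
  proof -
    have "\<epsilon> = 2 * d - d\<^sup>2 - s\<^sup>2" using s(1) by simp
    then show ?thesis unfolding N_def z_eq
      by (simp add: power2_eq_square) (simp add: algebra_simps)
  qed
  have A: "0 \<le> A" using C by simp
  have im: "s * ((1 - y) * A) \<le> - Im N"
    unfolding ImN using kernel_symbol_im[OF y C(1,2) d e s(1)] s(2)
    by (simp add: mult_left_mono)
  have re: "A / 12 * ((2 * d - \<epsilon>) + d * (1 - y)) - (7 / 6) * (s * ((1 - y) * A)) \<le> Re N"
    unfolding ReN using kernel_symbol_re[OF y C d e s] by (simp add: mult.assoc)
  have p: "0 \<le> s * ((1 - y) * A)" using s y A by simp
  then have "Im N \<le> 0" using im by simp
  then show "Im h \<le> 0" using D by (simp add: hN divide_nonpos_pos)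
  have q: "0 \<le> A / 12 * ((2 * d - \<epsilon>) + d * (1 - y))" using A e2 d y by simp
  have "(7 / 6) * Im N \<le> Re N" using re im q by linarith
  then have "(7 / 6) * Im N / D \<le> Re N / D" using D by (intro divide_right_mono) auto
  then show "(7 / 6) * Im h \<le> Re h" by (simp add: hN)
  \<comment> \<open>Subtracting 2 Im instead of (7/6) Im leaves 5/6 of the imaginary part over,
    which supplies the term with s (1 - y).\<close>
  have L: "A / 24 * ((2 * d - \<epsilon>) + (d + s) * (1 - y)) \<le> Re N - 2 * Im N"
  proof -
    have "A / 24 * ((2 * d - \<epsilon>) + (d + s) * (1 - y))
        = A / 12 * ((2 * d - \<epsilon>) + d * (1 - y)) / 2 + s * ((1 - y) * A) / 24"
      by (simp add: field_simps)
    then show ?thesis using re im p q by linarith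
  qed
  have n1: "norm (1 - z) \<le> d + s"
    using cmod_le[of "1 - z"] d s by (simp add: d_def s_def)
  have n2: "(norm (1 - z))\<^sup>2 = 2 * d - \<epsilon>"
    unfolding cmod_power2 using s(1) by (simp add: d_def s_def power2_eq_square algebra_simps)
  have "norm (1 - of_real y * z) \<le> norm (1 - z) + (1 - y)"
  proof -
    have "1 - of_real y * z = (1 - z) + of_real (1 - y) * z" by (simp add: algebra_simps)
    then have "norm (1 - of_real y * z) \<le> norm (1 - z) + norm (of_real (1 - y) * z)" by (metis norm_triangle_ineq)
    also have "norm (of_real (1 - y) * z) \<le> (1 - y) * 1" unfolding norm_mult norm_of_real using y z by (intro mult_mono) auto
    finally show ?thesis by simp
  qed
  then have "norm (1 - z) * norm (1 - of_real y * z) \<le> norm (1 - z) * (norm (1 - z) + (1 - y))"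
    by (intro mult_left_mono) auto
  also have "\<dots> \<le> (2 * d - \<epsilon>) + (d + s) * (1 - y)"
    unfolding n2[symmetric] using mult_right_mono[OF n1, of "1 - y"] y by (simp add: power2_eq_square algebra_simps)
  finally have "A / 24 * (norm (1 - z) * norm (1 - of_real y * z)) \<le> Re N - 2 * Im N"
    using L A by (smt (verit) mult_left_mono divide_nonneg_nonneg)
  then have "A / 24 * (norm (1 - z) * norm (1 - of_real y * z)) / D \<le> (Re N - 2 * Im N) / D"
    using D by (intro divide_right_mono) auto
  moreover have "A / 24 * (norm (1 - z) * norm (1 - of_real y * z)) / D = A / 24 * (norm (1 - z) / norm (1 - of_real y * z))"
    using nz by (simp add: D_def power2_eq_square)
  ultimately show "A / 24 * (norm (1 - z) / norm (1 - of_real y * z)) \<le> Re h - 2 * Im h"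
    by (simp add: hN diff_divide_distrib)
qed

section \<open>Laplace representation of the moments of the kernel over the mesh cells\<close>

definition gamma_weight :: "real \<Rightarrow> real \<Rightarrow> real" where
  "gamma_weight \<alpha> x = indicator {0<..} x * x powr (\<alpha> - 1) / Gamma \<alpha>"

definition cell_laplace :: "(real \<Rightarrow> real) \<Rightarrow> real \<Rightarrow> real" where
  "cell_laplace g x = (LINT s:{0..1}|lborel. exp (- (s * x)) * g s)"

text \<open>Here \<open>s\<close> is the distance from the right end of a cell and \<open>j\<close>
  the number of cells between that end and the evaluation point.\<close>

definition cell_moment :: "real \<Rightarrow> (real \<Rightarrow> real) \<Rightarrow> nat \<Rightarrow> real" where
  "cell_moment \<alpha> g j = (LINT s:{0..1}|lborel. (real j + s) powr (-\<alpha>) * g s)"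

lemma gamma_weight_measurable [measurable]: "gamma_weight \<alpha> \<in> borel_measurable borel"
  unfolding gamma_weight_def by measurable

lemma gamma_weight_nonneg: "0 < \<alpha> \<Longrightarrow> 0 \<le> gamma_weight \<alpha> x"
  unfolding gamma_weight_def by (simp add: Gamma_real_pos less_imp_le)

lemma gamma_weight_laplace:
  assumes "0 < \<alpha>" "0 < c"
  shows "has_bochner_integral lborel (\<lambda>x. gamma_weight \<alpha> x * exp (- (c * x))) (c powr (-\<alpha>))"
proof -
  define f where "f t = indicator {0..} t * t powr (\<alpha> - 1) / exp t" for t :: real
  have G: "0 < Gamma \<alpha>" using assms by (rule_tac Gamma_real_pos)
  have "has_bochner_integral lborel f (Gamma \<alpha>)"
    unfolding f_def
  proof (rule has_bochner_integral_nn_integral)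
    show "(\<integral>\<^sup>+ t. ennreal (indicator {0..} t * t powr (\<alpha> - 1) / exp t) \<partial>lborel) = ennreal (Gamma \<alpha>)"
      using Gamma_conv_nn_integral_real[OF assms(1)] by simp
  qed (use G in auto)
  then have "has_bochner_integral lborel (\<lambda>x. f (0 + c * x)) (Gamma \<alpha> /\<^sub>R \<bar>c\<bar>)"
    using lborel_has_bochner_integral_real_affine_iff[of c f "Gamma \<alpha>" 0] assms(2) by simp
  then have "has_bochner_integral lborel (\<lambda>x. (c powr (1 - \<alpha>) / Gamma \<alpha>) * f (0 + c * x))
      ((c powr (1 - \<alpha>) / Gamma \<alpha>) * (Gamma \<alpha> /\<^sub>R \<bar>c\<bar>))"
    by (intro has_bochner_integral_mult_right) auto
  moreover have "(c powr (1 - \<alpha>) / Gamma \<alpha>) * f (0 + c * x) = gamma_weight \<alpha> x * exp (- (c * x))" for x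
  proof -
    have "c powr (1 - \<alpha>) * c powr (\<alpha> - 1) = 1" using assms(2) by (simp flip: powr_add)
    then show ?thesis using assms(2)
      by (auto simp: f_def gamma_weight_def powr_mult exp_minus field_simps indicator_def zero_le_mult_iff
          split: if_splits)
  qed
  moreover have "(c powr (1 - \<alpha>) / Gamma \<alpha>) * (Gamma \<alpha> /\<^sub>R \<bar>c\<bar>) = c powr (- \<alpha>)"
    using assms(2) G by (simp add: powr_diff powr_minus field_simps)
  ultimately show ?thesis by simp
qed

lemma set_integrable_powr_unit:
  fixes \<alpha> :: real
  assumes "0 < \<alpha>" "\<alpha> < 1"
  shows "set_integrable lborel {0..1} (\<lambda>s. s powr (-\<alpha>))"
proof -
  have "set_integrable lborel {0..1} (\<lambda>t. t powr ((1 - \<alpha>) - 1) * (1 - t) powr (1 - 1))"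
    using integrable_Beta[of "1 - \<alpha>" 1] assms by simp
  \<comment> \<open>The Beta integrand differs from the power only at 1, where
    \<open>0 powr 0 = 0\<close>.\<close>
  then show ?thesis
    unfolding set_integrable_def
    by (rule integrable_cong_AE_imp) (auto intro!: AE_I[of _ _ "{1}"] simp: indicator_def split: if_splits)
qed

lemma cell_moment_integrable:
  assumes "0 < \<alpha>" "\<alpha> < 1" and [measurable]: "g \<in> borel_measurable borel"
    and g: "\<And>s. s \<in> {0..1} \<Longrightarrow> \<bar>g s\<bar> \<le> (1::real)"
  shows "set_integrable lborel {0..1} (\<lambda>s. (real j + s) powr (-\<alpha>) * g s)"
proof (rule set_integrable_bound[OF set_integrable_powr_unit[OF assms(1,2)]])
  \<comment> \<open>At 0 the majorant is \<open>0 powr (-\<alpha>) = 0\<close>, whereas the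
    integrand need not vanish for positive \<open>j\<close>; hence the exceptional null set.\<close>
  show "AE s in lborel. s \<in> {0..1} \<longrightarrow> norm ((real j + s) powr (-\<alpha>) * g s) \<le> norm (s powr (-\<alpha>))"
  proof (rule AE_I[of _ _ "{0}"], rule subsetI, clarsimp)
    fix s :: real assume s: "0 \<le> s" "s \<le> 1" and n: "\<not> \<bar>(real j + s) powr (-\<alpha>) * g s\<bar> \<le> s powr (-\<alpha>)"
    show "s = 0"
    proof (rule ccontr)
      assume "s \<noteq> 0"
      then have "(real j + s) powr (-\<alpha>) \<le> s powr (-\<alpha>)" using s assms by (intro powr_mono2') auto
      then have "(real j + s) powr (-\<alpha>) * \<bar>g s\<bar> \<le> s powr (-\<alpha>) * 1" using g[of s] s by (intro mult_mono) auto
      then show False using n by (simp add: abs_mult)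
    qed
  qed auto
qed (auto simp: set_borel_measurable_def)

text \<open>Inserting the Laplace integral of (j + s) powr (-\<alpha>) and exchanging the integrals
  leaves \<open>j\<close> only in the factor (exp (- x)) ^ j. The cell moments are thus power
  moments in y = exp (- x), and the geometric series sums their generating function.\<close>

lemma cell_moment_laplace:
  assumes "0 < \<alpha>" "\<alpha> < 1" and [measurable]: "g \<in> borel_measurable borel"
    and g: "\<And>s. s \<in> {0..1} \<Longrightarrow> \<bar>g s\<bar> \<le> (1::real)"
  shows "has_bochner_integral lborel (\<lambda>x. gamma_weight \<alpha> x * cell_laplace g x * exp (- (real j * x)))
           (cell_moment \<alpha> g j)"
proof -
  define F where "F s x = indicator {0..1} s * g s * (gamma_weight \<alpha> x * exp (- ((real j + s) * x)))" for s x
  have Fm [measurable]: "case_prod F \<in> borel_measurable (lborel \<Otimes>\<^sub>M lborel)"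
    unfolding F_def by measurable
  have inner: "has_bochner_integral lborel (F s) (indicator {0..1} s * g s * (real j + s) powr (-\<alpha>))"
    and inner_norm: "(\<integral>x. norm (F s x) \<partial>lborel) = indicator {0..1} s * \<bar>g s\<bar> * (real j + s) powr (-\<alpha>)"
    if "s \<noteq> 0" for s
  proof -
    show *: "has_bochner_integral lborel (F s) (indicator {0..1} s * g s * (real j + s) powr (-\<alpha>))"
    proof (cases "s \<in> {0..1}")
      case True
      then have "0 < real j + s" using that by auto
      from gamma_weight_laplace[OF assms(1) this] show ?thesis
        unfolding F_def by (intro has_bochner_integral_mult_right)
    next
      case False
      then have "F s = (\<lambda>x. 0)" by (auto simp: F_def)
      then show ?thesis using False by (simp add: has_bochner_integral_zero)
    qed
    show "(\<integral>x. norm (F s x) \<partial>lborel) = indicator {0..1} s * \<bar>g s\<bar> * (real j + s) powr (-\<alpha>)"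
    proof (cases "s \<in> {0..1}")
      case True
      then have "0 < real j + s" using that by auto
      from gamma_weight_laplace[OF assms(1) this]
      have "has_bochner_integral lborel (\<lambda>x. indicator {0..1} s * \<bar>g s\<bar> * (gamma_weight \<alpha> x * exp (- ((real j + s) * x))))
         (indicator {0..1} s * \<bar>g s\<bar> * (real j + s) powr (-\<alpha>))"
        by (intro has_bochner_integral_mult_right)
      moreover have "norm (F s x) = indicator {0..1} s * \<bar>g s\<bar> * (gamma_weight \<alpha> x * exp (- ((real j + s) * x)))" for x
        using gamma_weight_nonneg[OF assms(1), of x] by (simp add: F_def abs_mult)
      ultimately show ?thesis by (simp add: has_bochner_integral_iff)
    qed (simp add: F_def)
  qed
  \<comment> \<open>The Laplace integral diverges when j + s = 0, so the point s = 0 is left out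
    throughout.\<close>
  have ae: "AE s in lborel. s \<noteq> (0::real)" by (rule AE_I[of _ _ "{0}"]) auto
  have "set_integrable lborel {0..1} (\<lambda>s. (real j + s) powr (-\<alpha>) * \<bar>g s\<bar>)"
    using g by (intro cell_moment_integrable assms) auto
  then have I: "integrable lborel (\<lambda>s. indicator {0..1} s * \<bar>g s\<bar> * (real j + s) powr (-\<alpha>))"
    by (simp add: set_integrable_def mult_ac)
  have intF: "integrable (lborel \<Otimes>\<^sub>M lborel) (case_prod F)"
  proof (rule lborel_pair.Fubini_integrable[OF Fm])
    have [measurable]: "(\<lambda>s. \<integral>x. norm (F s x) \<partial>lborel) \<in> borel_measurable lborel"
      using Fm by measurable
    show "integrable lborel (\<lambda>s. \<integral>x. norm (case_prod F (s, x)) \<partial>lborel)"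
      unfolding prod.case
    proof (rule integrable_cong_AE_imp[OF I])
      show "AE s in lborel. indicator {0..1} s * \<bar>g s\<bar> * (real j + s) powr (-\<alpha>) = (\<integral>x. norm (F s x) \<partial>lborel)"
        using ae
      proof (rule AE_mp, intro AE_I2 impI)
        show "indicator {0..1} s * \<bar>g s\<bar> * (real j + s) powr (-\<alpha>) = (\<integral>x. norm (F s x) \<partial>lborel)" if "s \<noteq> 0" for s
          using inner_norm[OF that] by simp
      qed
    qed measurable
    show "AE s in lborel. integrable lborel (\<lambda>x. case_prod F (s, x))"
      unfolding prod.case using ae
    proof (rule AE_mp, intro AE_I2 impI)
      show "integrable lborel (F s)" if "s \<noteq> 0" for s
        using inner[OF that] by (simp add: has_bochner_integral_iff)
    qed
  qed
  have "(\<integral>s. F s x \<partial>lborel) = gamma_weight \<alpha> x * cell_laplace g x * exp (- (real j * x))" for x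
  proof -
    have "F s x = gamma_weight \<alpha> x * exp (- (real j * x)) * (indicator {0..1} s *\<^sub>R (exp (- (s * x)) * g s))" for s
      by (simp add: F_def algebra_simps exp_add[symmetric] flip: exp_add)
    then show ?thesis by (simp add: cell_laplace_def set_lebesgue_integral_def)
  qed
  moreover have "(\<integral>s. (\<integral>x. F s x \<partial>lborel) \<partial>lborel) = cell_moment \<alpha> g j"
    unfolding cell_moment_def set_lebesgue_integral_def
  proof (rule integral_cong_AE)
    show "AE s in lborel. (\<integral>x. F s x \<partial>lborel) = indicator {0..1} s *\<^sub>R ((real j + s) powr (-\<alpha>) * g s)"
      using ae
    proof (rule AE_mp, intro AE_I2 impI)
      show "(\<integral>x. F s x \<partial>lborel) = indicator {0..1} s *\<^sub>R ((real j + s) powr (-\<alpha>) * g s)" if "s \<noteq> 0" for s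
        using inner[OF that] by (simp add: has_bochner_integral_iff)
    qed
    show "(\<lambda>s. \<integral>x. F s x \<partial>lborel) \<in> borel_measurable lborel" using Fm by measurable
  qed measurable
  ultimately show ?thesis
    using lborel_pair.Fubini_integral[OF intF] lborel_pair.integrable_snd[OF intF] by (simp add: has_bochner_integral_iff)
qed

text \<open>Geometric series under the integral sign, with |m| |z|^j as majorant. The differentiated
  series is summed in the same manner, so that the derivative of the generating function is an
  explicit integral too. As \<open>m\<close> lives on x > 0, the ratio exp (- x) z stays in the unit
  disc.\<close>

lemma moment_sums:
  fixes m :: "real \<Rightarrow> real" and z :: complex
  assumes m: "integrable lborel m" "\<forall>x\<le>0. m x = 0"
    and \<mu>: "\<And>j. has_bochner_integral lborel (\<lambda>x. m x * exp (- (real j * x))) (\<mu> j)"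
    and z: "norm z < 1"
  shows "integrable lborel (\<lambda>x. of_real (m x) / (1 - of_real (exp (-x)) * z))" (is ?A)
    and "(\<lambda>j. of_real (\<mu> j) * z ^ j) sums (\<integral>x. of_real (m x) / (1 - of_real (exp (-x)) * z) \<partial>lborel)" (is ?B)
    and "(\<lambda>j. of_nat (Suc j) * of_real (\<mu> (Suc j)) * z ^ j) sums
      (\<integral>x. of_real (m x * exp (-x)) / (1 - of_real (exp (-x)) * z)\<^sup>2 \<partial>lborel)" (is ?C)
proof -
  have yz: "norm (of_real (exp (-x)) * z) \<le> norm z" if "0 \<le> x" for x :: real
    using that by (simp add: norm_mult mult_left_le_one_le)
  have yz1: "norm (of_real (exp (-x)) * z) < 1" if "0 \<le> x" for x :: real
    using yz[OF that] z by simp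
  have int: "integrable lborel (\<lambda>x. of_real (m x * exp (- (real j * x))) * w)" 
    and val: "(\<integral>x. of_real (m x * exp (- (real j * x))) * w \<partial>lborel) = of_real (\<mu> j) * w" for j and w :: complex
  proof -
    have "has_bochner_integral lborel (\<lambda>x. of_real (m x * exp (- (real j * x))) * w) (of_real (\<mu> j) * w)"
      by (intro has_bochner_integral_mult_left has_bochner_integral_of_real \<mu>)
    then show "integrable lborel (\<lambda>x. of_real (m x * exp (- (real j * x))) * w)"
      "(\<integral>x. of_real (m x * exp (- (real j * x))) * w \<partial>lborel) = of_real (\<mu> j) * w"
      by (auto simp: has_bochner_integral_iff)
  qed
  have bd: "(\<integral>x. norm (of_real (m x * exp (- (real j * x))) * w) \<partial>lborel) \<le> (\<integral>x. \<bar>m x\<bar> \<partial>lborel) * norm w" for j and w :: complex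
  proof -
    have "(\<integral>x. norm (of_real (m x * exp (- (real j * x))) * w) \<partial>lborel) \<le> (\<integral>x. \<bar>m x\<bar> * norm w \<partial>lborel)"
    proof (rule integral_mono)
      show "integrable lborel (\<lambda>x. norm (of_real (m x * exp (- (real j * x))) * w))" by (rule integrable_norm[OF int])
      show "integrable lborel (\<lambda>x. \<bar>m x\<bar> * norm w)" using m by auto
      show "norm (of_real (m x * exp (- (real j * x))) * w) \<le> \<bar>m x\<bar> * norm w" for x
        using m(2) by (cases "x \<le> 0") (auto simp: norm_mult abs_mult mult_right_mono mult_right_le_one_le)
    qed
    then show ?thesis by simp
  qed
  have pt: "of_real (m x * exp (- (real j * x))) * z ^ j = of_real (m x) * (of_real (exp (-x)) * z) ^ j" for x j
    by (simp add: power_mult_distrib exp_of_nat_mult[symmetric] flip: of_real_power)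
  have s1: "(\<lambda>j. of_real (m x * exp (- (real j * x))) * z ^ j) sums (of_real (m x) / (1 - of_real (exp (-x)) * z))" for x
  proof (cases "x \<le> 0")
    case False
    have "(\<lambda>j. of_real (m x) * (of_real (exp (-x)) * z) ^ j) sums (of_real (m x) * (1 / (1 - of_real (exp (-x)) * z)))"
      by (intro sums_mult geometric_sums yz1) (use False in simp)
    then show ?thesis unfolding pt by simp
  qed (simp add: m)
  have n1: "summable (\<lambda>j. norm (of_real (m x * exp (- (real j * x))) * z ^ j))" for x
  proof (cases "x \<le> 0")
    case False
    then show ?thesis unfolding pt norm_mult norm_power
      using yz1[of x] by (intro summable_mult summable_geometric) (simp add: norm_mult)
  qed (simp add: m)
  have b1: "summable (\<lambda>j. \<integral>x. norm (of_real (m x * exp (- (real j * x))) * z ^ j) \<partial>lborel)"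
  proof (rule summable_comparison_test_ev)
    show "eventually (\<lambda>j. norm (\<integral>x. norm (of_real (m x * exp (- (real j * x))) * z ^ j) \<partial>lborel)
        \<le> (\<integral>x. \<bar>m x\<bar> \<partial>lborel) * norm z ^ j) sequentially"
      using bd[of _ "z ^ _"] by (intro always_eventually allI) (simp add: norm_power)
    show "summable (\<lambda>j. (\<integral>x. \<bar>m x\<bar> \<partial>lborel) * norm z ^ j)" using z by (intro summable_mult summable_geometric) auto
  qed
  note I1 = integrable_suminf[OF int AE_I2[OF n1] b1] sums_integral[OF int AE_I2[OF n1] b1]
  show ?A using I1(1) unfolding sums_unique[OF s1, symmetric] .
  show ?B using I1(2) unfolding sums_unique[OF s1, symmetric] val .
  have pt2: "of_real (m x * exp (- (real (Suc j) * x))) * (of_nat (Suc j) * z ^ j)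
      = of_real (m x * exp (-x)) * (of_nat (Suc j) * (of_real (exp (-x)) * z) ^ j)" for x j
  proof -
    have "exp (- (real (Suc j) * x)) = exp (-x) * exp (-x) ^ j"
      by (simp add: exp_of_nat_mult[symmetric] exp_add[symmetric] algebra_simps)
    then show ?thesis by (simp add: power_mult_distrib)
  qed
  have s2: "(\<lambda>j. of_real (m x * exp (- (real (Suc j) * x))) * (of_nat (Suc j) * z ^ j)) sums
      (of_real (m x * exp (-x)) / (1 - of_real (exp (-x)) * z)\<^sup>2)" for x
  proof (cases "x \<le> 0")
    case False
    have "(\<lambda>j. of_real (m x * exp (-x)) * (of_nat (Suc j) * (of_real (exp (-x)) * z) ^ j)) sums
      (of_real (m x * exp (-x)) * (1 / (1 - of_real (exp (-x)) * z)\<^sup>2))"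
      by (intro sums_mult geometric_deriv_sums yz1) (use False in simp)
    then show ?thesis unfolding pt2 by simp
  qed (simp add: m)
  have geo: "summable (\<lambda>j. of_nat (Suc j) * r ^ j)" if "norm r < 1" for r :: real
    using geometric_deriv_sums[OF that] by (rule sums_summable)
  have n2: "summable (\<lambda>j. norm (of_real (m x * exp (- (real (Suc j) * x))) * (of_nat (Suc j) * z ^ j)))" for x
  proof (cases "x \<le> 0")
    case False
    have "summable (\<lambda>j. norm (of_real (m x * exp (-x)) :: complex) * (of_nat (Suc j) * norm (of_real (exp (-x)) * z) ^ j))"
      by (intro summable_mult geo) (use False yz1[of x] in simp)
    then show ?thesis unfolding pt2 norm_mult norm_power norm_of_nat by simp
  qed (simp add: m)
  have b2: "summable (\<lambda>j. \<integral>x. norm (of_real (m x * exp (- (real (Suc j) * x))) * (of_nat (Suc j) * z ^ j)) \<partial>lborel)"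
  proof (rule summable_comparison_test_ev)
    show "eventually (\<lambda>j. norm (\<integral>x. norm (of_real (m x * exp (- (real (Suc j) * x))) * (of_nat (Suc j) * z ^ j)) \<partial>lborel)
        \<le> (\<integral>x. \<bar>m x\<bar> \<partial>lborel) * (of_nat (Suc j) * norm z ^ j)) sequentially"
    proof (intro always_eventually allI)
      fix j
      have "norm (of_nat (Suc j) * z ^ j) = of_nat (Suc j) * norm z ^ j"
        by (simp only: norm_mult norm_of_nat norm_power)
      then show "norm (\<integral>x. norm (of_real (m x * exp (- (real (Suc j) * x))) * (of_nat (Suc j) * z ^ j)) \<partial>lborel)
        \<le> (\<integral>x. \<bar>m x\<bar> \<partial>lborel) * (of_nat (Suc j) * norm z ^ j)"
        using bd[of "Suc j" "of_nat (Suc j) * z ^ j"] by (simp only: real_norm_def abs_of_nonneg integral_nonneg_AE AE_I2 norm_ge_zero)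
    qed
    show "summable (\<lambda>j. (\<integral>x. \<bar>m x\<bar> \<partial>lborel) * (of_nat (Suc j) * norm z ^ j))" using z by (intro summable_mult geo) auto
  qed
  have "(\<lambda>j. of_real (\<mu> (Suc j)) * (of_nat (Suc j) * z ^ j)) sums
      (\<integral>x. of_real (m x * exp (-x)) / (1 - of_real (exp (-x)) * z)\<^sup>2 \<partial>lborel)"
    using sums_integral[OF int AE_I2[OF n2] b2] unfolding sums_unique[OF s2, symmetric] val .
  then show ?C by (simp only: mult_ac)
qed

text \<open>
  At \<open>t\<^sub>k - \<sigma> \<tau>\<close> the derivative of the cubic interpolant is \<open>1 / \<tau>\<close> times the sum of the first, second and third
  backward differences at \<open>k\<close> with the weights \<open>1\<close>, \<open>1 / 2 - \<sigma>\<close> and \<open>\<sigma>\<^sup>2 / 2 - \<sigma> + 1 / 3\<close>.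
\<close>

definition quad_weight :: "real \<Rightarrow> real" where "quad_weight s = 1 / 2 - s"
definition cubic_weight :: "real \<Rightarrow> real" where "cubic_weight s = s\<^sup>2 / 2 - s + 1 / 3"

lemma quad_weight_measurable [measurable]: "quad_weight \<in> borel_measurable borel"
  unfolding quad_weight_def by measurable

lemma cubic_weight_measurable [measurable]: "cubic_weight \<in> borel_measurable borel"
  unfolding cubic_weight_def by measurable

lemma abs_quad_weight_le: "\<forall>s\<in>{0..1}. \<bar>quad_weight s\<bar> \<le> 1"
  by (auto simp: quad_weight_def abs_le_iff)

lemma abs_cubic_weight_le: "\<forall>s\<in>{0..1}. \<bar>cubic_weight s\<bar> \<le> 1"
proof
  fix s :: real assume s: "s \<in> {0..1}"
  then have "0 \<le> s * s" "s * s \<le> s" by (auto simp: mult_left_le_one_le)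
  then show "\<bar>cubic_weight s\<bar> \<le> 1" using s unfolding cubic_weight_def power2_eq_square abs_le_iff atLeastAtMost_iff by linarith
qed

section \<open>Signs and order of the Laplace transforms of the weights\<close>

lemma cell_laplace_conv_integral:
  assumes "continuous_on {0..1} g"
  shows "cell_laplace g x = integral {0..1} (\<lambda>s. exp (- (s * x)) * g s)"
    "(\<lambda>s. exp (- (s * x)) * g s) integrable_on {0..1}"
proof -
  have c: "continuous_on {0..1} (\<lambda>s. exp (- (s * x)) * g s)"
    by (intro continuous_intros assms)
  then show "(\<lambda>s. exp (- (s * x)) * g s) integrable_on {0..1}"
    by (rule integrable_continuous_interval)
  show "cell_laplace g x = integral {0..1} (\<lambda>s. exp (- (s * x)) * g s)"
    unfolding cell_laplace_def using borel_integrable_atLeastAtMost'[OF c]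
    by (rule set_borel_integral_eq_integral)
qed

lemma cell_laplace_mono:
  assumes "continuous_on {0..1} g" "continuous_on {0..1} k" "\<And>s. s \<in> {0..1} \<Longrightarrow> g s \<le> k s"
  shows "cell_laplace g x \<le> cell_laplace k x"
  using assms unfolding cell_laplace_conv_integral(1)[OF assms(1)] cell_laplace_conv_integral(1)[OF assms(2)]
  by (intro integral_le cell_laplace_conv_integral) auto

lemma cell_laplace_cmult: "cell_laplace (\<lambda>s. c * g s) x = c * cell_laplace g x"
  unfolding cell_laplace_def by (simp add: mult.left_commute)

lemma cell_laplace_diff:
  assumes "continuous_on {0..1} g" "continuous_on {0..1} k"
  shows "cell_laplace (\<lambda>s. g s - k s) x = cell_laplace g x - cell_laplace k x"
  using assms by (simp add: cell_laplace_conv_integral continuous_on_diff right_diff_distrib integral_diff)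

text \<open>Chebyshev's argument: the weight \<open>exp (- s x)\<close> is decreasing, so it favours the part where \<open>p\<close> is positive.\<close>

lemma cell_laplace_nonneg:
  assumes p: "continuous_on {0..1} p" "(p has_integral 0) {0..1}" and x: "0 \<le> x"
    and sgn: "\<And>s. s \<in> {0..1} \<Longrightarrow> s \<le> s0 \<Longrightarrow> 0 \<le> p s" "\<And>s. s \<in> {0..1} \<Longrightarrow> s0 \<le> s \<Longrightarrow> p s \<le> 0"
  shows "0 \<le> cell_laplace p x"
proof -
  have "((\<lambda>s. exp (- (s0 * x)) * p s) has_integral exp (- (s0 * x)) * 0) {0..1}"
    by (rule has_integral_mult_right[OF p(2)])
  then have "0 = integral {0..1} (\<lambda>s. exp (- (s0 * x)) * p s)" by (metis integral_unique mult_zero_right)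
  also have "\<dots> \<le> integral {0..1} (\<lambda>s. exp (- (s * x)) * p s)"
  proof (rule integral_le)
    show "(\<lambda>s. exp (- (s0 * x)) * p s) integrable_on {0..1}"
      by (intro integrable_continuous_interval continuous_intros p)
    fix s :: real assume s: "s \<in> {0..1}"
    show "exp (- (s0 * x)) * p s \<le> exp (- (s * x)) * p s"
    proof (cases "s \<le> s0")
      case True
      then show ?thesis using sgn(1)[OF s] x by (intro mult_right_mono) (auto simp: mult_right_mono)
    next
      case False
      then show ?thesis using sgn(2)[OF s] x by (intro mult_right_mono_neg) (auto simp: mult_right_mono)
    qed
  qed (rule cell_laplace_conv_integral[OF p(1)])
  finally show ?thesis by (simp add: cell_laplace_conv_integral[OF p(1)])
qed

text \<open>The derivative of an interpolant integrates over its cell to the first difference of the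
  nodal values, so the higher differences must carry weights of mean zero.\<close>

lemma cell_weights_integral_zero:
  "(quad_weight has_integral 0) {0..1}" "(cubic_weight has_integral 0) {0..1}"
proof -
  have "(cubic_weight has_integral (\<lambda>s. s^3 / 6 - s\<^sup>2 / 2 + s / 3) 1 - (\<lambda>s. s^3 / 6 - s\<^sup>2 / 2 + s / 3) 0) {0..1::real}"
    by (intro fundamental_theorem_of_calculus)
       (auto intro!: derivative_eq_intros simp: cubic_weight_def has_real_derivative_iff_has_vector_derivative[symmetric] power2_eq_square)
  then show "(cubic_weight has_integral 0) {0..1}" by simp
  have "(quad_weight has_integral (\<lambda>s. s / 2 - s\<^sup>2 / 2) 1 - (\<lambda>s. s / 2 - s\<^sup>2 / 2) 0) {0..1::real}"
    by (intro fundamental_theorem_of_calculus)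
       (auto intro!: derivative_eq_intros simp: quad_weight_def has_real_derivative_iff_has_vector_derivative[symmetric] power2_eq_square)
  then show "(quad_weight has_integral 0) {0..1}" by simp
qed

text \<open>Both \<open>cubic_weight\<close> and the difference of \<open>quad_weight\<close> and
  \<open>cubic_weight\<close> have mean zero and change sign once in the cell, from plus to minus,
  at 1 - 1 / sqrt 3 and at 1 / sqrt 3. The upper bounds hold pointwise. The orderings are exactly
  what \<open>kernel_symbol\<close> asks for.\<close>

lemma cell_laplace_bounds:
  assumes x: "0 \<le> x"
  defines "A \<equiv> cell_laplace (\<lambda>_. 1) x" and "B \<equiv> cell_laplace quad_weight x"
    and "C \<equiv> cell_laplace cubic_weight x"
  shows "0 \<le> C" "C \<le> B" "B \<le> A / 2" "C \<le> A / 3" "exp (- x) \<le> A"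
proof -
  have cont: "continuous_on {0..1} quad_weight" "continuous_on {0..1} cubic_weight"
    unfolding quad_weight_def cubic_weight_def by (auto intro!: continuous_intros)
  have r3: "0 \<le> (1::real) / sqrt 3" "(1 / sqrt 3)\<^sup>2 = (1::real) / 3" by (simp_all add: power_divide)
  have I: "((\<lambda>s. quad_weight s - cubic_weight s) has_integral 0) {0..1}"
    using has_integral_diff[OF cell_weights_integral_zero] by simp
  have cw: "cubic_weight s = ((1 - s)\<^sup>2 - 1 / 3) / 2" "quad_weight s - cubic_weight s = (1 / 3 - s\<^sup>2) / 2" for s
    by (simp_all add: cubic_weight_def quad_weight_def power2_eq_square field_simps)
  show "0 \<le> C" unfolding C_def
  proof (rule cell_laplace_nonneg[OF cont(2) cell_weights_integral_zero(2) x, of "1 - 1 / sqrt 3"])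
    fix s :: real assume s: "s \<in> {0..1}"
    show "0 \<le> cubic_weight s" if "s \<le> 1 - 1 / sqrt 3"
    proof -
      have "(1 / sqrt 3)\<^sup>2 \<le> (1 - s)\<^sup>2" using that r3 by (intro power_mono) auto
      then show ?thesis unfolding cw(1) r3 by simp
    qed
    show "cubic_weight s \<le> 0" if "1 - 1 / sqrt 3 \<le> s"
    proof -
      have "(1 - s)\<^sup>2 \<le> (1 / sqrt 3)\<^sup>2" using that s by (intro power_mono) auto
      then show ?thesis unfolding cw(1) r3 by simp
    qed
  qed
  have "0 \<le> cell_laplace (\<lambda>s. quad_weight s - cubic_weight s) x"
  proof (rule cell_laplace_nonneg[OF continuous_on_diff[OF cont] I x, of "1 / sqrt 3"])
    fix s :: real assume s: "s \<in> {0..1}"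
    show "0 \<le> quad_weight s - cubic_weight s" if "s \<le> 1 / sqrt 3"
    proof -
      have "s\<^sup>2 \<le> (1 / sqrt 3)\<^sup>2" using that s by (intro power_mono) auto
      then show ?thesis unfolding cw(2) r3 by simp
    qed
    show "quad_weight s - cubic_weight s \<le> 0" if "1 / sqrt 3 \<le> s"
    proof -
      have "(1 / sqrt 3)\<^sup>2 \<le> s\<^sup>2" using that r3 by (intro power_mono) auto
      then show ?thesis unfolding cw(2) r3 by simp
    qed
  qed
  then show "C \<le> B" by (simp add: B_def C_def cell_laplace_diff[OF cont])
  have "B \<le> cell_laplace (\<lambda>s. (1/2) * 1) x"
    unfolding B_def by (intro cell_laplace_mono cont) (auto simp: quad_weight_def)
  then show "B \<le> A / 2" unfolding cell_laplace_cmult A_def by simp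
  have "C \<le> cell_laplace (\<lambda>s. (1/3) * 1) x"
    unfolding C_def
  proof (intro cell_laplace_mono cont)
    fix s :: real assume "s \<in> {0..1}"
    then have "s * s \<le> s" "0 \<le> s" by (auto simp: mult_left_le_one_le)
    then show "cubic_weight s \<le> (1/3) * 1" by (simp add: cubic_weight_def power2_eq_square)
  qed auto
  then show "C \<le> A / 3" unfolding cell_laplace_cmult A_def by simp
  have "exp (- x) = integral {0..1} (\<lambda>s::real. exp (- x))" by simp
  also have "\<dots> \<le> integral {0..1} (\<lambda>s. exp (- (s * x)) * 1)"
    by (intro integral_le cell_laplace_conv_integral) (use x in \<open>auto simp: mult_left_le_one_le\<close>)
  finally show "exp (- x) \<le> A" unfolding A_def by (simp add: cell_laplace_conv_integral)
qed

section \<open>The generating function of the scheme on the unit mesh and its bounds\<close>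

definition cell_fps :: "real \<Rightarrow> (real \<Rightarrow> real) \<Rightarrow> complex fps" where
  "cell_fps \<alpha> g = Abs_fps (\<lambda>j. of_real (cell_moment \<alpha> g j))"

definition cell_density :: "real \<Rightarrow> (real \<Rightarrow> real) \<Rightarrow> real \<Rightarrow> real" where
  "cell_density \<alpha> g x = gamma_weight \<alpha> x * cell_laplace g x"

lemma cell_density_nonpos: "x \<le> 0 \<Longrightarrow> cell_density \<alpha> g x = 0"
  by (simp add: cell_density_def gamma_weight_def)

lemma cell_fps:
  assumes "0 < \<alpha>" "\<alpha> < 1" "g \<in> borel_measurable borel" "\<forall>s\<in>{0..1}. \<bar>g s\<bar> \<le> (1::real)"
  shows "integrable lborel (cell_density \<alpha> g)" "1 \<le> fps_conv_radius (cell_fps \<alpha> g)"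
    and "norm z < 1 \<Longrightarrow> integrable lborel (\<lambda>x. of_real (cell_density \<alpha> g x) / (1 - of_real (exp (-x)) * z))"
    and "norm z < 1 \<Longrightarrow> eval_fps (cell_fps \<alpha> g) z = (\<integral>x. of_real (cell_density \<alpha> g x) / (1 - of_real (exp (-x)) * z) \<partial>lborel)"
    and "norm z < 1 \<Longrightarrow> eval_fps (fps_deriv (cell_fps \<alpha> g)) z =
      (\<integral>x. of_real (cell_density \<alpha> g x * exp (-x)) / (1 - of_real (exp (-x)) * z)\<^sup>2 \<partial>lborel)"
proof -
  have mom: "has_bochner_integral lborel (\<lambda>x. cell_density \<alpha> g x * exp (- (real j * x))) (cell_moment \<alpha> g j)" for j
    unfolding cell_density_def by (rule cell_moment_laplace) (use assms in auto)
  show int: "integrable lborel (cell_density \<alpha> g)"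
    using mom[of 0] by (simp add: has_bochner_integral_iff)
  have "\<forall>x\<le>0. cell_density \<alpha> g x = 0" by (simp add: cell_density_nonpos)
  note M = moment_sums[OF int this mom]
  show "1 \<le> fps_conv_radius (cell_fps \<alpha> g)"
    unfolding fps_conv_radius_def
  proof (rule conv_radius_geI_ex')
    fix r :: real assume "0 < r" "ereal r < 1"
    then have "norm (complex_of_real r) < 1" by (simp add: one_ereal_def)
    from sums_summable[OF M(2)[OF this]]
    show "summable (\<lambda>n. fps_nth (cell_fps \<alpha> g) n * of_real r ^ n)" by (simp add: cell_fps_def)
  qed
  assume z: "norm z < 1"
  show "integrable lborel (\<lambda>x. of_real (cell_density \<alpha> g x) / (1 - of_real (exp (-x)) * z))" by (rule M(1)[OF z])
  show "eval_fps (cell_fps \<alpha> g) z = (\<integral>x. of_real (cell_density \<alpha> g x) / (1 - of_real (exp (-x)) * z) \<partial>lborel)"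
    unfolding eval_fps_def using sums_unique[OF M(2)[OF z]] by (simp add: cell_fps_def)
  show "eval_fps (fps_deriv (cell_fps \<alpha> g)) z =
      (\<integral>x. of_real (cell_density \<alpha> g x * exp (-x)) / (1 - of_real (exp (-x)) * z)\<^sup>2 \<partial>lborel)"
    unfolding eval_fps_def using sums_unique[OF M(3)[OF z]] by (simp add: cell_fps_def)
qed

text \<open>Multiplication by \<open>1 - fps_X\<close> is the backward difference of a sequence
  extended by zero, so the three terms carry the first, second and third differences. The factor
  \<tau> powr (-\<alpha>) / Gamma (1 - \<alpha>) is left out.\<close>

definition caputo_symbol :: "real \<Rightarrow> complex fps" where
  "caputo_symbol \<alpha> = (1 - fps_X) * cell_fps \<alpha> (\<lambda>_. 1) + (1 - fps_X)\<^sup>2 * cell_fps \<alpha> quad_weight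
     + (1 - fps_X) ^ 3 * cell_fps \<alpha> cubic_weight"

text \<open>A common yardstick: the symbol is at least a multiple of |1 - z| times this mass, its
  derivative at most a multiple of the mass. Their quotient is then controlled without an upper
  bound for the mass near 1.\<close>

definition symbol_mass :: "real \<Rightarrow> complex \<Rightarrow> real" where
  "symbol_mass \<alpha> z = (\<integral>x. cell_density \<alpha> (\<lambda>_. 1) x / norm (1 - of_real (exp (-x)) * z) \<partial>lborel)"

lemma one_minus_damped:
  fixes z :: complex
  assumes "0 < y" "y < 1" "norm z < 1"
  shows "1 - of_real y * z \<noteq> 0" "norm (1 - z) \<le> 2 * norm (1 - of_real y * z)"
    "norm (1 - of_real y * z) \<le> norm (1 - z) + (1 - y)"
proof -
  have yz: "norm (of_real y * z) \<le> y"
    using assms by (simp add: norm_mult mult_left_le)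
  have "norm (1 :: complex) \<le> norm (1 - of_real y * z) + norm (of_real y * z)"
    using norm_triangle_sub[of 1 "of_real y * z"] by (simp add: add.commute)
  then have g: "1 - y \<le> norm (1 - of_real y * z)" using yz by simp
  then show "1 - of_real y * z \<noteq> 0" using assms by auto
  have d: "norm (of_real (1 - y) * z) \<le> 1 - y"
    unfolding norm_mult norm_of_real using assms by (simp add: mult_left_le)
  have "1 - z = (1 - of_real y * z) - of_real (1 - y) * z" by (simp add: algebra_simps)
  then have "norm (1 - z) \<le> norm (1 - of_real y * z) + norm (of_real (1 - y) * z)" by (metis norm_triangle_ineq4)
  then show "norm (1 - z) \<le> 2 * norm (1 - of_real y * z)" using d g by simp
  have "1 - of_real y * z = (1 - z) + of_real (1 - y) * z" by (simp add: algebra_simps)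
  then have "norm (1 - of_real y * z) \<le> norm (1 - z) + norm (of_real (1 - y) * z)" by (metis norm_triangle_ineq)
  then show "norm (1 - of_real y * z) \<le> norm (1 - z) + (1 - y)" using d by simp
qed

context
  fixes \<alpha> :: real
  assumes \<alpha>: "0 < \<alpha>" "\<alpha> < 1"
begin

lemma cell_density_bounds:
  shows "0 \<le> cell_density \<alpha> cubic_weight x" 
    "cell_density \<alpha> cubic_weight x \<le> cell_density \<alpha> quad_weight x"
    "cell_density \<alpha> quad_weight x \<le> cell_density \<alpha> (\<lambda>_. 1) x / 2"
    "cell_density \<alpha> cubic_weight x \<le> cell_density \<alpha> (\<lambda>_. 1) x / 3"
    "gamma_weight \<alpha> x * exp (-x) \<le> cell_density \<alpha> (\<lambda>_. 1) x"
proof -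
  have "0 \<le> cell_density \<alpha> cubic_weight x \<and> 
    cell_density \<alpha> cubic_weight x \<le> cell_density \<alpha> quad_weight x \<and>
    cell_density \<alpha> quad_weight x \<le> cell_density \<alpha> (\<lambda>_. 1) x / 2 \<and>
    cell_density \<alpha> cubic_weight x \<le> cell_density \<alpha> (\<lambda>_. 1) x / 3 \<and>
    gamma_weight \<alpha> x * exp (-x) \<le> cell_density \<alpha> (\<lambda>_. 1) x"
  proof (cases "x \<le> 0")
    case False
    then have x: "0 \<le> x" by simp
    show ?thesis
      using cell_laplace_bounds[OF x] gamma_weight_nonneg[OF \<alpha>(1), of x] unfolding cell_density_def
      by (auto simp: mult_left_mono simp flip: times_divide_eq_right)
  qed (simp add: cell_density_nonpos gamma_weight_def)
  then show "0 \<le> cell_density \<alpha> cubic_weight x" 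
    "cell_density \<alpha> cubic_weight x \<le> cell_density \<alpha> quad_weight x"
    "cell_density \<alpha> quad_weight x \<le> cell_density \<alpha> (\<lambda>_. 1) x / 2"
    "cell_density \<alpha> cubic_weight x \<le> cell_density \<alpha> (\<lambda>_. 1) x / 3"
    "gamma_weight \<alpha> x * exp (-x) \<le> cell_density \<alpha> (\<lambda>_. 1) x"
    by auto
qed

lemmas cell_fps_one = cell_fps[of \<alpha> "\<lambda>_. 1", OF \<alpha>, simplified]
lemmas cell_fps_quad = cell_fps[OF \<alpha> quad_weight_measurable abs_quad_weight_le]
lemmas cell_fps_cubic = cell_fps[OF \<alpha> cubic_weight_measurable abs_cubic_weight_le]

lemma symbol_mass_integrable:
  assumes "norm (z :: complex) < 1"
  shows "integrable lborel (\<lambda>x. cell_density \<alpha> (\<lambda>_. 1) x / norm (1 - of_real (exp (-x)) * z))"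
proof -
  have nn: "0 \<le> cell_density \<alpha> (\<lambda>_. 1) x" for x using cell_density_bounds(1,4)[of x] by simp
  have "integrable lborel (\<lambda>x. norm (complex_of_real (cell_density \<alpha> (\<lambda>_. 1) x) / (1 - of_real (exp (-x)) * z)))"
    using cell_fps_one(3)[OF assms] by (intro integrable_norm) (simp add: exp_of_real)
  moreover have "norm (complex_of_real (cell_density \<alpha> (\<lambda>_. 1) x) / (1 - of_real (exp (-x)) * z)) 
      = cell_density \<alpha> (\<lambda>_. 1) x / norm (1 - of_real (exp (-x)) * z)" for x
    using nn[of x] by (simp add: norm_divide)
  ultimately show ?thesis by simp
qed

text \<open>Differentiation squares the denominator; one of the two factors is paid for by |1 - z|
  <= 2 |1 - exp (- x) z|, so the derivative is measured by the same mass.\<close>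

lemma norm_cell_fps_le:
  assumes g: "g \<in> borel_measurable borel" "\<forall>s\<in>{0..1}. \<bar>g s\<bar> \<le> (1::real)"
    and gA: "\<And>x. \<bar>cell_density \<alpha> g x\<bar> \<le> cell_density \<alpha> (\<lambda>_. 1) x" and z: "norm z < 1"
  shows "norm (eval_fps (cell_fps \<alpha> g) z) \<le> symbol_mass \<alpha> z"
    and "norm (1 - z) * norm (eval_fps (fps_deriv (cell_fps \<alpha> g)) z) \<le> 2 * symbol_mass \<alpha> z"
proof -
  note F = cell_fps[OF \<alpha> g]
  show "norm (eval_fps (cell_fps \<alpha> g) z) \<le> symbol_mass \<alpha> z"
    unfolding F(4)[OF z] symbol_mass_def
    by (rule Bochner_Integration.integral_norm_bound_integral[OF F(3)[OF z] symbol_mass_integrable[OF z]])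
       (use gA in \<open>auto simp: norm_divide divide_right_mono\<close>)
  have bd: "norm ((1 - z) * (of_real (cell_density \<alpha> g x * exp (-x)) / (1 - of_real (exp (-x)) * z)\<^sup>2))
      \<le> 2 * (cell_density \<alpha> (\<lambda>_. 1) x / norm (1 - of_real (exp (-x)) * z))" for x
  proof (cases "x \<le> 0")
    case False
    then have y: "0 < exp (-x)" "exp (-x) < 1" by auto
    note o = one_minus_damped[OF y z]
    let ?N = "norm (1 - of_real (exp (-x)) * z)"
    have "norm ((1 - z) * (of_real (cell_density \<alpha> g x * exp (-x)) / (1 - of_real (exp (-x)) * z)\<^sup>2))
      = norm (1 - z) * (\<bar>cell_density \<alpha> g x\<bar> * exp (-x)) / ?N\<^sup>2"
      by (simp only: norm_mult norm_divide norm_power norm_of_real abs_mult) simp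
    also have "\<dots> \<le> (2 * ?N) * (cell_density \<alpha> (\<lambda>_. 1) x * 1) / ?N\<^sup>2"
      using o(2) gA[of x] y by (intro divide_right_mono mult_mono) auto
    also have "\<dots> = 2 * (cell_density \<alpha> (\<lambda>_. 1) x / ?N)"
      using o(1) by (simp add: power2_eq_square)
    finally show ?thesis .
  qed (simp add: cell_density_nonpos)
  show "norm (1 - z) * norm (eval_fps (fps_deriv (cell_fps \<alpha> g)) z) \<le> 2 * symbol_mass \<alpha> z"
  proof -
    have "norm (1 - z) * norm (eval_fps (fps_deriv (cell_fps \<alpha> g)) z)
      = norm (\<integral>x. (1 - z) * (of_real (cell_density \<alpha> g x * exp (-x)) / (1 - of_real (exp (-x)) * z)\<^sup>2) \<partial>lborel)"
      unfolding F(5)[OF z] by (simp only: norm_mult[symmetric] integral_mult_right_zero)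
    also have "\<dots> \<le> (\<integral>x. 2 * (cell_density \<alpha> (\<lambda>_. 1) x / norm (1 - of_real (exp (-x)) * z)) \<partial>lborel)"
    proof (rule order.trans[OF integral_norm_bound integral_mono'])
      show "0 \<le> 2 * (cell_density \<alpha> (\<lambda>_. 1) x / norm (1 - of_real (exp (-x)) * z))" for x
        using order.trans[OF norm_ge_zero bd[of x]] by simp
      show "integrable lborel (\<lambda>x. 2 * (cell_density \<alpha> (\<lambda>_. 1) x / norm (1 - of_real (exp (-x)) * z)))"
        by (intro integrable_mult_right symbol_mass_integrable z)
    qed (rule bd)
    also have "\<dots> = 2 * symbol_mass \<alpha> z" unfolding symbol_mass_def by (rule integral_mult_right_zero)
    finally show ?thesis .
  qed
qed

lemma fps_conv_radius_caputo_symbol: "1 \<le> fps_conv_radius (caputo_symbol \<alpha>)"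
proof -
  have X: "fps_conv_radius (1 - fps_X :: complex fps) = \<infinity>"
    using fps_conv_radius_diff[of "1 :: complex fps" fps_X] by simp
  have P: "1 \<le> fps_conv_radius ((1 - fps_X) ^ n * F)" if "1 \<le> fps_conv_radius F" for n and F :: "complex fps"
  proof -
    have "fps_conv_radius ((1 - fps_X :: complex fps) ^ n) = \<infinity>"
      using fps_conv_radius_power[of "1 - fps_X :: complex fps" n] X by simp
    then show ?thesis using that fps_conv_radius_mult[of "(1 - fps_X) ^ n" F] by simp
  qed
  show ?thesis unfolding caputo_symbol_def
    using P[OF cell_fps_one(2), of 1] P[OF cell_fps_quad(2), of 2] P[OF cell_fps_cubic(2), of 3]
    by (intro order.trans[OF _ fps_conv_radius_add] min.boundedI) auto
qed

lemma eval_caputo_symbol: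
  assumes z: "norm z < 1"
  shows "eval_fps (caputo_symbol \<alpha>) z = (1 - z) * eval_fps (cell_fps \<alpha> (\<lambda>_. 1)) z
    + (1 - z)\<^sup>2 * eval_fps (cell_fps \<alpha> quad_weight) z + (1 - z) ^ 3 * eval_fps (cell_fps \<alpha> cubic_weight) z"
proof -
  have X: "fps_conv_radius (1 - fps_X :: complex fps) = \<infinity>"
    using fps_conv_radius_diff[of "1 :: complex fps" fps_X] by simp
  have XP: "fps_conv_radius ((1 - fps_X :: complex fps) ^ n) = \<infinity>" for n
    using fps_conv_radius_power[of "1 - fps_X :: complex fps" n] X by simp
  have z1: "ereal (norm z) < R" if "1 \<le> R" for R
    using that z by (meson ereal_less(3) less_le_trans)
  have EX: "eval_fps ((1 - fps_X) ^ n) z = (1 - z) ^ n" for n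
    by (simp add: eval_fps_power X eval_fps_diff)
  have T: "eval_fps ((1 - fps_X) ^ n * F) z = (1 - z) ^ n * eval_fps F z"
    "1 \<le> fps_conv_radius ((1 - fps_X) ^ n * F)" if "1 \<le> fps_conv_radius F" for n F
  proof -
    show "eval_fps ((1 - fps_X) ^ n * F) z = (1 - z) ^ n * eval_fps F z"
      using z1[OF that] by (subst eval_fps_mult) (simp_all add: XP EX)
    show "1 \<le> fps_conv_radius ((1 - fps_X) ^ n * F)"
      using that fps_conv_radius_mult[of "(1 - fps_X) ^ n" F] XP[of n] by simp
  qed
  note t1 = T[OF cell_fps_one(2), of 1, unfolded power_one_right] and t2 = T[OF cell_fps_quad(2), of 2] and t3 = T[OF cell_fps_cubic(2), of 3]
  have t12: "1 \<le> fps_conv_radius ((1 - fps_X) * cell_fps \<alpha> (\<lambda>_. 1) + (1 - fps_X)\<^sup>2 * cell_fps \<alpha> quad_weight)"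
    using t1 t2 by (intro order.trans[OF _ fps_conv_radius_add] min.boundedI)
  show ?thesis
    unfolding caputo_symbol_def
    by (simp only: eval_fps_add[OF z1[OF t12] z1[OF t3(2)]] eval_fps_add[OF z1[OF t1(2)] z1[OF t2(2)]] t1(1) t2(1) t3(1))
qed

definition symbol_density :: "complex \<Rightarrow> real \<Rightarrow> complex" where
  "symbol_density z x = (1 - z) * (of_real (cell_density \<alpha> (\<lambda>_. 1) x) + of_real (cell_density \<alpha> quad_weight x) * (1 - z)
     + of_real (cell_density \<alpha> cubic_weight x) * (1 - z)\<^sup>2) / (1 - of_real (exp (-x)) * z)"

lemma caputo_symbol_integral:
  assumes z: "norm z < 1"
  shows "has_bochner_integral lborel (symbol_density z) (eval_fps (caputo_symbol \<alpha>) z)"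
proof -
  have "has_bochner_integral lborel (\<lambda>x. 
      (1 - z) * (of_real (cell_density \<alpha> (\<lambda>_. 1) x) / (1 - of_real (exp (-x)) * z))
    + (1 - z)\<^sup>2 * (of_real (cell_density \<alpha> quad_weight x) / (1 - of_real (exp (-x)) * z))
    + (1 - z) ^ 3 * (of_real (cell_density \<alpha> cubic_weight x) / (1 - of_real (exp (-x)) * z)))
    (eval_fps (caputo_symbol \<alpha>) z)"
    unfolding eval_caputo_symbol[OF z]
    by (intro has_bochner_integral_add has_bochner_integral_mult_right)
       (use cell_fps_one(3,4)[OF z] cell_fps_quad(3,4)[OF z] cell_fps_cubic(3,4)[OF z] in \<open>simp_all add: has_bochner_integral_iff\<close>)
  moreover have "symbol_density z x = 
      (1 - z) * (of_real (cell_density \<alpha> (\<lambda>_. 1) x) / (1 - of_real (exp (-x)) * z))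
    + (1 - z)\<^sup>2 * (of_real (cell_density \<alpha> quad_weight x) / (1 - of_real (exp (-x)) * z))
    + (1 - z) ^ 3 * (of_real (cell_density \<alpha> cubic_weight x) / (1 - of_real (exp (-x)) * z))" for x
    unfolding symbol_density_def by (simp add: add_divide_distrib[symmetric] algebra_simps power2_eq_square power3_eq_cube)
  ultimately show ?thesis by presburger
qed

text \<open>The conditions Im <= 0 and (7/6) Im <= Re define a convex cone inside the sector and
  therefore pass from the density to its integral. The constant 72 is 24 * 3, as Re w - 2 Im w <= 3
  |w|.\<close>

lemma caputo_symbol_upper:
  assumes z: "norm z < 1" "0 \<le> Im z"
  defines "w \<equiv> eval_fps (caputo_symbol \<alpha>) z"
  shows "w \<in> obtuse_sector" "norm (1 - z) * symbol_mass \<alpha> z \<le> 72 * norm w"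
proof -
  have pt: "Im (symbol_density z x) \<le> 0" "(7 / 6) * Im (symbol_density z x) \<le> Re (symbol_density z x)"
    "cell_density \<alpha> (\<lambda>_. 1) x / 24 * (norm (1 - z) / norm (1 - of_real (exp (-x)) * z))
      \<le> Re (symbol_density z x) - 2 * Im (symbol_density z x)" for x
  proof -
    have "Im (symbol_density z x) \<le> 0 \<and> (7 / 6) * Im (symbol_density z x) \<le> Re (symbol_density z x) \<and>
      cell_density \<alpha> (\<lambda>_. 1) x / 24 * (norm (1 - z) / norm (1 - of_real (exp (-x)) * z))
      \<le> Re (symbol_density z x) - 2 * Im (symbol_density z x)"
    proof (cases "x \<le> 0")
      case True
      then show ?thesis by (simp add: symbol_density_def cell_density_nonpos)
    next
      case False
      then have y: "0 \<le> exp (-x)" "exp (-x) < 1" by auto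
      show ?thesis unfolding symbol_density_def
        using kernel_symbol[OF y cell_density_bounds(1-4) less_imp_le[OF z(1)] z(2)] by blast
    qed
    then show "Im (symbol_density z x) \<le> 0" "(7 / 6) * Im (symbol_density z x) \<le> Re (symbol_density z x)"
      "cell_density \<alpha> (\<lambda>_. 1) x / 24 * (norm (1 - z) / norm (1 - of_real (exp (-x)) * z))
      \<le> Re (symbol_density z x) - 2 * Im (symbol_density z x)" by auto
  qed
  note H = caputo_symbol_integral[OF z(1), folded w_def]
  have HR: "integrable lborel (\<lambda>x. Re (symbol_density z x))" "(\<integral>x. Re (symbol_density z x) \<partial>lborel) = Re w"
    and HI: "integrable lborel (\<lambda>x. Im (symbol_density z x))" "(\<integral>x. Im (symbol_density z x) \<partial>lborel) = Im w"
    using H by (auto simp: has_bochner_integral_iff)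
  have im: "Im w \<le> 0"
    using integral_mono[OF HI(1) integrable_zero pt(1)] HI(2) by simp
  have "(7 / 6) * Im w \<le> Re w"
    using integral_mono[OF _ HR(1) pt(2)] HI HR(2) by simp
  with im show "w \<in> obtuse_sector" by (simp add: obtuse_sector_def)
  have "(\<integral>x. norm (1 - z) / 24 * (cell_density \<alpha> (\<lambda>_. 1) x / norm (1 - of_real (exp (-x)) * z)) \<partial>lborel)
     \<le> (\<integral>x. Re (symbol_density z x) - 2 * Im (symbol_density z x) \<partial>lborel)"
  proof (rule integral_mono)
    show "integrable lborel (\<lambda>x. norm (1 - z) / 24 * (cell_density \<alpha> (\<lambda>_. 1) x / norm (1 - of_real (exp (-x)) * z)))"
      by (intro integrable_mult_right symbol_mass_integrable z)
    show "integrable lborel (\<lambda>x. Re (symbol_density z x) - 2 * Im (symbol_density z x))"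
      by (intro Bochner_Integration.integrable_diff integrable_mult_right HI(1) HR(1))
    show "norm (1 - z) / 24 * (cell_density \<alpha> (\<lambda>_. 1) x / norm (1 - of_real (exp (-x)) * z))
      \<le> Re (symbol_density z x) - 2 * Im (symbol_density z x)" for x
      using pt(3)[of x] by (simp add: mult_ac)
  qed
  also have "(\<integral>x. norm (1 - z) / 24 * (cell_density \<alpha> (\<lambda>_. 1) x / norm (1 - of_real (exp (-x)) * z)) \<partial>lborel)
      = norm (1 - z) / 24 * symbol_mass \<alpha> z"
    unfolding symbol_mass_def by (rule integral_mult_right_zero)
  also have "(\<integral>x. Re (symbol_density z x) - 2 * Im (symbol_density z x) \<partial>lborel) = Re w - 2 * Im w"
    using HI HR by simp
  also have "Re w - 2 * Im w \<le> 3 * norm w"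
    using abs_Re_le_cmod[of w] abs_Im_le_cmod[of w] by linarith
  finally show "norm (1 - z) * symbol_mass \<alpha> z \<le> 72 * norm w" by simp
qed

lemma caputo_symbol_sector:
  assumes z: "norm z < 1"
  defines "w \<equiv> eval_fps (caputo_symbol \<alpha>) z"
  shows "w \<in> obtuse_sector" "norm (1 - z) * symbol_mass \<alpha> z \<le> 72 * norm w"
proof -
  have "w \<in> obtuse_sector \<and> norm (1 - z) * symbol_mass \<alpha> z \<le> 72 * norm w"
  proof (cases "0 \<le> Im z")
    case True
    then show ?thesis using caputo_symbol_upper[OF z] by (simp add: w_def)
  next
    case False
    have z': "norm (cnj z) < 1" "0 \<le> Im (cnj z)" using z False by auto
    have "symbol_density (cnj z) = (\<lambda>x. cnj (symbol_density z x))"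
      by (rule ext) (simp add: symbol_density_def)
    then have "has_bochner_integral lborel (symbol_density (cnj z)) (cnj w)"
      using has_bochner_integral_cnj[OF caputo_symbol_integral[OF z]] by (simp only: w_def)
    then have "eval_fps (caputo_symbol \<alpha>) (cnj z) = cnj w"
      using caputo_symbol_integral[OF z'(1)] has_bochner_integral_eq by blast
    moreover have "symbol_mass \<alpha> (cnj z) = symbol_mass \<alpha> z"
      unfolding symbol_mass_def
    proof (rule Bochner_Integration.integral_cong[OF refl])
      fix x :: real
      have "norm (1 - of_real (exp (-x)) * cnj z) = norm (cnj (1 - of_real (exp (-x)) * z))" by simp
      then show "cell_density \<alpha> (\<lambda>_. 1) x / norm (1 - of_real (exp (-x)) * cnj z)
        = cell_density \<alpha> (\<lambda>_. 1) x / norm (1 - of_real (exp (-x)) * z)" by (simp only: complex_mod_cnj)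
    qed
    moreover have "norm (1 - cnj z) = norm (1 - z)" by (metis complex_cnj_diff complex_cnj_one complex_mod_cnj)
    ultimately show ?thesis using caputo_symbol_upper[OF z'] by (simp add: obtuse_sector_def)
  qed
  then show "w \<in> obtuse_sector" "norm (1 - z) * symbol_mass \<alpha> z \<le> 72 * norm w" by auto
qed

text \<open>Only the range 0 < x <= |1 - z| is kept. There |1 - exp (- x) z| <= 2 |1 - z| and exp (-
  x) >= exp (- 2); what remains is the integral of x powr (\<alpha> - 1), which is |1 - z| powr
  \<alpha> / \<alpha>.\<close>

lemma symbol_mass_ge:
  assumes z: "norm z < 1"
  shows "exp (- 2) / (2 * \<alpha> * Gamma \<alpha>) * norm (1 - z) powr (\<alpha> - 1) \<le> symbol_mass \<alpha> z"
proof -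
  define \<delta> where "\<delta> = norm (1 - z)"
  have \<delta>: "0 < \<delta>" "\<delta> \<le> 2" using z norm_triangle_ineq4[of 1 z] by (auto simp: \<delta>_def)
  have G: "0 < Gamma \<alpha>" using \<alpha> by (intro Gamma_real_pos)
  define k where "k = exp (- 2) / (2 * \<delta> * Gamma \<alpha>)"
  have k: "0 \<le> k" using G \<delta> by (simp add: k_def)
  have "has_bochner_integral lborel (\<lambda>x. indicator {0..\<delta>} x * x powr (\<alpha> - 1)) (\<delta> powr \<alpha> / \<alpha>)"
  proof (rule has_bochner_integral_nn_integral)
    have "((\<lambda>x. x powr (\<alpha> - 1)) has_integral (\<delta> powr ((\<alpha> - 1) + 1) / ((\<alpha> - 1) + 1))) {0..\<delta>}"
      using \<alpha> \<delta> by (intro has_integral_powr_from_0) auto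
    then show "(\<integral>\<^sup>+ x. ennreal (indicator {0..\<delta>} x * x powr (\<alpha> - 1)) \<partial>lborel) = ennreal (\<delta> powr \<alpha> / \<alpha>)"
      using nn_integral_has_integral_lebesgue[of "{0..\<delta>}" "\<lambda>x. x powr (\<alpha> - 1)"] by simp
  qed (use \<alpha> in auto)
  then have L: "has_bochner_integral lborel (\<lambda>x. k * (indicator {0..\<delta>} x * x powr (\<alpha> - 1))) (k * (\<delta> powr \<alpha> / \<alpha>))"
    by (rule has_bochner_integral_mult_right)
  have "k * (\<delta> powr \<alpha> / \<alpha>) = (\<integral>x. k * (indicator {0..\<delta>} x * x powr (\<alpha> - 1)) \<partial>lborel)"
    using L by (simp only: has_bochner_integral_iff)
  also have "\<dots> \<le> symbol_mass \<alpha> z"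
    unfolding symbol_mass_def
  proof (rule integral_mono[OF _ symbol_mass_integrable[OF z]])
    show "integrable lborel (\<lambda>x. k * (indicator {0..\<delta>} x * x powr (\<alpha> - 1)))"
      using L by (simp only: has_bochner_integral_iff)
    fix x :: real
    have nn: "0 \<le> cell_density \<alpha> (\<lambda>_. 1) x" using cell_density_bounds(1,4)[of x] by simp
    show "k * (indicator {0..\<delta>} x * x powr (\<alpha> - 1)) \<le> cell_density \<alpha> (\<lambda>_. 1) x / norm (1 - of_real (exp (-x)) * z)"
    proof (cases "0 < x \<and> x \<le> \<delta>")
      case True
      then have y: "0 < exp (-x)" "exp (-x) < 1" by auto
      note o = one_minus_damped[OF y z]
      have "1 - exp (-x) \<le> x" using exp_ge_add_one_self[of "-x"] by simp
      then have N: "norm (1 - of_real (exp (-x)) * z) \<le> 2 * \<delta>" "0 < norm (1 - of_real (exp (-x)) * z)"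
        using o(1,3) True by (auto simp: \<delta>_def)
      have "k * (indicator {0..\<delta>} x * x powr (\<alpha> - 1)) = gamma_weight \<alpha> x * exp (- 2) / (2 * \<delta>)"
        using True G \<delta> by (simp add: k_def gamma_weight_def field_simps)
      also have "\<dots> \<le> gamma_weight \<alpha> x * exp (- x) / norm (1 - of_real (exp (-x)) * z)"
        using N True \<delta> gamma_weight_nonneg[OF \<alpha>(1), of x]
        by (intro frac_le mult_left_mono mult_nonneg_nonneg) auto
      also have "\<dots> \<le> cell_density \<alpha> (\<lambda>_. 1) x / norm (1 - of_real (exp (-x)) * z)"
        using cell_density_bounds(5)[of x] by (intro divide_right_mono) auto
      finally show ?thesis .
    next
      case False
      then have "indicator {0..\<delta>} x * x powr (\<alpha> - 1) = 0" by (auto simp: indicator_def)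
      then show ?thesis using nn by (simp only: mult_zero_right) simp
    qed
  qed
  also have "k * (\<delta> powr \<alpha> / \<alpha>) = exp (- 2) / (2 * \<alpha> * Gamma \<alpha>) * \<delta> powr (\<alpha> - 1)"
    using \<delta> \<alpha> G by (simp add: k_def powr_diff field_simps)
  finally show ?thesis by (simp add: \<delta>_def)
qed

text \<open>In the product rule each derivative of a cell series uses up one factor 1 - z, and the
  other factors are at most 2 in modulus. The six terms add up to 1 + 2 + 4 + 4 + 12 + 8 =
  31.\<close>

lemma norm_deriv_caputo_symbol_le:
  assumes z: "norm z < 1"
  shows "norm (deriv (eval_fps (caputo_symbol \<alpha>)) z) \<le> 31 * symbol_mass \<alpha> z"
proof -
  let ?a = "cell_fps \<alpha> (\<lambda>_. 1)" and ?b = "cell_fps \<alpha> quad_weight" and ?c = "cell_fps \<alpha> cubic_weight"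
  let ?I = "symbol_mass \<alpha> z" and ?d = "norm (1 - z)"
  have z1: "ereal (norm z) < R" if "1 \<le> R" for R
    using that z by (meson ereal_less(3) less_le_trans)
  have cd: "\<bar>cell_density \<alpha> quad_weight x\<bar> \<le> cell_density \<alpha> (\<lambda>_. 1) x"
    "\<bar>cell_density \<alpha> cubic_weight x\<bar> \<le> cell_density \<alpha> (\<lambda>_. 1) x"
    "\<bar>cell_density \<alpha> (\<lambda>_. 1) x\<bar> \<le> cell_density \<alpha> (\<lambda>_. 1) x" for x
    using cell_density_bounds[of x] by (auto simp: abs_le_iff)
  have D: "((\<lambda>z. (1 - z) * eval_fps ?a z + (1 - z)\<^sup>2 * eval_fps ?b z + (1 - z) ^ 3 * eval_fps ?c z)
    has_field_derivative (- eval_fps ?a z + (1 - z) * eval_fps (fps_deriv ?a) z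
      + (- 2 * (1 - z) * eval_fps ?b z + (1 - z)\<^sup>2 * eval_fps (fps_deriv ?b) z)
      + (- 3 * (1 - z)\<^sup>2 * eval_fps ?c z + (1 - z) ^ 3 * eval_fps (fps_deriv ?c) z))) (at z)"
  proof -
    have da: "(eval_fps ?a has_field_derivative eval_fps (fps_deriv ?a) z) (at z)"
      and db: "(eval_fps ?b has_field_derivative eval_fps (fps_deriv ?b) z) (at z)"
      and dc: "(eval_fps ?c has_field_derivative eval_fps (fps_deriv ?c) z) (at z)"
      by (intro has_field_derivative_eval_fps z1 cell_fps_one(2) cell_fps_quad(2) cell_fps_cubic(2))+
    have p: "((\<lambda>z. 1 - z) has_field_derivative -1) (at z)" "((\<lambda>z. (1 - z)\<^sup>2) has_field_derivative - 2 * (1 - z)) (at z)"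
      "((\<lambda>z. (1 - z) ^ 3) has_field_derivative - 3 * (1 - z)\<^sup>2) (at z)" for z :: complex
      by (auto intro!: derivative_eq_intros)
    show ?thesis
      by (rule DERIV_cong[OF DERIV_add[OF DERIV_add[OF DERIV_mult[OF p(1) da] DERIV_mult[OF p(2) db]] DERIV_mult[OF p(3) dc]]])
         (simp add: mult_ac add_ac)
  qed
  have "eventually (\<lambda>w. w \<in> ball 0 1) (nhds z)" using z by (intro eventually_nhds_in_open) auto
  then have ev: "eventually (\<lambda>w. eval_fps (caputo_symbol \<alpha>) w =
     (1 - w) * eval_fps ?a w + (1 - w)\<^sup>2 * eval_fps ?b w + (1 - w) ^ 3 * eval_fps ?c w) (nhds z)"
    by eventually_elim (simp add: eval_caputo_symbol)
  have dz: "deriv (eval_fps (caputo_symbol \<alpha>)) z = - eval_fps ?a z + (1 - z) * eval_fps (fps_deriv ?a) z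
      + (- 2 * (1 - z) * eval_fps ?b z + (1 - z)\<^sup>2 * eval_fps (fps_deriv ?b) z)
      + (- 3 * (1 - z)\<^sup>2 * eval_fps ?c z + (1 - z) ^ 3 * eval_fps (fps_deriv ?c) z)"
    using deriv_cong_ev[OF ev refl] DERIV_imp_deriv[OF D] by simp
  have "norm (deriv (eval_fps (caputo_symbol \<alpha>)) z) \<le> norm (eval_fps ?a z) + ?d * norm (eval_fps (fps_deriv ?a) z)
      + (2 * ?d * norm (eval_fps ?b z) + ?d\<^sup>2 * norm (eval_fps (fps_deriv ?b) z))
      + (3 * ?d\<^sup>2 * norm (eval_fps ?c z) + ?d ^ 3 * norm (eval_fps (fps_deriv ?c) z))"
    unfolding dz by (intro norm_triangle_mono)
       (simp_all only: norm_minus_cancel norm_mult norm_power norm_numeral norm_neg_numeral order.refl)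
  also have "\<dots> \<le> ?I + 2 * ?I + (2 * 2 * ?I + 2 * (2 * ?I)) + (3 * 2\<^sup>2 * ?I + 2\<^sup>2 * (2 * ?I))"
  proof -
    have d: "0 \<le> ?d" "?d \<le> 2" using z norm_triangle_ineq4[of 1 z] by auto
    note a = norm_cell_fps_le[OF _ _ cd(3) z, simplified] and b = norm_cell_fps_le[OF _ abs_quad_weight_le cd(1) z, simplified]
      and c = norm_cell_fps_le[OF _ abs_cubic_weight_le cd(2) z, simplified]
    have b': "?d\<^sup>2 * norm (eval_fps (fps_deriv ?b) z) \<le> 2 * (2 * ?I)"
      unfolding power2_eq_square mult.assoc by (rule mult_mono[OF d(2) b(2)]) simp_all
    have c': "?d ^ 3 * norm (eval_fps (fps_deriv ?c) z) \<le> 2\<^sup>2 * (2 * ?I)"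
    proof -
      have "?d ^ 3 * norm (eval_fps (fps_deriv ?c) z) = ?d\<^sup>2 * (?d * norm (eval_fps (fps_deriv ?c) z))"
        by (simp add: power2_eq_square power3_eq_cube)
      also have "\<dots> \<le> 2\<^sup>2 * (2 * ?I)" by (rule mult_mono[OF power_mono[OF d(2,1)] c(2)]) simp_all
      finally show ?thesis .
    qed
    have b'': "2 * ?d * norm (eval_fps ?b z) \<le> 2 * 2 * ?I"
      by (rule mult_mono[OF mult_left_mono[OF d(2)] b(1)]) simp_all
    have c'': "3 * ?d\<^sup>2 * norm (eval_fps ?c z) \<le> 3 * 2\<^sup>2 * ?I"
      by (rule mult_mono[OF mult_left_mono[OF power_mono[OF d(2,1)]] c(1)]) simp_all
    show ?thesis
      by (intro add_mono a b' b'' c' c'')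
  qed
  also have "\<dots> = 31 * ?I" by simp
  finally show ?thesis .
qed

end

lemma caputo_symbol_estimates:
  assumes \<alpha>: "0 < \<alpha>" "\<alpha> < 1"
  obtains c where "0 < c" "\<And>z. norm z < 1 \<Longrightarrow> eval_fps (caputo_symbol \<alpha>) z \<in> obtuse_sector"
    "\<And>z. norm z < 1 \<Longrightarrow> c * norm (1 - z) powr \<alpha> \<le> norm (eval_fps (caputo_symbol \<alpha>) z)"
    "\<And>z. norm z < 1 \<Longrightarrow> norm (1 - z) * norm (deriv (eval_fps (caputo_symbol \<alpha>)) z) \<le> 2232 * norm (eval_fps (caputo_symbol \<alpha>) z)"
proof
  define c where "c = exp (- 2) / (2 * \<alpha> * Gamma \<alpha>) / 72"
  show "0 < c" using \<alpha> Gamma_real_pos[of \<alpha>] by (simp add: c_def)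
  fix z :: complex assume z: "norm z < 1"
  show "eval_fps (caputo_symbol \<alpha>) z \<in> obtuse_sector" by (rule caputo_symbol_sector[OF \<alpha> z])
  have d: "0 < norm (1 - z)" using z by auto
  have "norm (1 - z) * (exp (- 2) / (2 * \<alpha> * Gamma \<alpha>) * norm (1 - z) powr (\<alpha> - 1)) \<le> norm (1 - z) * symbol_mass \<alpha> z"
    by (intro mult_left_mono symbol_mass_ge[OF \<alpha> z]) auto
  also have "\<dots> \<le> 72 * norm (eval_fps (caputo_symbol \<alpha>) z)" by (rule caputo_symbol_sector[OF \<alpha> z])
  finally show "c * norm (1 - z) powr \<alpha> \<le> norm (eval_fps (caputo_symbol \<alpha>) z)"
    using d by (simp add: c_def powr_diff field_simps)
  \<comment> \<open>The mass is eliminated between derivative and symbol: 31 * 72 = 2232.\<close>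
  have "norm (1 - z) * norm (deriv (eval_fps (caputo_symbol \<alpha>)) z) \<le> norm (1 - z) * (31 * symbol_mass \<alpha> z)"
    by (intro mult_left_mono norm_deriv_caputo_symbol_le[OF \<alpha> z]) auto
  then show "norm (1 - z) * norm (deriv (eval_fps (caputo_symbol \<alpha>)) z) \<le> 2232 * norm (eval_fps (caputo_symbol \<alpha>) z)"
    using caputo_symbol_sector(2)[OF \<alpha> z] by linarith
qed

section \<open>Impulse responses and stability\<close>

lemma sin_pi_ge:
  assumes "0 \<le> t" "t \<le> 1 / 2"
  shows "t \<le> sin (pi * t)"
proof -
  have "\<bar>sin (pi * t) - pi * t\<bar> \<le> (pi * t) ^ 3 / 6"
    using Maclaurin_sin_bound[of "pi * t" 3] assms
    by (simp add: numeral_3_eq_3 sin_coeff_def fact_numeral abs_mult)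
  moreover have "(pi * t) ^ 3 / 6 \<le> (2 / 3) * (pi * t)"
  proof -
    have "pi * t \<le> 4 * (1 / 2)" using assms pi_less_4 by (intro mult_mono) auto
    then have "(pi * t) * (pi * t) \<le> 2 * 2" using assms by (intro mult_mono) auto
    then have "(pi * t) * ((pi * t) * (pi * t)) \<le> (pi * t) * (2 * 2)" by (rule mult_left_mono) (use assms in auto)
    then show ?thesis unfolding power3_eq_cube mult.assoc by linarith
  qed
  ultimately have "(1 / 3) * (pi * t) \<le> sin (pi * t)" by linarith
  moreover have "3 * t \<le> pi * t" using pi_gt3 assms by (intro mult_right_mono) auto
  ultimately show ?thesis by linarith
qed

text \<open>The squared modulus is (1 - r)^2 + 4 r sin(pi t)^2. The minimum of \<open>t\<close> and
  \<open>1 - t\<close> appears because both ends of the parameter interval correspond to the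
  direction of 1.\<close>

lemma norm_one_minus_circle_ge:
  assumes r: "1 / 2 \<le> r" "r \<le> 1" and t: "0 \<le> t" "t \<le> 1"
  shows "(1 - r) + min t (1 - t) \<le> 2 * norm (1 - of_real r * exp (2 * of_real pi * \<i> * of_real t))"
proof -
  define m where "m = min t (1 - t)"
  have m: "0 \<le> m" "m \<le> 1 / 2" using t unfolding m_def by linarith+
  have ms: "m \<le> sin (pi * t)"
  proof (cases "t \<le> 1 / 2")
    case True then show ?thesis using sin_pi_ge[of t] t by (simp add: m_def)
  next
    case False
    have "sin (pi * (1 - t)) = sin (pi - pi * t)" by (simp add: algebra_simps)
    then have "sin (pi * (1 - t)) = sin (pi * t)" by simp
    then show ?thesis using sin_pi_ge[of "1 - t"] t False by (simp add: m_def)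
  qed
  have e: "exp (2 * of_real pi * \<i> * of_real t) = cis (2 * (pi * t))"
    by (simp add: cis_conv_exp algebra_simps)
  have c: "cos (2 * (pi * t)) = 1 - 2 * (sin (pi * t))\<^sup>2" by (rule cos_double_sin)
  have "(norm (1 - of_real r * cis (2 * (pi * t))))\<^sup>2 = 1 - 2 * r * cos (2 * (pi * t)) + r\<^sup>2 * ((cos (2 * (pi * t)))\<^sup>2 + (sin (2 * (pi * t)))\<^sup>2)"
  proof -
    have "(1 - r * C)\<^sup>2 + (r * S)\<^sup>2 = 1 - 2 * r * C + r\<^sup>2 * (C\<^sup>2 + S\<^sup>2)" for C S :: real
      by (simp add: power2_eq_square algebra_simps)
    from this[of "cos (2 * (pi * t))" "sin (2 * (pi * t))"] show ?thesis
      unfolding cmod_power2 by simp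
  qed
  also have "\<dots> = (1 - r)\<^sup>2 + 4 * r * (sin (pi * t))\<^sup>2"
  proof -
    have "1 - 2 * r * (1 - 2 * S\<^sup>2) + r\<^sup>2 * 1 = (1 - r)\<^sup>2 + 4 * r * S\<^sup>2" for S :: real
      by (simp add: power2_eq_square algebra_simps)
    then show ?thesis unfolding sin_cos_squared_add2 by (simp only: c)
  qed
  finally have n: "(norm (1 - of_real r * cis (2 * (pi * t))))\<^sup>2 = (1 - r)\<^sup>2 + 4 * r * (sin (pi * t))\<^sup>2" .
  have "((1 - r) + m)\<^sup>2 + ((1 - r) - m)\<^sup>2 = 2 * (1 - r)\<^sup>2 + 2 * m\<^sup>2" by (simp add: power2_eq_square algebra_simps)
  then have "((1 - r) + m)\<^sup>2 \<le> 2 * (1 - r)\<^sup>2 + 2 * m\<^sup>2" using zero_le_power2[of "(1 - r) - m"] by linarith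
  also have "\<dots> \<le> 4 * ((1 - r)\<^sup>2 + 4 * r * (sin (pi * t))\<^sup>2)"
  proof -
    have "m\<^sup>2 \<le> (sin (pi * t))\<^sup>2" using ms m by (intro power_mono) auto
    moreover have "2 * (sin (pi * t))\<^sup>2 \<le> 4 * r * (sin (pi * t))\<^sup>2" using r by (intro mult_right_mono) auto
    moreover have "4 * ((1 - r)\<^sup>2 + 4 * r * (sin (pi * t))\<^sup>2) = 4 * (1 - r)\<^sup>2 + 4 * (4 * r * (sin (pi * t))\<^sup>2)" by simp
    ultimately show ?thesis using zero_le_power2[of "1 - r"] zero_le_power2[of "sin (pi * t)"] by linarith
  qed
  also have "\<dots> = (2 * norm (1 - of_real r * cis (2 * (pi * t))))\<^sup>2" by (simp only: n power_mult_distrib) simp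
  finally show ?thesis unfolding e m_def[symmetric] by (rule power2_le_imp_le) simp
qed

text \<open>Majorant for |1 - z| powr (-1 - \<alpha>) along the circle of radius 1 - \<delta>; a sum
  over both ends of the parameter interval replaces the minimum.\<close>

lemma integral_powr_shift_le:
  fixes \<alpha> \<delta> :: real
  assumes "0 < \<alpha>" "0 < \<delta>"
  shows "(\<lambda>t. (\<delta> + t) powr (-1 - \<alpha>) + (\<delta> + (1 - t)) powr (-1 - \<alpha>)) integrable_on {0..1}"
    and "integral {0..1} (\<lambda>t. (\<delta> + t) powr (-1 - \<alpha>) + (\<delta> + (1 - t)) powr (-1 - \<alpha>)) \<le> 2 * \<delta> powr (-\<alpha>) / \<alpha>"
proof -
  define F where "F t = ((\<delta> + (1 - t)) powr (-\<alpha>) - (\<delta> + t) powr (-\<alpha>)) / \<alpha>" for t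
  have "((\<lambda>t. (\<delta> + t) powr (-1 - \<alpha>) + (\<delta> + (1 - t)) powr (-1 - \<alpha>)) has_integral (F 1 - F 0)) {0..1}"
  proof (rule fundamental_theorem_of_calculus)
    fix t :: real assume t: "t \<in> {0..1}"
    have "(F has_real_derivative (\<delta> + t) powr (-1 - \<alpha>) + (\<delta> + (1 - t)) powr (-1 - \<alpha>)) (at t within {0..1})"
    proof -
      have 1: "((\<lambda>t. (\<delta> + t) powr (-\<alpha>)) has_real_derivative (-\<alpha> * (\<delta> + t) powr (-\<alpha> - 1)) * 1) (at t)"
        by (rule DERIV_chain2[OF has_real_derivative_powr]) (use assms t in \<open>auto intro!: derivative_eq_intros\<close>)
      have 2: "((\<lambda>t. (\<delta> + (1 - t)) powr (-\<alpha>)) has_real_derivative (-\<alpha> * (\<delta> + (1 - t)) powr (-\<alpha> - 1)) * (-1)) (at t)"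
        by (rule DERIV_chain2[OF has_real_derivative_powr]) (use assms t in \<open>auto intro!: derivative_eq_intros\<close>)
      have e: "- \<alpha> - 1 = -1 - \<alpha>" by simp
      have "((\<lambda>t. ((\<delta> + (1 - t)) powr (-\<alpha>) - (\<delta> + t) powr (-\<alpha>)) / \<alpha>) has_real_derivative
        ((-\<alpha> * (\<delta> + (1 - t)) powr (-\<alpha> - 1)) * (-1) - (-\<alpha> * (\<delta> + t) powr (-\<alpha> - 1)) * 1) / \<alpha>) (at t)"
        by (intro DERIV_cdivide DERIV_diff 1 2)
      moreover have "((-\<alpha> * (\<delta> + (1 - t)) powr (-\<alpha> - 1)) * (-1) - (-\<alpha> * (\<delta> + t) powr (-\<alpha> - 1)) * 1) / \<alpha>
        = (\<delta> + t) powr (-1 - \<alpha>) + (\<delta> + (1 - t)) powr (-1 - \<alpha>)"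
        using assms unfolding e by (simp add: add_divide_distrib)
      ultimately have "(F has_real_derivative (\<delta> + t) powr (-1 - \<alpha>) + (\<delta> + (1 - t)) powr (-1 - \<alpha>)) (at t)"
        unfolding F_def by (simp only:)
      then show ?thesis by (rule has_field_derivative_at_within)
    qed
    then show "(F has_vector_derivative (\<delta> + t) powr (-1 - \<alpha>) + (\<delta> + (1 - t)) powr (-1 - \<alpha>)) (at t within {0..1})"
      by (simp add: has_real_derivative_iff_has_vector_derivative)
  qed simp
  moreover have "F 1 - F 0 \<le> 2 * \<delta> powr (-\<alpha>) / \<alpha>"
    using assms by (simp add: F_def field_simps)
  ultimately show "(\<lambda>t. (\<delta> + t) powr (-1 - \<alpha>) + (\<delta> + (1 - t)) powr (-1 - \<alpha>)) integrable_on {0..1}"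
    "integral {0..1} (\<lambda>t. (\<delta> + t) powr (-1 - \<alpha>) + (\<delta> + (1 - t)) powr (-1 - \<alpha>)) \<le> 2 * \<delta> powr (-\<alpha>) / \<alpha>"
    by (auto simp: integral_unique intro: has_integral_integrable)
qed

text \<open>
  Cauchy's formula for \<open>f'\<close> on the circle of radius \<open>m / (m + 1)\<close>, which keeps the distance \<open>1 / (m + 1)\<close> from the
  singularity at 1 while its \<open>m\<close>-th power stays bounded below.
\<close>

lemma fps_expansion_nth_le:
  fixes f :: "complex \<Rightarrow> complex" and \<alpha> D :: real
  assumes hol: "f holomorphic_on ball 0 1" and \<alpha>: "0 < \<alpha>" "\<alpha> < 1" and D: "0 \<le> D"
    and der: "\<And>z. norm z < 1 \<Longrightarrow> norm (deriv f z) \<le> D * norm (1 - z) powr (-1 - \<alpha>)"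
    and m: "1 \<le> m"
  shows "norm (fps_nth (fps_expansion f 0) m) \<le> 48 / \<alpha> * D * real m powr (\<alpha> - 1)"
proof -
  define r where "r = real m / (real m + 1)"
  have r: "1 / 2 \<le> r" "r < 1" "0 < r" using m by (auto simp: r_def field_simps)
  have r1: "1 - r = 1 / (real m + 1)" by (simp add: r_def field_simps)
  obtain k where k: "m = Suc k" using m by (cases m) auto
  have hd: "deriv f holomorphic_on ball 0 1" by (rule holomorphic_deriv[OF hol]) auto
  have sub: "cball 0 r \<subseteq> ball (0::complex) 1" using r by auto
  define G where "G t = deriv f (of_real r * exp (2 * of_real pi * \<i> * of_real t)) / (of_real r * exp (2 * of_real pi * \<i> * of_real t)) ^ Suc k
     * (2 * of_real pi * \<i> * of_real r * exp (2 * of_real pi * \<i> * of_real t))" for t :: real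
  \<comment> \<open>Used for \<open>deriv f\<close> at order k = m - 1: the integral is of order (1
    - r) powr (-\<alpha>) = (m + 1) powr \<alpha>, and passing to the coefficient of
    \<open>f\<close> gains 1 / m.\<close>
  have "((\<lambda>u. deriv f u / (u - 0) ^ Suc k) has_contour_integral ((2 * pi * \<i>) / (fact k) * (deriv ^^ k) (deriv f) 0)) (circlepath 0 r)"
    by (rule Cauchy_has_contour_integral_higher_derivative_circlepath)
       (use hd sub r in \<open>auto intro: holomorphic_on_imp_continuous_on holomorphic_on_subset\<close>)
  then have G: "(G has_integral ((2 * pi * \<i>) / (fact k) * (deriv ^^ k) (deriv f) 0)) {0..1}"
    unfolding has_contour_integral vector_derivative_circlepath unfolding circlepath G_def by simp
  \<comment> \<open>24 pi is the product of 2 pi from the velocity, 3 as a bound for 1 / r ^ k, and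
    4 as a bound for 2 powr (1 + \<alpha>).\<close>
  define H where "H t = 24 * pi * D * ((1 - r + t) powr (-1 - \<alpha>) + (1 - r + (1 - t)) powr (-1 - \<alpha>))" for t
  have GH: "norm (G t) \<le> H t" if t: "t \<in> {0..1}" for t
  proof -
    define e where "e = exp (2 * of_real pi * \<i> * of_real t)"
    have ne: "norm e = 1" "e \<noteq> 0" by (simp_all add: e_def)
    define N where "N = norm (1 - of_real r * e)"
    define mn where "mn = min t (1 - t)"
    have "(1 - r) + mn \<le> 2 * N"
      using norm_one_minus_circle_ge[of r t] r t by (simp add: N_def e_def mn_def)
    moreover have mn0: "0 \<le> mn" using t by (auto simp: mn_def)
    ultimately have N: "((1 - r) + mn) / 2 \<le> N" "0 < ((1 - r) + mn) / 2" using r by auto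
    have "N powr (-1 - \<alpha>) \<le> (((1 - r) + mn) / 2) powr (-1 - \<alpha>)" using N \<alpha> by (intro powr_mono2') auto
    also have "\<dots> = 2 powr (1 + \<alpha>) * (1 - r + mn) powr (-1 - \<alpha>)"
      using N by (simp add: powr_divide powr_diff powr_minus powr_add field_simps)
    also have "\<dots> \<le> 4 * (1 - r + mn) powr (-1 - \<alpha>)"
    proof -
      have "2 powr (1 + \<alpha>) \<le> 2 powr (2::real)" using \<alpha> by (intro powr_mono) auto
      then show ?thesis by (intro mult_right_mono) auto
    qed
    also have "\<dots> \<le> 4 * ((1 - r + t) powr (-1 - \<alpha>) + (1 - r + (1 - t)) powr (-1 - \<alpha>))"
      by (auto simp: mn_def min_def)
    finally have Np: "N powr (-1 - \<alpha>) \<le> 4 * ((1 - r + t) powr (-1 - \<alpha>) + (1 - r + (1 - t)) powr (-1 - \<alpha>))" .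
    have "norm (G t) = norm (deriv f (of_real r * e)) / r ^ k * (2 * pi)"
      using r ne by (simp add: G_def e_def[symmetric] norm_mult norm_divide norm_power power_mult_distrib)
    also have "\<dots> \<le> (D * N powr (-1 - \<alpha>)) * 3 * (2 * pi)"
    proof -
      have "1 / r ^ k \<le> 3"
      proof -
        have "1 / r ^ k = (1 / r) ^ k" by (simp add: power_divide)
        also have "\<dots> \<le> (1 / r) ^ m" using r k by (intro power_increasing) auto
        also have "1 / r = 1 + 1 / real m" using m by (simp add: r_def field_simps)
        also have "(1 + 1 / real m) ^ m \<le> exp 1" using m by (intro exp_ge_one_plus_x_over_n_power_n) auto
        also have "\<dots> \<le> 3" by (rule exp_le)
        finally show ?thesis .
      qed
      moreover have "norm (deriv f (of_real r * e)) \<le> D * N powr (-1 - \<alpha>)"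
        using der[of "of_real r * e"] ne r by (simp add: norm_mult N_def)
      ultimately have "norm (deriv f (of_real r * e)) * (1 / r ^ k) \<le> (D * N powr (-1 - \<alpha>)) * 3"
        using D r by (intro mult_mono) auto
      then have "norm (deriv f (of_real r * e)) * (1 / r ^ k) * (2 * pi) \<le> (D * N powr (-1 - \<alpha>)) * 3 * (2 * pi)"
        by (intro mult_right_mono) auto
      then show ?thesis by simp
    qed
    also have "\<dots> = 6 * pi * D * N powr (-1 - \<alpha>)" by simp
    also have "\<dots> \<le> 6 * pi * D * (4 * ((1 - r + t) powr (-1 - \<alpha>) + (1 - r + (1 - t)) powr (-1 - \<alpha>)))"
      using Np D by (intro mult_left_mono) auto
    also have "6 * pi * D * (4 * X) = 24 * pi * D * X" for X by simp
    finally show ?thesis unfolding H_def .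
  qed
  have I: "H integrable_on {0..1}" "integral {0..1} H \<le> 24 * pi * D * (2 * (1 - r) powr (-\<alpha>) / \<alpha>)"
  proof -
    note J = integral_powr_shift_le[of \<alpha> "1 - r"]
    show "H integrable_on {0..1}" unfolding H_def by (intro integrable_on_mult_right J) (use \<alpha> r in auto)
    have "integral {0..1} H = 24 * pi * D * integral {0..1} (\<lambda>t. (1 - r + t) powr (-1 - \<alpha>) + (1 - r + (1 - t)) powr (-1 - \<alpha>))"
      unfolding H_def by (rule integral_mult_right)
    also have "\<dots> \<le> 24 * pi * D * (2 * (1 - r) powr (-\<alpha>) / \<alpha>)"
      using D by (intro mult_left_mono J) (use \<alpha> r in auto)
    finally show "integral {0..1} H \<le> 24 * pi * D * (2 * (1 - r) powr (-\<alpha>) / \<alpha>)" .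
  qed
  have "norm ((2 * pi * \<i>) / (fact k) * (deriv ^^ k) (deriv f) 0) = norm (integral {0..1} G)"
    using G by (simp add: integral_unique)
  also have "\<dots> \<le> integral {0..1} H"
    by (rule integral_norm_bound_integral) (use G I(1) GH in auto)
  finally have A: "norm ((2 * pi * \<i>) / (fact k) * (deriv ^^ k) (deriv f) 0) \<le> 24 * pi * D * (2 * (1 - r) powr (-\<alpha>) / \<alpha>)"
    using I(2) by simp
  have "norm ((2 * pi * \<i>) / (fact k) * (deriv ^^ k) (deriv f) 0) = 2 * pi * (norm ((deriv ^^ m) f 0) / fact k)"
    by (simp add: norm_mult norm_divide k funpow_swap1)
  also have "norm ((deriv ^^ m) f 0) / fact k = real m * norm (fps_nth (fps_expansion f 0) m)"
  proof -
    have "norm ((deriv ^^ m) f 0 / fact m) = norm ((deriv ^^ m) f 0) / fact m"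
      by (simp only: norm_divide norm_fact)
    moreover have "fact m = real m * fact k" by (simp add: k)
    ultimately show ?thesis using m by (simp add: fps_expansion_def)
  qed
  finally have "2 * pi * (real m * norm (fps_nth (fps_expansion f 0) m)) \<le> 24 * pi * D * (2 * (1 - r) powr (-\<alpha>) / \<alpha>)"
    using A by simp
  then have "2 * pi * (real m * norm (fps_nth (fps_expansion f 0) m)) \<le> 2 * pi * (24 / \<alpha> * D * (1 - r) powr (-\<alpha>))"
    by (simp add: mult_ac)
  then have "real m * norm (fps_nth (fps_expansion f 0) m) \<le> 24 / \<alpha> * D * (1 - r) powr (-\<alpha>)"
    by (rule mult_left_le_imp_le) simp
  also have "\<dots> \<le> 24 / \<alpha> * D * (2 * real m powr \<alpha>)"
  proof (rule mult_left_mono)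
    have "(1 - r) powr (-\<alpha>) = (real m + 1) powr \<alpha>" unfolding r1 by (simp add: powr_divide powr_minus field_simps)
    also have "\<dots> \<le> (2 * real m) powr \<alpha>" using m \<alpha> by (intro powr_mono2) auto
    also have "\<dots> = 2 powr \<alpha> * real m powr \<alpha>" by (simp add: powr_mult)
    also have "\<dots> \<le> 2 powr 1 * real m powr \<alpha>" using \<alpha> by (intro mult_right_mono powr_mono) auto
    finally show "(1 - r) powr (-\<alpha>) \<le> 2 * real m powr \<alpha>" by simp
  qed (use D \<alpha> in auto)
  finally have fin: "real m * norm (fps_nth (fps_expansion f 0) m) \<le> 24 / \<alpha> * D * (2 * real m powr \<alpha>)" .
  have "norm (fps_nth (fps_expansion f 0) m) \<le> 24 / \<alpha> * D * (2 * real m powr \<alpha>) / real m"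
  proof -
    have "0 < real m" using m by simp
    then show ?thesis unfolding pos_le_divide_eq[OF \<open>0 < real m\<close>] using fin by (simp only: mult.commute)
  qed
  also have "\<dots> = 48 / \<alpha> * D * real m powr (\<alpha> - 1)"
    using m by (simp add: powr_diff)
  finally show ?thesis .
qed

section \<open>Impulse responses of the scheme by shooting\<close>

fun shooting :: "complex \<Rightarrow> complex \<Rightarrow> (nat \<Rightarrow> complex) \<Rightarrow> nat \<Rightarrow> complex" where
  "shooting s a r 0 = 0"
| "shooting s a r (Suc 0) = a"
| "shooting s a r (Suc (Suc i)) = (2 + s) * shooting s a r (Suc i) - shooting s a r i - r (Suc i)"

lemma shooting_step:
  "1 \<le> i \<Longrightarrow> s * shooting s a r i + (2 * shooting s a r i - shooting s a r (i + 1) - shooting s a r (i - 1)) = r i"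
  by (cases i) (auto simp: algebra_simps)

lemma holomorphic_shooting:
  assumes "s holomorphic_on S"
  shows "(\<lambda>z. shooting (s z) a r i) holomorphic_on S"
  by (induction "0::complex" a r i rule: shooting.induct) (auto intro!: holomorphic_intros assms)

text \<open>Shooting is used because its values are polynomials in the symbol and hence visibly
  holomorphic; the only division by a function of z is by \<open>y z K\<close>. The resolvent bound
  enters for the solution and once more for the differentiated equation, whose right-hand side is -
  w' E. The derivative is then of order |w'| / |w|^2, that is |1 - z| powr (-1 - \<alpha>),
  uniformly in \<open>K\<close> and \<open>\<mu>\<close>.\<close>

lemma impulse_response:
  assumes \<alpha>: "0 < \<alpha>" "\<alpha> < 1"
  obtains C where "0 < C"
    "\<And>K \<mu> (r :: nat \<Rightarrow> real) B. 0 < K \<Longrightarrow> 0 < \<mu> \<Longrightarrow> 0 \<le> B \<Longrightarrow> (\<And>i. 1 \<le> i \<Longrightarrow> i < K \<Longrightarrow> \<bar>r i\<bar> \<le> B) \<Longrightarrow>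
      \<exists>G. G 0 = 0 \<and> G K = 0 \<and>
        (\<forall>i. 1 \<le> i \<longrightarrow> i < K \<longrightarrow> caputo_symbol \<alpha> * G i + fps_const (of_real \<mu>) * (2 * G i - G (i + 1) - G (i - 1))
            = fps_const (of_real (r i))) \<and>
        (\<forall>i\<le>K. \<forall>m. norm (fps_nth (G i) m) \<le> C * real (m + 1) powr (\<alpha> - 1) * B)"
proof -
  obtain c where c: "0 < c" and sec: "\<And>z. norm z < 1 \<Longrightarrow> eval_fps (caputo_symbol \<alpha>) z \<in> obtuse_sector"
    and low: "\<And>z. norm z < 1 \<Longrightarrow> c * norm (1 - z) powr \<alpha> \<le> norm (eval_fps (caputo_symbol \<alpha>) z)"
    and der: "\<And>z. norm z < 1 \<Longrightarrow> norm (1 - z) * norm (deriv (eval_fps (caputo_symbol \<alpha>)) z) \<le> 2232 * norm (eval_fps (caputo_symbol \<alpha>) z)"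
    using caputo_symbol_estimates[OF \<alpha>] by metis
  define w where "w = eval_fps (caputo_symbol \<alpha>)"
  note rad = fps_conv_radius_caputo_symbol[OF \<alpha>]
  have sub: "ball 0 1 \<subseteq> eball (0::complex) (fps_conv_radius (caputo_symbol \<alpha>))"
    using rad by (auto simp: ball_def eball_def) (meson ereal_less(3) less_le_trans)
  have whol: "w holomorphic_on ball 0 1"
    unfolding w_def by (rule holomorphic_on_eval_fps[OF sub])
  have wexp: "w has_fps_expansion caputo_symbol \<alpha>"
    unfolding w_def by (rule eval_fps_has_fps_expansion) (use rad in \<open>auto intro: less_le_trans[of 0 1]\<close>)
  have w0: "w z \<noteq> 0" if "norm z < 1" for z
  proof -
    have "z \<noteq> 1" using that by auto
    then have "0 < c * norm (1 - z) powr \<alpha>" using c by simp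
    then show ?thesis using low[OF that] by (auto simp: w_def)
  qed
  \<comment> \<open>100 * 100 * 2232 / c: two resolvent bounds, the bound for w' / w and the lower
    bound for w.\<close>
  define D where "D = 22320000 / c"
  \<comment> \<open>The first entry serves the coefficient of order 0, the second the others; its
    factor 2 pays for \<open>m + 1\<close> in place of \<open>m\<close>.\<close>
  define C where "C = max (100 / c) (48 / \<alpha> * D * 2)"
  have D: "0 \<le> D" using c by (simp add: D_def)
  show ?thesis
  proof (rule that[of C])
    show "0 < C" using c by (simp add: C_def less_max_iff_disj)
    fix K :: nat and \<mu> :: real and r :: "nat \<Rightarrow> real" and B :: real
    assume K: "0 < K" and mu: "0 < \<mu>" and B: "0 \<le> B" and r: "\<And>i. 1 \<le> i \<Longrightarrow> i < K \<Longrightarrow> \<bar>r i\<bar> \<le> B"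
    define y where "y z = shooting (w z / of_real \<mu>) 1 (\<lambda>_. 0)" for z
    define P where "P z = shooting (w z / of_real \<mu>) 0 (\<lambda>i. of_real (r i) / of_real \<mu>)" for z
    \<comment> \<open>\<open>y\<close> starts with the values 0 and 1. If it vanished at
      \<open>K\<close> it would solve the boundary value problem with zero data, and the resolvent
      bound would make it zero.\<close>
    have yK: "y z K \<noteq> 0" if z: "norm z < 1" for z
    proof
      assume y0: "y z K = 0"
      have "norm (y z 1) \<le> 100 * 0 / norm (w z)"
      proof (rule discrete_resolvent_bound[where r = "\<lambda>_. 0" and K = K])
        show "w z \<in> obtuse_sector" using sec[OF z] by (simp add: w_def)
        fix i assume i: "1 \<le> i" "i < K"
        have "of_real \<mu> * (w z / of_real \<mu> * y z i + (2 * y z i - y z (i + 1) - y z (i - 1))) = 0"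
          unfolding y_def shooting_step[OF i(1)] by simp
        then show "w z * y z i + of_real \<mu> * (2 * y z i - y z (i + 1) - y z (i - 1)) = 0"
          using mu by (simp add: algebra_simps)
      qed (use w0[OF z] mu y0 K in \<open>auto simp: y_def\<close>)
      then show False by (simp add: y_def)
    qed
    define E where "E i z = P z i - P z K / y z K * y z i" for i z
    have Ehol: "E i holomorphic_on ball 0 1" for i
    proof -
      have "(\<lambda>z. P z i) holomorphic_on ball 0 1" "(\<lambda>z. y z i) holomorphic_on ball 0 1" for i
        unfolding P_def y_def using mu by (auto intro!: holomorphic_shooting holomorphic_intros whol)
      then show ?thesis unfolding E_def by (intro holomorphic_intros) (use yK in auto)
    qed
    have E0: "E 0 z = 0" for z by (simp add: E_def P_def y_def)
    have EK: "E K z = 0" if "norm z < 1" for z using yK[OF that] by (simp add: E_def)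
    have Eeq: "w z * E i z + of_real \<mu> * (2 * E i z - E (i + 1) z - E (i - 1) z) = of_real (r i)" if i: "1 \<le> i" for i z
    proof -
      have "of_real \<mu> * (w z / of_real \<mu> * P z i + (2 * P z i - P z (i + 1) - P z (i - 1))) = of_real \<mu> * (of_real (r i) / of_real \<mu>)"
        unfolding P_def shooting_step[OF i] ..
      then have 1: "w z * P z i + of_real \<mu> * (2 * P z i - P z (i + 1) - P z (i - 1)) = of_real (r i)"
        using mu by (simp add: algebra_simps)
      have "of_real \<mu> * (w z / of_real \<mu> * y z i + (2 * y z i - y z (i + 1) - y z (i - 1))) = 0"
        unfolding y_def shooting_step[OF i] by simp
      then have 2: "w z * y z i + of_real \<mu> * (2 * y z i - y z (i + 1) - y z (i - 1)) = 0"
        using mu by (simp add: algebra_simps)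
      have "w z * E i z + of_real \<mu> * (2 * E i z - E (i + 1) z - E (i - 1) z)
        = (w z * P z i + of_real \<mu> * (2 * P z i - P z (i + 1) - P z (i - 1)))
          - P z K / y z K * (w z * y z i + of_real \<mu> * (2 * y z i - y z (i + 1) - y z (i - 1)))"
        unfolding E_def by (simp only: algebra_simps)
      then show ?thesis unfolding 1 2 by simp
    qed
    have Ebd: "norm (E i z) \<le> 100 * B / norm (w z)" if z: "norm z < 1" and i: "i \<le> K" for i z
      by (rule discrete_resolvent_bound[where r = "\<lambda>i. of_real (r i)" and K = K and \<mu> = \<mu>])
         (use sec[OF z] w0[OF z] mu E0 EK[OF z] Eeq r B i in \<open>auto simp: w_def\<close>)
    have Eder: "norm (deriv (E i) z) \<le> 100 * (norm (deriv w z) * (100 * B / norm (w z))) / norm (w z)"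
      if z: "norm z < 1" and i: "i \<le> K" for i z
    proof (rule discrete_resolvent_bound[where r = "\<lambda>i. - (deriv w z * E i z)" and K = K and \<mu> = \<mu> and E = "\<lambda>i. deriv (E i) z"])
      have zb: "z \<in> ball 0 1" using z by simp
      have dE: "(E i has_field_derivative deriv (E i) z) (at z)" for i
        by (rule holomorphic_derivI[OF Ehol open_ball zb])
      have dw: "(w has_field_derivative deriv w z) (at z)"
        by (rule holomorphic_derivI[OF whol open_ball zb])
      have nh: "eventually (\<lambda>z. z \<in> ball 0 (1::real)) (nhds z)" using zb by (intro eventually_nhds_in_open) auto
      show "deriv (E 0) z = 0"
      proof -
        have "E 0 = (\<lambda>_. 0)" using E0 by auto
        then show ?thesis by simp
      qed
      show "deriv (E K) z = 0"
        using deriv_cong_ev[of "E K" "\<lambda>_. 0" z z] nh EK by (simp add: eventually_mono)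
      fix j assume j: "1 \<le> j" "j < K"
      have "((\<lambda>z. w z * E j z + of_real \<mu> * (2 * E j z - E (j + 1) z - E (j - 1) z)) has_field_derivative
        (deriv w z * E j z + w z * deriv (E j) z) + of_real \<mu> * (2 * deriv (E j) z - deriv (E (j + 1)) z - deriv (E (j - 1)) z)) (at z)"
        by (auto intro!: derivative_eq_intros dE dw)
      moreover have "(\<lambda>z. w z * E j z + of_real \<mu> * (2 * E j z - E (j + 1) z - E (j - 1) z)) = (\<lambda>z. of_real (r j))"
        using Eeq[OF j(1)] by (rule ext)
      ultimately have "((\<lambda>z. of_real (r j)) has_field_derivative
        (deriv w z * E j z + w z * deriv (E j) z) + of_real \<mu> * (2 * deriv (E j) z - deriv (E (j + 1)) z - deriv (E (j - 1)) z)) (at z)"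
        by simp
      then have "(deriv w z * E j z + w z * deriv (E j) z) + of_real \<mu> * (2 * deriv (E j) z - deriv (E (j + 1)) z - deriv (E (j - 1)) z) = 0"
        by (rule DERIV_unique) auto
      then show "w z * deriv (E j) z + of_real \<mu> * (2 * deriv (E j) z - deriv (E (j + 1)) z - deriv (E (j - 1)) z) = - (deriv w z * E j z)"
        by (simp add: eq_neg_iff_add_eq_0 algebra_simps)
      show "norm (- (deriv w z * E j z)) \<le> norm (deriv w z) * (100 * B / norm (w z))"
        unfolding norm_minus_cancel norm_mult using Ebd[OF z, of j] j by (intro mult_left_mono) auto
    qed (use sec[OF z] w0[OF z] mu B i in \<open>auto simp: w_def\<close>)
    have Eder': "norm (deriv (E i) z) \<le> D * B * norm (1 - z) powr (-1 - \<alpha>)"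
      if z: "norm z < 1" and i: "i \<le> K" for i z
    proof -
      have d: "0 < norm (1 - z)" using z by auto
      have wp: "0 < norm (w z)" using w0[OF z] by simp
      have "norm (deriv w z) / norm (w z) \<le> 2232 / norm (1 - z)"
        using der[OF z] d wp by (simp add: w_def field_simps)
      moreover have "1 / norm (w z) \<le> 1 / (c * norm (1 - z) powr \<alpha>)"
        using low[OF z] c d by (intro frac_le) (auto simp: w_def)
      ultimately have "norm (deriv w z) / norm (w z) * (1 / norm (w z)) \<le> 2232 / norm (1 - z) * (1 / (c * norm (1 - z) powr \<alpha>))"
        by (intro mult_mono) auto
      then have "10000 * B * (norm (deriv w z) / norm (w z) * (1 / norm (w z))) \<le> 10000 * B * (2232 / norm (1 - z) * (1 / (c * norm (1 - z) powr \<alpha>)))"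
        using B by (intro mult_left_mono) auto
      also have "\<dots> = D * B * norm (1 - z) powr (-1 - \<alpha>)"
        using d c by (simp add: D_def powr_diff powr_minus field_simps)
      finally show ?thesis using Eder[OF z i] by (simp add: mult_ac)
    qed
    define G where "G i = fps_expansion (E i) 0" for i
    have Gexp: "E i has_fps_expansion G i" for i
      unfolding G_def by (rule has_fps_expansion_fps_expansion[OF open_ball _ Ehol]) auto
    have G0: "G 0 = 0"
    proof -
      have "E 0 = (\<lambda>_. 0)" using E0 by (rule ext)
      then have "E 0 has_fps_expansion 0" by simp
      then show ?thesis using fps_expansion_unique_complex[OF Gexp] by blast
    qed
    have GK: "G K = 0"
    proof -
      have "eventually (\<lambda>z::complex. z \<in> ball 0 1) (nhds 0)" by (intro eventually_nhds_in_open) auto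
      then have "eventually (\<lambda>z. E K z = 0) (nhds 0)" by eventually_elim (use EK in auto)
      then have "E K has_fps_expansion 0" using has_fps_expansion_cong[of "E K" "\<lambda>_. 0" 0 0] by simp
      then show ?thesis using fps_expansion_unique_complex[OF Gexp] by blast
    qed
    have Geq: "caputo_symbol \<alpha> * G i + fps_const (of_real \<mu>) * (2 * G i - G (i + 1) - G (i - 1)) = fps_const (of_real (r i))"
      if i: "1 \<le> i" for i
    proof -
      have "(\<lambda>z. w z * E i z + of_real \<mu> * (2 * E i z - E (i + 1) z - E (i - 1) z)) has_fps_expansion
        (caputo_symbol \<alpha> * G i + fps_const (of_real \<mu>) * (2 * G i - G (i + 1) - G (i - 1)))"
        by (intro fps_expansion_intros wexp Gexp)
      moreover have "(\<lambda>z. w z * E i z + of_real \<mu> * (2 * E i z - E (i + 1) z - E (i - 1) z)) = (\<lambda>z. of_real (r i))"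
        using Eeq[OF i] by (rule ext)
      ultimately have "(\<lambda>z. of_real (r i)) has_fps_expansion
        (caputo_symbol \<alpha> * G i + fps_const (of_real \<mu>) * (2 * G i - G (i + 1) - G (i - 1)))" by simp
      then show ?thesis using fps_expansion_unique_complex has_fps_expansion_const by blast
    qed
    have Gbd: "norm (fps_nth (G i) m) \<le> C * real (m + 1) powr (\<alpha> - 1) * B" if i: "i \<le> K" for i m
    proof (cases "m = 0")
      case True
      have "c \<le> norm (w 0)" using low[of 0] by (simp add: w_def)
      then have "100 * B / norm (w 0) \<le> 100 * B / c" using B c by (intro frac_le) auto
      then have "norm (E i 0) \<le> 100 / c * B" using Ebd[of 0 i] i by simp
      also have "\<dots> \<le> C * B" unfolding C_def using B by (intro mult_right_mono) auto
      finally show ?thesis using True by (simp add: G_def fps_expansion_def)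
    next
      case False
      then have m: "1 \<le> m" by simp
      have "norm (fps_nth (G i) m) \<le> 48 / \<alpha> * (D * B) * real m powr (\<alpha> - 1)"
        unfolding G_def by (rule fps_expansion_nth_le[OF Ehol \<alpha> _ _ m]) (use D B Eder' i in auto)
      also have "\<dots> \<le> 48 / \<alpha> * (D * B) * (2 * real (m + 1) powr (\<alpha> - 1))"
      proof (rule mult_left_mono)
        have "real m powr (\<alpha> - 1) = 2 powr (1 - \<alpha>) * (2 * real m) powr (\<alpha> - 1)"
          using m by (simp add: powr_mult flip: powr_add mult.assoc)
        also have "\<dots> \<le> 2 * (real (m + 1)) powr (\<alpha> - 1)"
        proof (rule mult_mono)
          have "2 powr (1 - \<alpha>) \<le> 2 powr (1::real)" using \<alpha> by (intro powr_mono) auto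
          then show "2 powr (1 - \<alpha>) \<le> 2" by simp
          show "(2 * real m) powr (\<alpha> - 1) \<le> real (m + 1) powr (\<alpha> - 1)" using m \<alpha> by (intro powr_mono2') auto
        qed auto
        finally show "real m powr (\<alpha> - 1) \<le> 2 * real (m + 1) powr (\<alpha> - 1)" .
      qed (use D B \<alpha> in auto)
      also have "\<dots> = (48 / \<alpha> * D * 2) * (real (m + 1) powr (\<alpha> - 1) * B)" by simp
      also have "\<dots> \<le> C * (real (m + 1) powr (\<alpha> - 1) * B)"
        unfolding C_def using B by (intro mult_right_mono) auto
      finally show ?thesis by (simp add: mult.assoc)
    qed
    show "\<exists>G. G 0 = 0 \<and> G K = 0 \<and>
        (\<forall>i. 1 \<le> i \<longrightarrow> i < K \<longrightarrow> caputo_symbol \<alpha> * G i + fps_const (of_real \<mu>) * (2 * G i - G (i + 1) - G (i - 1))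
            = fps_const (of_real (r i))) \<and>
        (\<forall>i\<le>K. \<forall>m. norm (fps_nth (G i) m) \<le> C * real (m + 1) powr (\<alpha> - 1) * B)"
      by (intro exI[of _ G] conjI allI impI G0 GK Geq Gbd)
  qed
qed

section \<open>From impulse responses to stability of the convolution scheme\<close>

definition real_fps :: "complex fps \<Rightarrow> bool" where
  "real_fps F \<longleftrightarrow> (\<forall>n. Im (fps_nth F n) = 0)"

lemma real_fps_mult: "real_fps F \<Longrightarrow> real_fps G \<Longrightarrow> real_fps (F * G)"
  by (simp add: real_fps_def fps_mult_nth)

lemma real_fps_power: "real_fps F \<Longrightarrow> real_fps (F ^ n)"
  by (induction n) (auto intro: real_fps_mult, simp add: real_fps_def)

lemma real_fps_caputo_symbol: "real_fps (caputo_symbol \<alpha>)"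
proof -
  have "real_fps (1 - fps_X)" "real_fps (cell_fps \<alpha> g)" for g
    by (simp_all add: real_fps_def cell_fps_def fps_X_def)
  then have "real_fps ((1 - fps_X) ^ n * cell_fps \<alpha> g)" for n g
    by (intro real_fps_mult real_fps_power)
  from this[of 1] this[of 2] this[of 3] show ?thesis
    unfolding caputo_symbol_def by (simp add: real_fps_def)
qed

definition caputo_weight :: "real \<Rightarrow> nat \<Rightarrow> real" where
  "caputo_weight \<alpha> n = Re (fps_nth (caputo_symbol \<alpha>) n)"

lemma fps_nth_caputo_symbol: "fps_nth (caputo_symbol \<alpha>) n = of_real (caputo_weight \<alpha> n)"
  using real_fps_caputo_symbol[of \<alpha>] by (simp add: real_fps_def caputo_weight_def complex_eq_iff)

text \<open>Once the earlier coefficients vanish, only the leading coefficient of the symbol acts at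
  the current level. It is the value of the symbol at 0, a nonzero element of the sector, so the
  resolvent bound with zero data applies.\<close>

lemma convolution_unique:
  fixes D :: "nat \<Rightarrow> complex fps"
  assumes \<alpha>: "0 < \<alpha>" "\<alpha> < 1" and mu: "0 < \<mu>"
    and bc: "D 0 = 0" "\<And>n. n \<le> N \<Longrightarrow> fps_nth (D K) n = 0"
    and eq: "\<And>i n. 1 \<le> i \<Longrightarrow> i < K \<Longrightarrow> n \<le> N \<Longrightarrow>
      fps_nth (caputo_symbol \<alpha> * D i + fps_const (of_real \<mu>) * (2 * D i - D (i + 1) - D (i - 1))) n = 0"
    and n: "n \<le> N" and i: "i \<le> K"
  shows "fps_nth (D i) n = 0"
  using n i
proof (induction n arbitrary: i rule: less_induct)
  case (less n)
  define w where "w = fps_nth (caputo_symbol \<alpha>) 0"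
  obtain c where c: "0 < c" and sec: "\<And>z. norm z < 1 \<Longrightarrow> eval_fps (caputo_symbol \<alpha>) z \<in> obtuse_sector"
    and low: "\<And>z. norm z < 1 \<Longrightarrow> c * norm (1 - z) powr \<alpha> \<le> norm (eval_fps (caputo_symbol \<alpha>) z)"
    using caputo_symbol_estimates[OF \<alpha>] by metis
  have w: "w \<in> obtuse_sector" "w \<noteq> 0"
    using sec[of 0] low[of 0] c by (auto simp: w_def eval_fps_at_0)
  have "norm (fps_nth (D i) n) \<le> 100 * 0 / norm w"
  proof (rule discrete_resolvent_bound[where r = "\<lambda>_. 0" and K = K and E = "\<lambda>i. fps_nth (D i) n" and \<mu> = \<mu>])
    fix j assume j: "1 \<le> j" "j < K"
    have z: "fps_nth (caputo_symbol \<alpha>) l * fps_nth (D j) (n - l) = 0" if "l \<in> {1..n}" for l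
      using less.IH[of "n - l" j] that j less.prems by auto
    have "fps_nth (caputo_symbol \<alpha> * D j) n = (\<Sum>l=0..n. fps_nth (caputo_symbol \<alpha>) l * fps_nth (D j) (n - l))"
      by (rule fps_mult_nth)
    also have "\<dots> = w * fps_nth (D j) n + (\<Sum>l=1..n. fps_nth (caputo_symbol \<alpha>) l * fps_nth (D j) (n - l))"
      by (simp add: sum.atLeast_Suc_atMost w_def)
    also have "(\<Sum>l=1..n. fps_nth (caputo_symbol \<alpha>) l * fps_nth (D j) (n - l)) = 0"
      by (rule sum.neutral) (use z in blast)
    finally have "fps_nth (caputo_symbol \<alpha> * D j) n = w * fps_nth (D j) n" by simp
    then show "w * fps_nth (D j) n + of_real \<mu> * (2 * fps_nth (D j) n - fps_nth (D (j + 1)) n - fps_nth (D (j - 1)) n) = 0"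
      using eq[OF j less.prems(1)] by (simp add: numeral_fps_const)
  qed (use w mu bc less.prems in auto)
  then show ?case by simp
qed

text \<open>Superposition: data at level \<open>j\<close> produce an impulse response delayed by
  \<open>j\<close> steps, that is multiplied by \<open>fps_X ^ j\<close>. The sum \<open>H\<close>
  solves the same equations up to order \<open>N\<close>, and uniqueness identifies it with
  \<open>e\<close>.\<close>

lemma scheme_stability:
  assumes \<alpha>: "0 < \<alpha>" "\<alpha> < 1"
  obtains C where "0 < C"
    "\<And>K N \<mu> (e :: nat \<Rightarrow> nat \<Rightarrow> real) R b n i. 0 < K \<Longrightarrow> 0 < \<mu> \<Longrightarrow>
      (\<And>i. e i 0 = 0) \<Longrightarrow> (\<And>n. n \<le> N \<Longrightarrow> e 0 n = 0 \<and> e K n = 0) \<Longrightarrow>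
      (\<And>i n. 1 \<le> i \<Longrightarrow> i < K \<Longrightarrow> 1 \<le> n \<Longrightarrow> n \<le> N \<Longrightarrow>
        (\<Sum>j=0..n. caputo_weight \<alpha> (n - j) * e i j) + \<mu> * (2 * e i n - e (i + 1) n - e (i - 1) n) = R i n) \<Longrightarrow>
      (\<And>i n. 1 \<le> i \<Longrightarrow> i < K \<Longrightarrow> 1 \<le> n \<Longrightarrow> n \<le> N \<Longrightarrow> \<bar>R i n\<bar> \<le> b n) \<Longrightarrow>
      (\<And>n. 0 \<le> b n) \<Longrightarrow> n \<le> N \<Longrightarrow> i \<le> K \<Longrightarrow>
      \<bar>e i n\<bar> \<le> C * (\<Sum>j=1..n. real (n - j + 1) powr (\<alpha> - 1) * b j)"
proof -
  obtain C where C: "0 < C" and imp: "\<And>K \<mu> (r :: nat \<Rightarrow> real) B. 0 < K \<Longrightarrow> 0 < \<mu> \<Longrightarrow> 0 \<le> B \<Longrightarrow>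
      (\<And>i. 1 \<le> i \<Longrightarrow> i < K \<Longrightarrow> \<bar>r i\<bar> \<le> B) \<Longrightarrow>
      \<exists>G. G 0 = 0 \<and> G K = 0 \<and>
        (\<forall>i. 1 \<le> i \<longrightarrow> i < K \<longrightarrow> caputo_symbol \<alpha> * G i + fps_const (of_real \<mu>) * (2 * G i - G (i + 1) - G (i - 1))
            = fps_const (of_real (r i))) \<and>
        (\<forall>i\<le>K. \<forall>m. norm (fps_nth (G i) m) \<le> C * real (m + 1) powr (\<alpha> - 1) * B)"
    using impulse_response[OF \<alpha>] by blast
  show ?thesis
  proof (rule that[OF C])
    fix K N \<mu> and e :: "nat \<Rightarrow> nat \<Rightarrow> real" and R b n i
    assume K: "0 < K" and mu: "0 < \<mu>" and e0: "\<And>i. e i 0 = 0"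
      and bc: "\<And>n. n \<le> N \<Longrightarrow> e 0 n = 0 \<and> e K n = 0"
      and eq: "\<And>i n. 1 \<le> i \<Longrightarrow> i < K \<Longrightarrow> 1 \<le> n \<Longrightarrow> n \<le> N \<Longrightarrow>
        (\<Sum>j=0..n. caputo_weight \<alpha> (n - j) * e i j) + \<mu> * (2 * e i n - e (i + 1) n - e (i - 1) n) = R i n"
      and R: "\<And>i n. 1 \<le> i \<Longrightarrow> i < K \<Longrightarrow> 1 \<le> n \<Longrightarrow> n \<le> N \<Longrightarrow> \<bar>R i n\<bar> \<le> b n"
      and b: "\<And>n. 0 \<le> b n" and n: "n \<le> N" and i: "i \<le> K"
    have "\<forall>j\<in>{1..N}. \<exists>G. G 0 = 0 \<and> G K = 0 \<and>
        (\<forall>i. 1 \<le> i \<longrightarrow> i < K \<longrightarrow> caputo_symbol \<alpha> * G i + fps_const (of_real \<mu>) * (2 * G i - G (i + 1) - G (i - 1))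
            = fps_const (of_real (R i j))) \<and>
        (\<forall>i\<le>K. \<forall>m. norm (fps_nth (G i) m) \<le> C * real (m + 1) powr (\<alpha> - 1) * b j)"
      using R b by (intro ballI imp K mu) auto
    then obtain G where G: "\<And>j. j \<in> {1..N} \<Longrightarrow> G j 0 = 0" "\<And>j. j \<in> {1..N} \<Longrightarrow> G j K = 0"
      "\<And>i j. j \<in> {1..N} \<Longrightarrow> 1 \<le> i \<Longrightarrow> i < K \<Longrightarrow> caputo_symbol \<alpha> * G j i + fps_const (of_real \<mu>) * (2 * G j i - G j (i + 1) - G j (i - 1))
            = fps_const (of_real (R i j))"
      "\<And>i j m. j \<in> {1..N} \<Longrightarrow> i \<le> K \<Longrightarrow> norm (fps_nth (G j i) m) \<le> C * real (m + 1) powr (\<alpha> - 1) * b j"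
      unfolding bchoice_iff by metis
    define H where "H i = (\<Sum>j=1..N. fps_X ^ j * G j i)" for i
    \<comment> \<open>Cut off after \<open>N\<close>, where the equation is not assumed;
      coefficients up to order \<open>N\<close> do not see the difference.\<close>
    define ef :: "nat \<Rightarrow> complex fps" where "ef i = Abs_fps (\<lambda>m. if m \<le> N then of_real (e i m) else 0)" for i
    have Heq: "caputo_symbol \<alpha> * H i + fps_const (of_real \<mu>) * (2 * H i - H (i + 1) - H (i - 1))
      = (\<Sum>j=1..N. fps_X ^ j * fps_const (of_real (R i j)))" if i: "1 \<le> i" "i < K" for i
    proof -
      have "caputo_symbol \<alpha> * H i + fps_const (of_real \<mu>) * (2 * H i - H (i + 1) - H (i - 1))
        = (\<Sum>j=1..N. fps_X ^ j * (caputo_symbol \<alpha> * G j i + fps_const (of_real \<mu>) * (2 * G j i - G j (i + 1) - G j (i - 1))))"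
        unfolding H_def by (simp add: sum_distrib_left sum.distrib[symmetric] sum_subtractf[symmetric] algebra_simps)
      also have "\<dots> = (\<Sum>j=1..N. fps_X ^ j * fps_const (of_real (R i j)))"
        using G(3) i by (intro sum.cong) auto
      finally show ?thesis .
    qed
    have Hn: "fps_nth (H i) m = (\<Sum>j=1..m. fps_nth (G j i) (m - j))" if "m \<le> N" for i m
    proof -
      have "fps_nth (H i) m = (\<Sum>j=1..N. if m < j then 0 else fps_nth (G j i) (m - j))"
        unfolding H_def by (simp add: fps_sum_nth fps_X_power_mult_nth)
      also have "\<dots> = (\<Sum>j=1..m. if m < j then 0 else fps_nth (G j i) (m - j))"
        using that by (intro sum.mono_neutral_right) auto
      also have "\<dots> = (\<Sum>j=1..m. fps_nth (G j i) (m - j))" by (intro sum.cong) auto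
      finally show ?thesis .
    qed
    have "fps_nth (ef i - H i) n = 0"
    proof (rule convolution_unique[OF \<alpha> mu _ _ _ n i, where D = "\<lambda>i. ef i - H i"])
      show "ef 0 - H 0 = 0"
      proof -
        have "ef 0 = 0" using bc by (auto simp: ef_def fps_eq_iff)
        moreover have "H 0 = 0" using G(1) by (simp add: H_def)
        ultimately show ?thesis by simp
      qed
      show "fps_nth (ef K - H K) m = 0" if "m \<le> N" for m
      proof -
        have "H K = 0" using G(2) by (simp add: H_def)
        then show ?thesis using bc[OF that] by (simp add: ef_def)
      qed
      fix l m assume l: "1 \<le> l" "l < K" and m: "m \<le> N"
      have "fps_nth (caputo_symbol \<alpha> * ef l + fps_const (of_real \<mu>) * (2 * ef l - ef (l + 1) - ef (l - 1))) m
        = of_real ((\<Sum>j=0..m. caputo_weight \<alpha> (m - j) * e l j) + \<mu> * (2 * e l m - e (l + 1) m - e (l - 1) m))"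
      proof -
        have "fps_nth (caputo_symbol \<alpha> * ef l) m = fps_nth (ef l * caputo_symbol \<alpha>) m" by (simp add: mult.commute)
        also have "\<dots> = (\<Sum>j=0..m. of_real (caputo_weight \<alpha> (m - j) * e l j))"
          unfolding fps_mult_nth using m by (intro sum.cong) (auto simp: ef_def fps_nth_caputo_symbol)
        finally show ?thesis using m by (simp add: ef_def numeral_fps_const)
      qed
      \<comment> \<open>The hypothesis covers levels from 1 on; at level 0 the left-hand side
        vanishes by the zero initial values.\<close>
      also have "\<dots> = of_real (if m = 0 then 0 else R l m)"
        using eq[OF l, of m] m e0 by (cases "m = 0") auto
      also have "\<dots> = fps_nth (\<Sum>j=1..N. fps_X ^ j * fps_const (of_real (R l j))) m"
      proof -
        have "fps_nth (\<Sum>j=1..N. fps_X ^ j * fps_const (of_real (R l j))) m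
          = (\<Sum>j=1..N. if m = j then complex_of_real (R l j) else 0)"
          unfolding fps_sum_nth fps_X_power_mult_nth by (intro sum.cong) auto
        then show ?thesis using m by simp
      qed
      finally have "fps_nth (caputo_symbol \<alpha> * ef l + fps_const (of_real \<mu>) * (2 * ef l - ef (l + 1) - ef (l - 1))) m
        = fps_nth (caputo_symbol \<alpha> * H l + fps_const (of_real \<mu>) * (2 * H l - H (l + 1) - H (l - 1))) m"
        unfolding Heq[OF l] .
      moreover have "caputo_symbol \<alpha> * (ef l - H l) + fps_const (of_real \<mu>) * (2 * (ef l - H l) - (ef (l + 1) - H (l + 1)) - (ef (l - 1) - H (l - 1)))
        = (caputo_symbol \<alpha> * ef l + fps_const (of_real \<mu>) * (2 * ef l - ef (l + 1) - ef (l - 1)))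
         - (caputo_symbol \<alpha> * H l + fps_const (of_real \<mu>) * (2 * H l - H (l + 1) - H (l - 1)))"
        by (simp only: algebra_simps)
      ultimately show "fps_nth (caputo_symbol \<alpha> * (ef l - H l) + fps_const (of_real \<mu>) * (2 * (ef l - H l) - (ef (l + 1) - H (l + 1)) - (ef (l - 1) - H (l - 1)))) m = 0"
        by simp
    qed
    then have "complex_of_real (e i n) = (\<Sum>j=1..n. fps_nth (G j i) (n - j))"
      using n by (simp add: ef_def Hn)
    then have "\<bar>e i n\<bar> = norm (\<Sum>j=1..n. fps_nth (G j i) (n - j))"
      by (metis norm_of_real)
    also have "\<dots> \<le> (\<Sum>j=1..n. C * real (n - j + 1) powr (\<alpha> - 1) * b j)"
    proof (rule sum_norm_le)
      fix j assume "j \<in> {1..n}"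
      then have "j \<in> {1..N}" using n by auto
      then show "norm (fps_nth (G j i) (n - j)) \<le> C * real (n - j + 1) powr (\<alpha> - 1) * b j"
        using i by (rule G(4))
    qed
    also have "\<dots> = C * (\<Sum>j=1..n. real (n - j + 1) powr (\<alpha> - 1) * b j)"
      by (simp add: sum_distrib_left mult.assoc)
    finally show "\<bar>e i n\<bar> \<le> C * (\<Sum>j=1..n. real (n - j + 1) powr (\<alpha> - 1) * b j)" .
  qed
qed

text \<open>Each term is at most the increment of x powr \<alpha> / \<alpha> over the unit interval
  to its left, and the increments telescope.\<close>

lemma sum_powr_le:
  assumes "0 < \<alpha>" "\<alpha> < 1"
  shows "(\<Sum>j=1..n. real j powr (\<alpha> - 1)) \<le> real n powr \<alpha> / \<alpha>"
proof (induction n)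
  case (Suc n)
  have "real (Suc n) powr (\<alpha> - 1) \<le> (real (Suc n) powr \<alpha> - real n powr \<alpha>) / \<alpha>"
  proof (cases "n = 0")
    case False
    have "\<exists>z. real n < z \<and> z < real (Suc n) \<and> real (Suc n) powr \<alpha> - real n powr \<alpha> = (real (Suc n) - real n) * (\<alpha> * z powr (\<alpha> - 1))"
      by (rule MVT2) (use False in \<open>auto intro!: has_real_derivative_powr\<close>)
    then obtain z where z: "real n < z" "z < real (Suc n)" "real (Suc n) powr \<alpha> - real n powr \<alpha> = \<alpha> * z powr (\<alpha> - 1)"
      by auto
    have "real (Suc n) powr (\<alpha> - 1) \<le> z powr (\<alpha> - 1)"
      using z assms by (intro powr_mono2') auto
    then show ?thesis using z assms by (simp add: field_simps)
  qed (use assms in \<open>simp add: field_simps\<close>)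
  then have "real (Suc n) powr (\<alpha> - 1) \<le> real (Suc n) powr \<alpha> / \<alpha> - real n powr \<alpha> / \<alpha>"
    by (simp add: diff_divide_distrib)
  then show ?case using Suc.IH by simp
qed simp

section \<open>The discrete Caputo derivative on a uniform mesh\<close>

text \<open>Contribution of cell \<open>k\<close> at level \<open>n\<close>, up to the factor \<tau>
  powr (-\<alpha>) / Gamma (1 - \<alpha>). The case distinctions reflect the linear and the
  quadratic interpolant in the first two cells.\<close>

definition weighted_diff :: "real \<Rightarrow> nat \<Rightarrow> (nat \<Rightarrow> real) \<Rightarrow> nat \<Rightarrow> real" where
  "weighted_diff \<alpha> n v k =
     cell_moment \<alpha> (\<lambda>_. 1) (n - k) * (v k - v (k - 1))
   + (if k < 2 then 0 else cell_moment \<alpha> quad_weight (n - k) * (v k - 2 * v (k - 1) + v (k - 2)))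
   + (if k < 3 then 0 else cell_moment \<alpha> cubic_weight (n - k) * (v k - 3 * v (k - 1) + 3 * v (k - 2) - v (k - 3)))"

definition newton_slope :: "(nat \<Rightarrow> real) \<Rightarrow> nat \<Rightarrow> real \<Rightarrow> real" where
  "newton_slope v k s =
     (v k - v (k - 1))
   + (if k < 2 then 0 else quad_weight s * (v k - 2 * v (k - 1) + v (k - 2)))
   + (if k < 3 then 0 else cubic_weight s * (v k - 3 * v (k - 1) + 3 * v (k - 2) - v (k - 3)))"

lemma interp_poly_eqI:
  assumes "inj_on t {a..b}" "a \<le> b" "degree q \<le> b - a" "\<And>k. k \<in> {a..b} \<Longrightarrow> poly q (t k) = v k"
  shows "interp_poly t v a b = q"
  unfolding interp_poly_def
proof (rule the_equality)
  show *: "degree q \<le> b - a \<and> (\<forall>k\<in>{a..b}. poly q (t k) = v k)" using assms by blast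
  show "p = q" if "degree p \<le> b - a \<and> (\<forall>k\<in>{a..b}. poly p (t k) = v k)" for p
    using interp_poly_unique[OF assms(1,2), of p v q] that * by blast
qed

text \<open>Uniqueness identifies the interpolant with Newton's backward form in the variable
  \<theta>, which counts mesh steps from node \<open>k\<close> and equals - s at the point in
  question.\<close>

lemma poly_pderiv_interp_mesh:
  assumes \<tau>: "0 < \<tau>" and k: "1 \<le> k"
  shows "poly (pderiv (interp_poly (\<lambda>j. real j * \<tau>) v (k - 3) k)) ((real k - s) * \<tau>) = newton_slope v k s / \<tau>"
proof -
  define d1 where "d1 = v k - v (k - 1)"
  define d2 where "d2 = (if k < 2 then 0 else v k - 2 * v (k - 1) + v (k - 2))"
  define d3 where "d3 = (if k < 3 then 0 else v k - 3 * v (k - 1) + 3 * v (k - 2) - v (k - 3))"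
  define \<theta> where "\<theta> = [:- real k, 1 / \<tau>:]"
  define q where "q = [:v k:] + smult d1 \<theta> + smult (d2 / 2) (\<theta> * (\<theta> + 1)) + smult (d3 / 6) (\<theta> * (\<theta> + 1) * (\<theta> + 2))"
  have p\<theta>: "poly \<theta> ((real k - s) * \<tau>) = - s" for s
    using \<tau> by (simp add: \<theta>_def field_simps)
  have pq: "poly q ((real k - s) * \<tau>) = v k - s * d1 + d2 / 2 * (s * (s - 1)) - d3 / 6 * (s * (s - 1) * (s - 2))" for s
    unfolding q_def by (simp add: p\<theta>) (simp add: field_simps)
  have "interp_poly (\<lambda>j. real j * \<tau>) v (k - 3) k = q"
  proof (rule interp_poly_eqI)
    show "inj_on (\<lambda>j. real j * \<tau>) {k - 3..k}" using \<tau> by (auto simp: inj_on_def)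
    have d\<theta>: "degree \<theta> \<le> 1" "degree (\<theta> + 1) \<le> 1" "degree (\<theta> + 2) \<le> 1"
    proof -
      show 1: "degree \<theta> \<le> 1" by (simp add: \<theta>_def)
      show "degree (\<theta> + 1) \<le> 1" "degree (\<theta> + 2) \<le> 1"
        using 1 by (auto intro!: degree_add_le)
    qed
    have d2': "degree (\<theta> * (\<theta> + 1)) \<le> 2" using degree_mult_le[of \<theta> "\<theta> + 1"] d\<theta> by simp
    have d3': "degree (\<theta> * (\<theta> + 1) * (\<theta> + 2)) \<le> 3" using degree_mult_le[of "\<theta> * (\<theta> + 1)" "\<theta> + 2"] d\<theta> d2' by simp
    \<comment> \<open>With truncated subtraction \<open>k - (k - 3)\<close> is the minimum of
      \<open>k\<close> and 3. Where there are too few nodes for a difference its coefficient is 0,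
      and so is the summand.\<close>
    show "degree q \<le> k - (k - 3)" unfolding q_def
    proof (intro degree_add_le)
      show "degree (smult (d2 / 2) (\<theta> * (\<theta> + 1))) \<le> k - (k - 3)"
      proof (cases "k < 2")
        case False
        have "degree (smult (d2 / 2) (\<theta> * (\<theta> + 1))) \<le> 2" using d2' degree_smult_le order.trans by blast
        then show ?thesis using False by simp
      qed (simp add: d2_def)
      show "degree (smult (d3 / 6) (\<theta> * (\<theta> + 1) * (\<theta> + 2))) \<le> k - (k - 3)"
      proof (cases "k < 3")
        case False
        have "degree (smult (d3 / 6) (\<theta> * (\<theta> + 1) * (\<theta> + 2))) \<le> 3" using d3' degree_smult_le order.trans by blast
        then show ?thesis using False by simp
      qed (simp add: d3_def)
      have "degree (smult d1 \<theta>) \<le> 1" using d\<theta>(1) degree_smult_le order.trans by blast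
      then show "degree (smult d1 \<theta>) \<le> k - (k - 3)" using k by simp
    qed simp
    fix j assume j: "j \<in> {k - 3..k}"
    define i where "i = k - j"
    have ji: "real j = real k - real i" "j = k - i" "i \<le> 3" "i \<le> k" using j by (auto simp: i_def)
    then consider "i = 0" | "i = 1" "1 \<le> k" | "i = 2" "2 \<le> k" | "i = 3" "3 \<le> k" by linarith
    then show "poly q (real j * \<tau>) = v j"
      unfolding ji(1) pq using ji(2)
      by cases (auto simp: d1_def d2_def d3_def field_simps)
  qed simp
  moreover have "poly (pderiv q) ((real k - s) * \<tau>) = newton_slope v k s / \<tau>"
  proof -
    have pd: "pderiv \<theta> = [:1 / \<tau>:]" by (simp add: \<theta>_def pderiv_pCons)
    have "poly (pderiv q) ((real k - s) * \<tau>) = d1 / \<tau> + d2 / 2 * ((- s) / \<tau> + (1 - s) / \<tau>)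
       + d3 / 6 * ((- s) * (1 - s) / \<tau> + (2 - s) * ((- s) / \<tau> + (1 - s) / \<tau>))"
      unfolding q_def by (simp add: pderiv_add pderiv_smult pderiv_mult pd p\<theta> pderiv_pCons)
    also have "\<dots> = (d1 + quad_weight s * d2 + cubic_weight s * d3) / \<tau>"
      using \<tau> by (simp add: quad_weight_def cubic_weight_def power2_eq_square field_simps)
    also have "d1 + quad_weight s * d2 + cubic_weight s * d3 = newton_slope v k s"
      by (simp add: newton_slope_def d1_def d2_def d3_def)
    finally show ?thesis .
  qed
  ultimately show ?thesis by simp
qed

lemma cell_moment_has_integral:
  assumes "0 < \<alpha>" "\<alpha> < 1" "g \<in> borel_measurable borel" "\<forall>s\<in>{0..1}. \<bar>g s\<bar> \<le> (1::real)"
  shows "((\<lambda>s. (real j + s) powr (-\<alpha>) * g s) has_integral cell_moment \<alpha> g j) {0..1}"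
proof -
  have "set_integrable lborel {0..1} (\<lambda>s. (real j + s) powr (-\<alpha>) * g s)"
    by (rule cell_moment_integrable) (use assms in auto)
  from set_borel_integral_eq_integral[OF this] show ?thesis
    by (simp add: cell_moment_def has_integral_iff)
qed

lemma newton_slope_has_integral:
  assumes \<alpha>: "0 < \<alpha>" "\<alpha> < 1"
  shows "((\<lambda>s. (real (n - k) + s) powr (-\<alpha>) * newton_slope v k s) has_integral weighted_diff \<alpha> n v k) {0..1}"
proof -
  define d1 where "d1 = v k - v (k - 1)"
  define d2 where "d2 = (if k < 2 then 0 else v k - 2 * v (k - 1) + v (k - 2))"
  define d3 where "d3 = (if k < 3 then 0 else v k - 3 * v (k - 1) + 3 * v (k - 2) - v (k - 3))"
  let ?p = "\<lambda>s. (real (n - k) + s) powr (-\<alpha>)"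
  have "((\<lambda>s. ?p s * 1 * d1 + ?p s * quad_weight s * d2 + ?p s * cubic_weight s * d3) has_integral
     (cell_moment \<alpha> (\<lambda>_. 1) (n - k) * d1 + cell_moment \<alpha> quad_weight (n - k) * d2 + cell_moment \<alpha> cubic_weight (n - k) * d3)) {0..1}"
    by (intro has_integral_add has_integral_mult_left cell_moment_has_integral \<alpha>
        quad_weight_measurable cubic_weight_measurable abs_quad_weight_le abs_cubic_weight_le) auto
  moreover have "?p s * 1 * d1 + ?p s * quad_weight s * d2 + ?p s * cubic_weight s * d3 = ?p s * newton_slope v k s" for s
    by (simp add: newton_slope_def d1_def d2_def d3_def algebra_simps)
  moreover have "cell_moment \<alpha> (\<lambda>_. 1) (n - k) * d1 + cell_moment \<alpha> quad_weight (n - k) * d2 + cell_moment \<alpha> cubic_weight (n - k) * d3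
     = weighted_diff \<alpha> n v k"
    by (simp add: weighted_diff_def d1_def d2_def d3_def)
  ultimately show ?thesis by simp
qed

text \<open>Substituting x = (k - s) \<tau> in each cell, the kernel contributes \<tau> powr
  (-\<alpha>), while the 1 / \<tau> of the slope cancels against dx.\<close>

lemma discrete_caputo_mesh:
  assumes \<alpha>: "0 < \<alpha>" "\<alpha> < 1" and \<tau>: "0 < \<tau>"
  shows "discrete_caputo \<alpha> (\<lambda>j. real j * \<tau>) n v = \<tau> powr (-\<alpha>) / Gamma (1 - \<alpha>) * (\<Sum>k=1..n. weighted_diff \<alpha> n v k)"
proof -
  have "integral {real (k - 1) * \<tau>..real k * \<tau>}
          (\<lambda>s. (real n * \<tau> - s) powr (-\<alpha>) * poly (pderiv (interp_poly (\<lambda>j. real j * \<tau>) v (k - 3) k)) s)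
        = \<tau> powr (-\<alpha>) * weighted_diff \<alpha> n v k" if k: "k \<in> {1..n}" for k
  proof -
    have k1: "1 \<le> k" "k \<le> n" using k by auto
    define F where "F s = (real n * \<tau> - s) powr (-\<alpha>) * poly (pderiv (interp_poly (\<lambda>j. real j * \<tau>) v (k - 3) k)) s" for s
    define f where "f s = (real (n - k) + s) powr (-\<alpha>) * newton_slope v k s" for s
    have Ff: "F ((real k - s) * \<tau>) = \<tau> powr (-\<alpha>) / \<tau> * f s" if "0 \<le> s" for s
    proof -
      have "real n * \<tau> - (real k - s) * \<tau> = \<tau> * (real (n - k) + s)" using k1 by (simp add: of_nat_diff algebra_simps)
      then show ?thesis
        unfolding F_def f_def poly_pderiv_interp_mesh[OF \<tau> k1(1)] using \<tau> that by (simp add: powr_mult)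
    qed
    have "(f has_integral weighted_diff \<alpha> n v k) (cbox 0 1)"
      unfolding f_def using newton_slope_has_integral[OF \<alpha>] by simp
    from has_integral_affinity[OF this, of "- 1 / \<tau>" "real k"]
    have "((\<lambda>x. f ((- 1 / \<tau>) * x + real k)) has_integral (\<tau> * weighted_diff \<alpha> n v k)) ((\<lambda>x. - (\<tau> * x) + real k * \<tau>) ` {0..1})"
      using \<tau> by (simp add: field_simps)
    moreover have "(\<lambda>x. - (\<tau> * x) + real k * \<tau>) ` {0..1} = {real (k - 1) * \<tau>..real k * \<tau>}"
      using image_affinity_atLeastAtMost[of "-\<tau>" "real k * \<tau>" 0 1] \<tau> k1 by (simp add: of_nat_diff algebra_simps)
    ultimately have "((\<lambda>x. \<tau> powr (-\<alpha>) / \<tau> * f ((- 1 / \<tau>) * x + real k)) has_integral (\<tau> powr (-\<alpha>) / \<tau> * (\<tau> * weighted_diff \<alpha> n v k))) {real (k - 1) * \<tau>..real k * \<tau>}"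
      by (intro has_integral_mult_right) simp
    then have "(F has_integral (\<tau> powr (-\<alpha>) / \<tau> * (\<tau> * weighted_diff \<alpha> n v k))) {real (k - 1) * \<tau>..real k * \<tau>}"
    proof (rule has_integral_eq[rotated])
      fix x assume x: "x \<in> {real (k - 1) * \<tau>..real k * \<tau>}"
      define s where "s = (- 1 / \<tau>) * x + real k"
      have "x = (real k - s) * \<tau>" using \<tau> by (simp add: s_def field_simps)
      moreover have "0 \<le> s" using x \<tau> by (simp add: s_def field_simps)
      ultimately show "\<tau> powr (-\<alpha>) / \<tau> * f ((- 1 / \<tau>) * x + real k) = F x"
        using Ff[of s] by (simp add: s_def[symmetric])
    qed
    then show ?thesis using \<tau> unfolding F_def by (simp add: integral_unique)
  qed
  then show ?thesis
    unfolding discrete_caputo_def by (simp add: sum_distrib_left[symmetric])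
qed

text \<open>
  For \<open>v 0 = 0\<close> the differences used by the scheme at \<open>k = 1, 2\<close> deviate from those of the extension of \<open>v\<close>
  by zero to negative indices, which is what the convolution sees.
\<close>

definition start_correction :: "real \<Rightarrow> nat \<Rightarrow> (nat \<Rightarrow> real) \<Rightarrow> nat \<Rightarrow> real" where
  "start_correction \<alpha> n v k =
     (if k = 1 then (cell_moment \<alpha> quad_weight (n - 1) + cell_moment \<alpha> cubic_weight (n - 1)) * v 1
      else if k = 2 then cell_moment \<alpha> cubic_weight (n - 2) * (v 2 - 3 * v 1) else 0)"

text \<open>The coefficients of (1 - X) V, (1 - X)^2 V and (1 - X)^3 V are the differences of the
  extension by zero. From k = 3 on they coincide with those in \<open>weighted_diff\<close>, and the
  two remaining cells give the correction.\<close>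

lemma caputo_weight_convolution:
  assumes v0: "v 0 = 0"
  shows "(\<Sum>j=0..n. caputo_weight \<alpha> (n - j) * v j) = (\<Sum>k=1..n. weighted_diff \<alpha> n v k + start_correction \<alpha> n v k)"
proof -
  define V :: "complex fps" where "V = Abs_fps (\<lambda>m. of_real (v m))"
  have X: "fps_nth ((1 - fps_X) * F) k = fps_nth F k - (if k = 0 then 0 else fps_nth F (k - 1))" for F :: "complex fps" and k
    by (simp add: left_diff_distrib)
  define D1 where "D1 = (1 - fps_X) * V"
  define D2 where "D2 = (1 - fps_X) * D1"
  define D3 where "D3 = (1 - fps_X) * D2"
  define c1 where "c1 k = (if k = 0 then 0 else v k - v (k - 1))" for k
  define c2 where "c2 k = c1 k - (if k = 0 then 0 else c1 (k - 1))" for k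
  define c3 where "c3 k = c2 k - (if k = 0 then 0 else c2 (k - 1))" for k
  have D: "fps_nth D1 k = of_real (c1 k)" "fps_nth D2 k = of_real (c2 k)" "fps_nth D3 k = of_real (c3 k)" for k
  proof -
    show 1: "fps_nth D1 k = of_real (c1 k)" for k unfolding D1_def X using v0 by (simp add: V_def c1_def)
    show 2: "fps_nth D2 k = of_real (c2 k)" for k unfolding D2_def X 1 by (simp add: c2_def)
    show "fps_nth D3 k = of_real (c3 k)" unfolding D3_def X 2 by (simp add: c3_def)
  qed
  have WV: "caputo_symbol \<alpha> * V = D1 * cell_fps \<alpha> (\<lambda>_. 1) + D2 * cell_fps \<alpha> quad_weight + D3 * cell_fps \<alpha> cubic_weight"
    unfolding caputo_symbol_def D3_def D2_def D1_def by (simp add: algebra_simps power2_eq_square power3_eq_cube)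
  have "complex_of_real (\<Sum>j=0..n. caputo_weight \<alpha> (n - j) * v j) = fps_nth (caputo_symbol \<alpha> * V) n"
    unfolding mult.commute[of _ V] fps_mult_nth of_real_sum
    by (intro sum.cong) (simp_all add: V_def fps_nth_caputo_symbol)
  also have "\<dots> = of_real (\<Sum>k=0..n. c1 k * cell_moment \<alpha> (\<lambda>_. 1) (n - k) + c2 k * cell_moment \<alpha> quad_weight (n - k)
      + c3 k * cell_moment \<alpha> cubic_weight (n - k))"
    unfolding WV fps_add_nth fps_mult_nth D by (simp add: cell_fps_def sum.distrib)
  finally have "(\<Sum>j=0..n. caputo_weight \<alpha> (n - j) * v j) = (\<Sum>k=0..n. c1 k * cell_moment \<alpha> (\<lambda>_. 1) (n - k)
      + c2 k * cell_moment \<alpha> quad_weight (n - k) + c3 k * cell_moment \<alpha> cubic_weight (n - k))"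
    by (simp only: of_real_eq_iff)
  also have "\<dots> = (\<Sum>k=1..n. c1 k * cell_moment \<alpha> (\<lambda>_. 1) (n - k)
      + c2 k * cell_moment \<alpha> quad_weight (n - k) + c3 k * cell_moment \<alpha> cubic_weight (n - k))"
    by (simp add: sum.atLeast_Suc_atMost c3_def c2_def c1_def)
  also have "\<dots> = (\<Sum>k=1..n. weighted_diff \<alpha> n v k + start_correction \<alpha> n v k)"
  proof (rule sum.cong[OF refl])
    fix k assume "k \<in> {1..n}"
    then consider "k = 1" | "k = 2" | l where "k = Suc (Suc (Suc l))"
      by (metis One_nat_def Suc_1 atLeastAtMost_iff not0_implies_Suc not_one_le_zero)
    then show "c1 k * cell_moment \<alpha> (\<lambda>_. 1) (n - k)
      + c2 k * cell_moment \<alpha> quad_weight (n - k) + c3 k * cell_moment \<alpha> cubic_weight (n - k)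
      = weighted_diff \<alpha> n v k + start_correction \<alpha> n v k"
    proof cases
      case 1
      then show ?thesis using v0 by (simp add: weighted_diff_def start_correction_def c3_def c2_def c1_def algebra_simps)
    next
      case 2
      then have "k - 1 = 1" "k - 2 = 0" "k \<noteq> 0" "k \<noteq> 1" by auto
      then show ?thesis using v0 2 unfolding weighted_diff_def start_correction_def c3_def c2_def c1_def
        by (simp add: algebra_simps)
    next
      case (3 l)
      have e: "Suc (Suc (Suc l)) - 2 = Suc l" "Suc (Suc (Suc l)) - 3 = l" by auto
      show ?thesis using v0 unfolding 3 weighted_diff_def start_correction_def c3_def c2_def c1_def e
        by (simp add: algebra_simps)
    qed
  qed
  finally show ?thesis .
qed

text \<open>As \<open>g\<close> has mean zero, the constant (j + 1) powr (-\<alpha>) may be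
  subtracted from the kernel; only the oscillation of the kernel over the cell is left.\<close>

lemma abs_cell_moment_le:
  assumes \<alpha>: "0 < \<alpha>" "\<alpha> < 1" and g: "g \<in> borel_measurable borel" "\<forall>s\<in>{0..1}. \<bar>g s\<bar> \<le> (1::real)"
    and z: "(g has_integral 0) {0..1}" and j: "1 \<le> j"
  shows "\<bar>cell_moment \<alpha> g j\<bar> \<le> real j powr (-\<alpha>) - real (j + 1) powr (-\<alpha>)"
proof -
  have "((\<lambda>s. (real j + s) powr (-\<alpha>) * g s - real (j + 1) powr (-\<alpha>) * g s) has_integral
      (cell_moment \<alpha> g j - real (j + 1) powr (-\<alpha>) * 0)) {0..1}"
    by (intro has_integral_diff cell_moment_has_integral has_integral_mult_right z \<alpha> g)
  then have I: "((\<lambda>s. ((real j + s) powr (-\<alpha>) - real (j + 1) powr (-\<alpha>)) * g s) has_integral cell_moment \<alpha> g j) {0..1}"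
    by (simp add: left_diff_distrib)
  have "norm (cell_moment \<alpha> g j) \<le> (real j powr (-\<alpha>) - real (j + 1) powr (-\<alpha>)) * measure lborel (cbox 0 (1::real))"
  proof (rule has_integral_bound[OF _ I[unfolded box_real[symmetric]]])
    have m: "real (j + 1) powr (-\<alpha>) \<le> (real j + s) powr (-\<alpha>)" "(real j + s) powr (-\<alpha>) \<le> real j powr (-\<alpha>)" if "s \<in> {0..1}" for s
      using that j \<alpha> by (auto intro!: powr_mono2')
    show "0 \<le> real j powr (-\<alpha>) - real (j + 1) powr (-\<alpha>)" using m[of 0] by simp
    fix s :: real assume "s \<in> cbox 0 1"
    then have s: "s \<in> {0..1}" by simp
    have "\<bar>(real j + s) powr (-\<alpha>) - real (j + 1) powr (-\<alpha>)\<bar> * \<bar>g s\<bar> \<le> (real j powr (-\<alpha>) - real (j + 1) powr (-\<alpha>)) * 1"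
      using m[OF s] m[of 0] g(2) s by (intro mult_mono) auto
    then show "norm (((real j + s) powr (-\<alpha>) - real (j + 1) powr (-\<alpha>)) * g s) \<le> real j powr (-\<alpha>) - real (j + 1) powr (-\<alpha>)"
      by (simp add: abs_mult)
  qed
  then show ?thesis by simp
qed

lemma sum_abs_cell_moment_le:
  assumes \<alpha>: "0 < \<alpha>" "\<alpha> < 1" and g: "g \<in> borel_measurable borel" "\<forall>s\<in>{0..1}. \<bar>g s\<bar> \<le> (1::real)"
    and z: "(g has_integral 0) {0..1}"
  shows "(\<Sum>j<n. \<bar>cell_moment \<alpha> g j\<bar>) \<le> \<bar>cell_moment \<alpha> g 0\<bar> + 1"
proof -
  \<comment> \<open>The term - n powr (-\<alpha>) makes the induction telescope; the singular cell j
    = 0 is kept as it is.\<close>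
  have "(\<Sum>j<n. \<bar>cell_moment \<alpha> g j\<bar>) \<le> \<bar>cell_moment \<alpha> g 0\<bar> + 1 - real n powr (-\<alpha>)" if "1 \<le> n"
    using that
  proof (induction n rule: dec_induct)
    case base show ?case by simp
  next
    case (step n)
    then show ?case using abs_cell_moment_le[OF \<alpha> g z, of n] by (simp add: add.commute)
  qed
  then show ?thesis by (cases "n = 0") (auto intro: order.trans)
qed

lemma cell_moment_one_ge:
  assumes \<alpha>: "0 < \<alpha>" "\<alpha> < 1"
  shows "1 \<le> cell_moment \<alpha> (\<lambda>_. 1) 0"
proof -
  have c: "((\<lambda>s::real. 1::real) has_integral 1) {0..1}" using has_integral_const_real[of "1::real" 0 1] by simp
  have "((\<lambda>s. (real 0 + s) powr (-\<alpha>) * 1) has_integral cell_moment \<alpha> (\<lambda>_. 1) 0) {0..1}"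
    by (intro cell_moment_has_integral \<alpha>) auto
  \<comment> \<open>The value at 0 is changed because \<open>0 powr (-\<alpha>) = 0\<close> would
    violate the pointwise comparison with 1.\<close>
  then have "((\<lambda>s. if s = 0 then 1 else (real 0 + s) powr (-\<alpha>) * 1) has_integral cell_moment \<alpha> (\<lambda>_. 1) 0) {0..1}"
    by (rule has_integral_spike_finite[of "{0}", rotated 2]) auto
  with c show ?thesis
  proof (rule has_integral_le)
    fix s :: real assume s: "s \<in> {0..1}"
    show "1 \<le> (if s = 0 then 1 else (real 0 + s) powr (-\<alpha>) * 1)"
    proof (cases "s = 0")
      case False
      then have "1 powr (-\<alpha>) \<le> s powr (-\<alpha>)" using \<alpha> s by (intro powr_mono2') auto
      then show ?thesis using False by simp
    qed simp
  qed
qed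

text \<open>The weight changes sign, but the density of its Laplace representation is
  nonnegative.\<close>

lemma cell_moment_quad_nonneg:
  assumes \<alpha>: "0 < \<alpha>" "\<alpha> < 1"
  shows "0 \<le> cell_moment \<alpha> quad_weight 0"
proof -
  have "has_bochner_integral lborel (\<lambda>x. gamma_weight \<alpha> x * cell_laplace quad_weight x * exp (- (real 0 * x)))
      (cell_moment \<alpha> quad_weight 0)"
    by (intro cell_moment_laplace \<alpha>) (use abs_quad_weight_le in auto)
  then have "cell_moment \<alpha> quad_weight 0
      = (\<integral>x. gamma_weight \<alpha> x * cell_laplace quad_weight x * exp (- (real 0 * x)) \<partial>lborel)"
    by (simp only: has_bochner_integral_iff)
  moreover have "0 \<le> gamma_weight \<alpha> x * cell_laplace quad_weight x * exp (- (real 0 * x))" for x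
    using cell_density_bounds(1,2)[OF \<alpha>, of x] by (simp add: cell_density_def)
  then have "0 \<le> (\<integral>x. gamma_weight \<alpha> x * cell_laplace quad_weight x * exp (- (real 0 * x)) \<partial>lborel)"
    by (intro integral_nonneg_AE AE_I2)
  ultimately show ?thesis by simp
qed

lemma real_resolvent_bound:
  fixes e r :: "nat \<Rightarrow> real"
  assumes "0 < \<omega>" "0 < \<mu>" "e 0 = 0" "e K = 0"
    "\<And>i. 1 \<le> i \<Longrightarrow> i < K \<Longrightarrow> \<omega> * e i + \<mu> * (2 * e i - e (i + 1) - e (i - 1)) = r i"
    "\<And>i. 1 \<le> i \<Longrightarrow> i < K \<Longrightarrow> \<bar>r i\<bar> \<le> B" "0 \<le> B" "i \<le> K"
  shows "\<bar>e i\<bar> \<le> 100 * B / \<omega>"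
proof -
  have "norm (complex_of_real (e i)) \<le> 100 * B / norm (complex_of_real \<omega>)"
  proof (rule discrete_resolvent_bound[where r = "\<lambda>i. of_real (r i)" and \<mu> = \<mu> and K = K and E = "\<lambda>i. of_real (e i)"])
    fix j assume "1 \<le> j" "j < K"
    from assms(5)[OF this] show "of_real \<omega> * of_real (e j) + of_real \<mu> * (2 * of_real (e j) - of_real (e (j + 1)) - of_real (e (j - 1)))
      = complex_of_real (r j)"
      by (metis (no_types, opaque_lifting) of_real_add of_real_diff of_real_mult of_real_numeral)
  qed (use assms in \<open>auto simp: obtuse_sector_def\<close>)
  then show ?thesis using assms(1) by simp
qed

text \<open>The start corrections involve only the first two errors. These solve elliptic problems
  with leading coefficients \<open>a0\<close> and \<open>a0 + q 0\<close>, both at least 1, and are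
  bounded through the resolvent estimate. Moved to the right-hand side, the corrections have
  coefficients whose sum over the levels is bounded, so the number of steps does not enter.\<close>

lemma weighted_scheme_stability:
  assumes \<alpha>: "0 < \<alpha>" "\<alpha> < 1"
  obtains C where "0 < C"
    "\<And>K N \<mu> (e :: nat \<Rightarrow> nat \<Rightarrow> real) R b n i. 0 < K \<Longrightarrow> 0 < \<mu> \<Longrightarrow>
      (\<And>i. e i 0 = 0) \<Longrightarrow> (\<And>n. n \<le> N \<Longrightarrow> e 0 n = 0 \<and> e K n = 0) \<Longrightarrow>
      (\<And>i n. 1 \<le> i \<Longrightarrow> i < K \<Longrightarrow> 1 \<le> n \<Longrightarrow> n \<le> N \<Longrightarrow>
        (\<Sum>k=1..n. weighted_diff \<alpha> n (e i) k) + \<mu> * (2 * e i n - e (i + 1) n - e (i - 1) n) = R i n) \<Longrightarrow>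
      (\<And>i n. 1 \<le> i \<Longrightarrow> i < K \<Longrightarrow> 1 \<le> n \<Longrightarrow> n \<le> N \<Longrightarrow> \<bar>R i n\<bar> \<le> b n) \<Longrightarrow>
      (\<And>n. 0 \<le> b n) \<Longrightarrow> n \<le> N \<Longrightarrow> i \<le> K \<Longrightarrow>
      \<bar>e i n\<bar> \<le> C * ((\<Sum>j=1..n. real (n - j + 1) powr (\<alpha> - 1) * b j) + b 1 + b 2)"
proof -
  obtain C0 where C0: "0 < C0" and stab: "\<And>K N \<mu> (e :: nat \<Rightarrow> nat \<Rightarrow> real) R b n i. 0 < K \<Longrightarrow> 0 < \<mu> \<Longrightarrow>
      (\<And>i. e i 0 = 0) \<Longrightarrow> (\<And>n. n \<le> N \<Longrightarrow> e 0 n = 0 \<and> e K n = 0) \<Longrightarrow>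
      (\<And>i n. 1 \<le> i \<Longrightarrow> i < K \<Longrightarrow> 1 \<le> n \<Longrightarrow> n \<le> N \<Longrightarrow>
        (\<Sum>j=0..n. caputo_weight \<alpha> (n - j) * e i j) + \<mu> * (2 * e i n - e (i + 1) n - e (i - 1) n) = R i n) \<Longrightarrow>
      (\<And>i n. 1 \<le> i \<Longrightarrow> i < K \<Longrightarrow> 1 \<le> n \<Longrightarrow> n \<le> N \<Longrightarrow> \<bar>R i n\<bar> \<le> b n) \<Longrightarrow>
      (\<And>n. 0 \<le> b n) \<Longrightarrow> n \<le> N \<Longrightarrow> i \<le> K \<Longrightarrow>
      \<bar>e i n\<bar> \<le> C0 * (\<Sum>j=1..n. real (n - j + 1) powr (\<alpha> - 1) * b j)"
    using scheme_stability[OF \<alpha>] by blast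
  define q where "q = cell_moment \<alpha> quad_weight"
  define c where "c = cell_moment \<alpha> cubic_weight"
  define a0 where "a0 = cell_moment \<alpha> (\<lambda>_. 1) 0"
  \<comment> \<open>Modulus of the coefficient of the first error in the equation at level 2. That
    level then gives 100 * (b 2 + P * (100 * b 1)), which explains \<open>M\<close>.\<close>
  define P where "P = \<bar>cell_moment \<alpha> (\<lambda>_. 1) 1 - a0 - 2 * q 0\<bar>"
  define M where "M = 100 * (1 + 100 * P)"
  define S where "S = (\<bar>q 0\<bar> + 1) + (\<bar>c 0\<bar> + 1)"
  have a0: "1 \<le> a0" unfolding a0_def by (rule cell_moment_one_ge[OF \<alpha>])
  have q0: "0 \<le> q 0" unfolding q_def by (rule cell_moment_quad_nonneg[OF \<alpha>])
  have P: "0 \<le> P" by (simp add: P_def)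
  have M: "100 \<le> M" using P by (simp add: M_def)
  have S: "2 \<le> S" by (simp add: S_def)
  define C where "C = C0 * (1 + 5 * S * M)"
  show ?thesis
  proof (rule that[of C])
    show "0 < C" using C0 S M by (simp add: C_def add_pos_nonneg)
    fix K N \<mu> and e :: "nat \<Rightarrow> nat \<Rightarrow> real" and R b n i
    assume K: "0 < K" and mu: "0 < \<mu>" and e0: "\<And>i. e i 0 = 0"
      and bc: "\<And>n. n \<le> N \<Longrightarrow> e 0 n = 0 \<and> e K n = 0"
      and eq: "\<And>i n. 1 \<le> i \<Longrightarrow> i < K \<Longrightarrow> 1 \<le> n \<Longrightarrow> n \<le> N \<Longrightarrow>
        (\<Sum>k=1..n. weighted_diff \<alpha> n (e i) k) + \<mu> * (2 * e i n - e (i + 1) n - e (i - 1) n) = R i n"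
      and R: "\<And>i n. 1 \<le> i \<Longrightarrow> i < K \<Longrightarrow> 1 \<le> n \<Longrightarrow> n \<le> N \<Longrightarrow> \<bar>R i n\<bar> \<le> b n"
      and b: "\<And>n. 0 \<le> b n" and n: "n \<le> N" and i: "i \<le> K"
    define B where "B = M * (b 1 + b 2)"
    have B: "0 \<le> B" using M b by (simp add: B_def)
    have e1: "\<bar>e i 1\<bar> \<le> 100 * b 1" if N: "1 \<le> N" and i: "i \<le> K" for i
    proof -
      have "\<bar>e i 1\<bar> \<le> 100 * b 1 / a0"
      proof (rule real_resolvent_bound[where r = "\<lambda>i. R i 1" and K = K and \<mu> = \<mu> and e = "\<lambda>i. e i 1"])
        fix j assume j: "1 \<le> j" "j < K"
        show "a0 * e j 1 + \<mu> * (2 * e j 1 - e (j + 1) 1 - e (j - 1) 1) = R j 1"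
          using eq[OF j, of 1] N e0 by (simp add: weighted_diff_def a0_def)
        show "\<bar>R j 1\<bar> \<le> b 1" using R[OF j, of 1] N by simp
      qed (use a0 mu bc N b i in auto)
      also have "\<dots> \<le> 100 * b 1 / 1" using a0 b by (intro divide_left_mono) auto
      finally show ?thesis by simp
    qed
    have e2: "\<bar>e i 2\<bar> \<le> B" if N: "2 \<le> N" and i: "i \<le> K" for i
    proof -
      have "\<bar>e i 2\<bar> \<le> 100 * (b 2 + P * (100 * b 1)) / (a0 + q 0)"
      proof (rule real_resolvent_bound[where r = "\<lambda>i. R i 2 - (cell_moment \<alpha> (\<lambda>_. 1) 1 - a0 - 2 * q 0) * e i 1" and K = K and \<mu> = \<mu> and e = "\<lambda>i. e i 2"])
        fix j assume j: "1 \<le> j" "j < K"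
        have two: "{1..2::nat} = {1, 2}" by auto
        show "(a0 + q 0) * e j 2 + \<mu> * (2 * e j 2 - e (j + 1) 2 - e (j - 1) 2) = R j 2 - (cell_moment \<alpha> (\<lambda>_. 1) 1 - a0 - 2 * q 0) * e j 1"
          using eq[OF j, of 2] N e0 unfolding two by (simp add: weighted_diff_def a0_def q_def algebra_simps)
        have "\<bar>(cell_moment \<alpha> (\<lambda>_. 1) 1 - a0 - 2 * q 0) * e j 1\<bar> \<le> P * (100 * b 1)"
          unfolding abs_mult P_def using e1[of j] N j by (intro mult_left_mono) auto
        then show "\<bar>R j 2 - (cell_moment \<alpha> (\<lambda>_. 1) 1 - a0 - 2 * q 0) * e j 1\<bar> \<le> b 2 + P * (100 * b 1)"
          using R[OF j, of 2] N by linarith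
      qed (use a0 q0 mu bc N b i P in auto)
      also have "\<dots> \<le> 100 * (b 2 + P * (100 * b 1)) / 1"
        using a0 q0 b P by (intro divide_left_mono) auto
      also have "\<dots> \<le> B"
        using b[of 1] mult_nonneg_nonneg[OF P b[of 2]] by (simp add: B_def M_def algebra_simps)
      finally show ?thesis .
    qed
    have e1': "\<bar>e i 1\<bar> \<le> B" if "1 \<le> N" "i \<le> K" for i
    proof -
      have "100 * b 1 \<le> M * (b 1 + b 2)" using M b by (intro mult_mono) auto
      then show ?thesis using e1[OF that] by (simp add: B_def)
    qed
    \<comment> \<open>The correction at level \<open>n\<close> in units of \<open>B\<close>; the 4
      stems from |e i 2 - 3 * e i 1| <= 4 B. In the sum the cubic moments occur with total factor
      5.\<close>
    define g where "g n = \<bar>q (n - 1)\<bar> + \<bar>c (n - 1)\<bar> + (if n < 2 then 0 else \<bar>c (n - 2)\<bar> * 4)" for n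
    have corr: "\<bar>\<Sum>k=1..n. start_correction \<alpha> n (e i) k\<bar> \<le> g n * B" if i: "i \<le> K" and n: "1 \<le> n" "n \<le> N" for i n
    proof -
      have "(\<Sum>k=1..n. start_correction \<alpha> n (e i) k) = (q (n - 1) + c (n - 1)) * e i 1 + (if n < 2 then 0 else c (n - 2) * (e i 2 - 3 * e i 1))"
      proof -
        have "(\<Sum>k=1..n. start_correction \<alpha> n (e i) k) = (\<Sum>k\<in>{1..n} \<inter> {1, 2}. start_correction \<alpha> n (e i) k)"
          by (rule sum.mono_neutral_right) (auto simp: start_correction_def)
        also have "{1..n} \<inter> {1, 2} = (if n < 2 then {1} else {1, 2})" using n by auto
        also have "(\<Sum>k\<in>(if n < 2 then {1} else {1, 2}). start_correction \<alpha> n (e i) k)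
          = (q (n - 1) + c (n - 1)) * e i 1 + (if n < 2 then 0 else c (n - 2) * (e i 2 - 3 * e i 1))"
          by (simp add: start_correction_def q_def c_def)
        finally show ?thesis .
      qed
      also have "\<bar>\<dots>\<bar> \<le> \<bar>(q (n - 1) + c (n - 1)) * e i 1\<bar> + \<bar>if n < 2 then 0 else c (n - 2) * (e i 2 - 3 * e i 1)\<bar>"
        by (rule abs_triangle_ineq)
      also have "\<dots> \<le> (\<bar>q (n - 1)\<bar> + \<bar>c (n - 1)\<bar>) * B + (if n < 2 then 0 else \<bar>c (n - 2)\<bar> * 4) * B"
      proof (rule add_mono)
        show "\<bar>(q (n - 1) + c (n - 1)) * e i 1\<bar> \<le> (\<bar>q (n - 1)\<bar> + \<bar>c (n - 1)\<bar>) * B"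
          unfolding abs_mult using e1' i n by (intro mult_mono abs_triangle_ineq) auto
        show "\<bar>if n < 2 then 0 else c (n - 2) * (e i 2 - 3 * e i 1)\<bar> \<le> (if n < 2 then 0 else \<bar>c (n - 2)\<bar> * 4) * B"
        proof (cases "n < 2")
          case False
          have "\<bar>e i 2 - 3 * e i 1\<bar> \<le> 4 * B" using e2[of i] e1'[of i] i n False by linarith
          then have "\<bar>c (n - 2)\<bar> * \<bar>e i 2 - 3 * e i 1\<bar> \<le> \<bar>c (n - 2)\<bar> * (4 * B)" by (intro mult_left_mono) auto
          then show ?thesis using False by (simp add: abs_mult)
        qed simp
      qed
      also have "\<dots> = g n * B" by (simp add: g_def algebra_simps)
      finally show ?thesis .
    qed
    have g0: "0 \<le> g n" for n by (simp add: g_def)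
    have gs: "(\<Sum>j=1..n. g j) \<le> 5 * S" for n
    proof -
      have sq: "(\<Sum>j<m. \<bar>q j\<bar>) \<le> \<bar>q 0\<bar> + 1" "(\<Sum>j<m. \<bar>c j\<bar>) \<le> \<bar>c 0\<bar> + 1" for m
        unfolding q_def c_def
        by (intro sum_abs_cell_moment_le \<alpha> quad_weight_measurable cubic_weight_measurable abs_quad_weight_le abs_cubic_weight_le
            cell_weights_integral_zero)+
      have "(\<Sum>j=1..n. g j) = (\<Sum>j=1..n. \<bar>q (j - 1)\<bar>) + (\<Sum>j=1..n. \<bar>c (j - 1)\<bar>) + (\<Sum>j=1..n. if j < 2 then 0 else \<bar>c (j - 2)\<bar> * 4)"
        by (simp add: g_def sum.distrib)
      also have "(\<Sum>j=1..n. \<bar>q (j - 1)\<bar>) = (\<Sum>j<n. \<bar>q j\<bar>)"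
        by (rule sum.reindex_bij_witness[of _ Suc "\<lambda>j. j - 1"]) auto
      also have "(\<Sum>j=1..n. \<bar>c (j - 1)\<bar>) = (\<Sum>j<n. \<bar>c j\<bar>)"
        by (rule sum.reindex_bij_witness[of _ Suc "\<lambda>j. j - 1"]) auto
      also have "(\<Sum>j=1..n. if j < 2 then 0 else \<bar>c (j - 2)\<bar> * 4) = (\<Sum>j<n - 1. \<bar>c j\<bar> * 4)"
      proof -
        have "(\<Sum>j=1..n. if j < 2 then 0 else \<bar>c (j - 2)\<bar> * 4) = (\<Sum>j=2..n. if j < 2 then 0 else \<bar>c (j - 2)\<bar> * 4)"
          by (rule sum.mono_neutral_right) auto
        also have "\<dots> = (\<Sum>j<n - 1. \<bar>c j\<bar> * 4)"
          by (rule sum.reindex_bij_witness[of _ "\<lambda>j. j + 2" "\<lambda>j. j - 2"]) auto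
        finally show ?thesis .
      qed
      also have "\<dots> = 4 * (\<Sum>j<n - 1. \<bar>c j\<bar>)" by (simp add: sum_distrib_left mult.commute)
      finally show ?thesis using sq(1)[of n] sq(2)[of n] sq(2)[of "n - 1"] by (simp add: S_def)
    qed
    have "\<bar>e i n\<bar> \<le> C0 * (\<Sum>j=1..n. real (n - j + 1) powr (\<alpha> - 1) * (b j + g j * B))"
    proof (rule stab[where R = "\<lambda>i n. R i n + (\<Sum>k=1..n. start_correction \<alpha> n (e i) k)" and e = e and K = K and N = N and \<mu> = \<mu>])
      show "0 < K" "0 < \<mu>" "\<And>i. e i 0 = 0" "\<And>n. n \<le> N \<Longrightarrow> e 0 n = 0 \<and> e K n = 0" "n \<le> N" "i \<le> K"
        by (fact K mu e0 bc n i)+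
      fix l m assume l: "1 \<le> l" "l < K" and m: "1 \<le> m" "m \<le> N"
      show "(\<Sum>j=0..m. caputo_weight \<alpha> (m - j) * e l j) + \<mu> * (2 * e l m - e (l + 1) m - e (l - 1) m)
        = R l m + (\<Sum>k=1..m. start_correction \<alpha> m (e l) k)"
        unfolding caputo_weight_convolution[where v = "e l", OF e0] sum.distrib using eq[OF l m] by simp
      show "\<bar>R l m + (\<Sum>k=1..m. start_correction \<alpha> m (e l) k)\<bar> \<le> b m + g m * B"
        using R[OF l m] corr[OF _ m, of l] l by linarith
    qed (use b g0 B in auto)
    also have "(\<Sum>j=1..n. real (n - j + 1) powr (\<alpha> - 1) * (b j + g j * B))
      = (\<Sum>j=1..n. real (n - j + 1) powr (\<alpha> - 1) * b j) + (\<Sum>j=1..n. real (n - j + 1) powr (\<alpha> - 1) * (g j * B))"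
      by (simp add: distrib_left sum.distrib)
    also have "(\<Sum>j=1..n. real (n - j + 1) powr (\<alpha> - 1) * (g j * B)) \<le> (\<Sum>j=1..n. 1 * (g j * B))"
    proof (intro sum_mono mult_right_mono)
      fix j show "real (n - j + 1) powr (\<alpha> - 1) \<le> 1"
        using powr_mono2'[of "\<alpha> - 1" 1 "real (n - j + 1)"] \<alpha> by simp
    qed (use g0 B in auto)
    also have "\<dots> = (\<Sum>j=1..n. g j) * B" by (simp add: sum_distrib_right)
    also have "\<dots> \<le> 5 * S * B" using gs B by (intro mult_right_mono) auto
    finally have "\<bar>e i n\<bar> \<le> C0 * ((\<Sum>j=1..n. real (n - j + 1) powr (\<alpha> - 1) * b j) + 5 * S * B)"
      using C0 by (simp add: mult_left_mono)
    also have "\<dots> \<le> C0 * ((1 + 5 * S * M) * ((\<Sum>j=1..n. real (n - j + 1) powr (\<alpha> - 1) * b j) + b 1 + b 2))"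
    proof (rule mult_left_mono)
      have s0: "0 \<le> (\<Sum>j=1..n. real (n - j + 1) powr (\<alpha> - 1) * b j)" using b by (intro sum_nonneg) auto
      have "0 \<le> 5 * S * M" using S M by simp
      then have "0 \<le> 5 * S * M * (\<Sum>j=1..n. real (n - j + 1) powr (\<alpha> - 1) * b j)" using s0 by simp
      then show "(\<Sum>j=1..n. real (n - j + 1) powr (\<alpha> - 1) * b j) + 5 * S * B
        \<le> (1 + 5 * S * M) * ((\<Sum>j=1..n. real (n - j + 1) powr (\<alpha> - 1) * b j) + b 1 + b 2)"
        using b[of 1] b[of 2] by (simp add: B_def algebra_simps)
    qed (use C0 in simp)
    finally show "\<bar>e i n\<bar> \<le> C * ((\<Sum>j=1..n. real (n - j + 1) powr (\<alpha> - 1) * b j) + b 1 + b 2)"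
      by (simp add: C_def mult.assoc)
  qed
qed

section \<open>Truncation error\<close>

text \<open>The integrands of the last cell are singular at end points, so continuity is assumed in
  the open interval only: it gives measurability, and the majorant gives integrability.\<close>

lemma dominated_integral_le:
  fixes f h :: "real \<Rightarrow> real"
  assumes cont: "continuous_on {a<..<b} f" and h: "h integrable_on {a..b}"
    and le: "\<And>s. s \<in> {a<..<b} \<Longrightarrow> \<bar>f s\<bar> \<le> h s"
  shows "f integrable_on {a..b}" "\<bar>integral {a..b} f\<bar> \<le> integral {a..b} h"
proof -
  have h': "h integrable_on {a<..<b}" using h by (simp add: integrable_on_Icc_iff_Ioo)
  have m: "f \<in> borel_measurable (lebesgue_on {a<..<b})"
    by (intro continuous_imp_measurable_on_sets_lebesgue cont) auto
  have f': "f integrable_on {a<..<b}"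
    by (rule measurable_bounded_by_integrable_imp_integrable_real[OF m h']) (use le in auto)
  then show "f integrable_on {a..b}" by (simp add: integrable_on_Icc_iff_Ioo)
  have "norm (integral {a<..<b} f) \<le> integral {a<..<b} h"
    using f' h' le by (intro integral_norm_bound_integral) auto
  then show "\<bar>integral {a..b} f\<bar> \<le> integral {a..b} h"
    by (simp add: integral_open_interval_real)
qed

lemma has_integral_reflect_unit:
  fixes f :: "real \<Rightarrow> real"
  assumes "(f has_integral I) {0..1}"
  shows "((\<lambda>s. f (c - s)) has_integral I) {c - 1..c}"
  using has_integral_affinity[OF assms[unfolded box_real[symmetric]], of "-1" c]
    image_affinity_atLeastAtMost[of "-1::real" c 0 1] by (simp add: add.commute)

text \<open>The value of the interpolant at \<open>k - \<sigma>\<close>, in Newton's backward form.\<close>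

definition newton_value :: "(nat \<Rightarrow> real) \<Rightarrow> nat \<Rightarrow> real \<Rightarrow> real" where
  "newton_value v k \<sigma> = v k - \<sigma> * (v k - v (k - 1))
   + (if k < 2 then 0 else \<sigma> * (\<sigma> - 1) / 2 * (v k - 2 * v (k - 1) + v (k - 2)))
   - (if k < 3 then 0 else \<sigma> * (\<sigma> - 1) * (\<sigma> - 2) / 6 * (v k - 3 * v (k - 1) + 3 * v (k - 2) - v (k - 3)))"

lemma newton_value_deriv:
  "((\<lambda>s. newton_value v k (c - s)) has_real_derivative newton_slope v k (c - s)) (at s)"
  unfolding newton_value_def newton_slope_def quad_weight_def cubic_weight_def
  by (auto intro!: derivative_eq_intros simp: power2_eq_square field_simps)

lemma continuous_newton_slope: "continuous_on S (newton_slope v k)"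
  unfolding newton_slope_def quad_weight_def cubic_weight_def
  by (cases "k < 2"; cases "k < 3") (auto intro!: continuous_intros)

lemma newton_value_nodes: "newton_value v k 0 = v k" "newton_value v k 1 = v (k - 1)"
  by (simp_all add: newton_value_def)

lemma newton_slope_diff: "newton_slope (\<lambda>j. v j - w j) k \<sigma> = newton_slope v k \<sigma> - newton_slope w k \<sigma>"
  by (simp add: newton_slope_def algebra_simps)

text \<open>14 = 2 + 4 + 8, the sums of the moduli of the coefficients in the three differences;
  both weights are at most 1 in modulus.\<close>

lemma abs_newton_slope_le:
  assumes \<sigma>: "\<sigma> \<in> {0..1}" and v: "\<And>j. k - 3 \<le> j \<Longrightarrow> j \<le> k \<Longrightarrow> \<bar>v j\<bar> \<le> B"
  shows "\<bar>newton_slope v k \<sigma>\<bar> \<le> 14 * B"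
proof -
  have b: "\<bar>v k\<bar> \<le> B" "\<bar>v (k - 1)\<bar> \<le> B" "\<bar>v (k - 2)\<bar> \<le> B" "\<bar>v (k - 3)\<bar> \<le> B"
    by (intro v; simp)+
  have q: "\<bar>quad_weight \<sigma> * x\<bar> \<le> \<bar>x\<bar>" "\<bar>cubic_weight \<sigma> * x\<bar> \<le> \<bar>x\<bar>" for x
    using abs_quad_weight_le abs_cubic_weight_le \<sigma> by (auto simp: abs_mult mult_left_le_one_le)
  have 1: "\<bar>v k - v (k - 1)\<bar> \<le> 2 * B" using b by linarith
  have 2: "\<bar>if k < 2 then 0 else quad_weight \<sigma> * (v k - 2 * v (k - 1) + v (k - 2))\<bar> \<le> 4 * B"
  proof (cases "k < 2")
    case False
    have "\<bar>v k - 2 * v (k - 1) + v (k - 2)\<bar> \<le> 4 * B" using b by linarith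
    from order.trans[OF q(1) this] show ?thesis using False by simp
  qed (use b in simp)
  have 3: "\<bar>if k < 3 then 0 else cubic_weight \<sigma> * (v k - 3 * v (k - 1) + 3 * v (k - 2) - v (k - 3))\<bar> \<le> 8 * B"
  proof (cases "k < 3")
    case False
    have "\<bar>v k - 3 * v (k - 1) + 3 * v (k - 2) - v (k - 3)\<bar> \<le> 8 * B" using b by linarith
    from order.trans[OF q(2) this] show ?thesis using False by simp
  qed (use b in simp)
  show ?thesis unfolding newton_slope_def using 1 2 3 by linarith
qed

text \<open>Cubic interpolation reproduces cubics. The argument has the form of a Taylor polynomial
  at \<open>k\<close>, ready to be subtracted from \<open>g 0\<close>.\<close>

lemma newton_slope_cubic:
  assumes "3 \<le> k"
  shows "newton_slope (\<lambda>j. c0 + c1 * (real j - real k) + c2 * (real j - real k)\<^sup>2 / 2 + c3 * (real j - real k) ^ 3 / 6) k \<sigma>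
    = c1 - c2 * \<sigma> + c3 * \<sigma>\<^sup>2 / 2"
proof -
  have r: "real (k - 1) - real k = -1" "real (k - 2) - real k = -2" "real (k - 3) - real k = -3"
    using assms by (simp_all add: of_nat_diff)
  show ?thesis using assms
    unfolding newton_slope_def r by (simp add: quad_weight_def cubic_weight_def power2_eq_square power3_eq_cube field_simps)
qed

text \<open>Size of the fourth derivative at the leftmost node \<open>k - 3\<close> of the stencil
  of cell \<open>k\<close>. For k <= 3 the stencil reaches the singular point 0 and a constant takes
  over.\<close>

definition node_factor :: "real \<Rightarrow> nat \<Rightarrow> real" where
  "node_factor \<alpha> k = (if k \<le> 3 then 1 else real (k - 3) powr (\<alpha> - 4))"

lemma node_factor_nonneg: "0 \<le> node_factor \<alpha> k"
  by (simp add: node_factor_def)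

text \<open>The first summand belongs to the last cell, where the kernel is singular; in the earlier
  cells integration by parts has replaced the kernel by its derivative.\<close>

definition truncation_bound :: "real \<Rightarrow> nat \<Rightarrow> real" where
  "truncation_bound \<alpha> n = node_factor \<alpha> n + (\<Sum>k=1..<n. real (n - k) powr (-1 - \<alpha>) * node_factor \<alpha> k)"

text \<open>The solution at a fixed point of space, with time measured in steps; \<open>g l\<close>
  is its derivative of order \<open>l\<close>. The half-open interval makes the derivatives
  one-sided at the final time.\<close>

locale weakly_singular =
  fixes \<alpha> M :: real and N :: nat and g :: "nat \<Rightarrow> real \<Rightarrow> real"
  assumes \<alpha>: "0 < \<alpha>" "\<alpha> < 1" and M: "0 \<le> M"
    and cont: "continuous_on {0..real N} (g 0)"
    and der: "\<And>l s. l < 4 \<Longrightarrow> s \<in> {0<..real N} \<Longrightarrow> (g l has_real_derivative g (Suc l) s) (at s within {0<..real N})"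
    and bd: "\<And>l s. 1 \<le> l \<Longrightarrow> l \<le> 4 \<Longrightarrow> s \<in> {0<..real N} \<Longrightarrow> \<bar>g l s\<bar> \<le> M * s powr (\<alpha> - real l)"
begin

definition cell_error :: "nat \<Rightarrow> real \<Rightarrow> real" where
  "cell_error k s = g 0 s - newton_value (\<lambda>j. g 0 (real j)) k (real k - s)"

definition cell_error_deriv :: "nat \<Rightarrow> real \<Rightarrow> real" where
  "cell_error_deriv k s = g 1 s - newton_slope (\<lambda>j. g 0 (real j)) k (real k - s)"

lemma der_at:
  assumes "l < 4" "0 < s" "s < real N"
  shows "(g l has_real_derivative g (Suc l) s) (at s)"
proof -
  have s: "s \<in> {0<..real N}" using assms by simp
  have "{0<..<real N} \<subseteq> {0<..real N}" by auto
  from DERIV_subset[OF der[OF assms(1) s] this]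
  have "(g l has_real_derivative g (Suc l) s) (at s within {0<..<real N})" .
  moreover have "at s within {0<..<real N} = at s"
    by (rule at_within_open) (use assms in auto)
  ultimately show ?thesis by (simp only:)
qed

lemma continuous_g: "l < 4 \<Longrightarrow> continuous_on {0<..real N} (g l)"
  by (intro DERIV_continuous_on[OF der]) auto

text \<open>The function M / \<alpha> * s powr \<alpha> is an antiderivative of the bound for
  \<open>g 1\<close>, so adding or subtracting \<open>g 0\<close> gives increasing functions; at 0
  continuity alone is used.\<close>

lemma g_increment:
  assumes "0 \<le> s" "s \<le> real N"
  shows "\<bar>g 0 s - g 0 0\<bar> \<le> M / \<alpha> * s powr \<alpha>"
proof -
  have c: "continuous_on {0..s} (g 0)" by (rule continuous_on_subset[OF cont]) (use assms in auto)
  have p: "continuous_on {0..s} (\<lambda>s. M / \<alpha> * s powr \<alpha>)" using \<alpha> by (intro continuous_on_mult continuous_on_const continuous_on_powr' continuous_on_id) auto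
  have d: "((\<lambda>s. M / \<alpha> * s powr \<alpha>) has_real_derivative M * s powr (\<alpha> - 1)) (at s)" if "0 < s" for s
    using DERIV_cmult[OF has_real_derivative_powr[OF that, of \<alpha>], of "M / \<alpha>"] \<alpha> by simp
  have b: "\<bar>g 1 x\<bar> \<le> M * x powr (\<alpha> - 1)" if "0 < x" "x < s" for x
    using bd[of 1 x] that assms by simp
  have "(\<lambda>s. M / \<alpha> * s powr \<alpha> - g 0 s) 0 \<le> (\<lambda>s. M / \<alpha> * s powr \<alpha> - g 0 s) s"
  proof (rule DERIV_nonneg_imp_increasing_open[OF assms(1)])
    fix x assume x: "0 < x" "x < s"
    have "((\<lambda>s. M / \<alpha> * s powr \<alpha> - g 0 s) has_real_derivative M * x powr (\<alpha> - 1) - g (Suc 0) x) (at x)"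
      by (intro DERIV_diff d der_at) (use x assms in auto)
    then show "\<exists>y. ((\<lambda>s. M / \<alpha> * s powr \<alpha> - g 0 s) has_real_derivative y) (at x) \<and> 0 \<le> y"
      using b[OF x] by (intro exI conjI) auto
  qed (intro continuous_intros c p)
  moreover have "(\<lambda>s. M / \<alpha> * s powr \<alpha> + g 0 s) 0 \<le> (\<lambda>s. M / \<alpha> * s powr \<alpha> + g 0 s) s"
  proof (rule DERIV_nonneg_imp_increasing_open[OF assms(1)])
    fix x assume x: "0 < x" "x < s"
    have "((\<lambda>s. M / \<alpha> * s powr \<alpha> + g 0 s) has_real_derivative M * x powr (\<alpha> - 1) + g (Suc 0) x) (at x)"
      by (intro DERIV_add d der_at) (use x assms in auto)
    then show "\<exists>y. ((\<lambda>s. M / \<alpha> * s powr \<alpha> + g 0 s) has_real_derivative y) (at x) \<and> 0 \<le> y"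
      using b[OF x] by (intro exI conjI) auto
  qed (intro continuous_intros c p)
  ultimately show ?thesis by (simp add: abs_le_iff)
qed

text \<open>Slopes annihilate constants, so \<open>g 0\<close> may be replaced by its increment from
  0, which is at most 3 M / \<alpha> at the nodes 0 to 3; 42 = 14 * 3.\<close>

lemma slope_small:
  assumes "k \<le> 3" "k \<le> N" "\<sigma> \<in> {0..1}"
  shows "\<bar>newton_slope (\<lambda>j. g 0 (real j)) k \<sigma>\<bar> \<le> 42 * M / \<alpha>"
proof -
  have "newton_slope (\<lambda>j. g 0 (real j)) k \<sigma> = newton_slope (\<lambda>j. g 0 (real j) - g 0 0) k \<sigma>"
    unfolding newton_slope_diff by (simp add: newton_slope_def[of "\<lambda>_. g 0 0"])
  also have "\<bar>\<dots>\<bar> \<le> 14 * (3 * M / \<alpha>)"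
  proof (rule abs_newton_slope_le[OF assms(3)])
    fix j assume j: "j \<le> k"
    have "real j powr \<alpha> \<le> 3 powr \<alpha>" using j assms \<alpha> by (intro powr_mono2) auto
    also have "\<dots> \<le> 3 powr 1" using \<alpha> by (intro powr_mono) auto
    finally have "M / \<alpha> * real j powr \<alpha> \<le> M / \<alpha> * 3" using M \<alpha> by (intro mult_left_mono) auto
    moreover have "\<bar>g 0 (real j) - g 0 0\<bar> \<le> M / \<alpha> * real j powr \<alpha>"
      by (rule g_increment) (use j assms in auto)
    moreover have "M / \<alpha> * 3 = 3 * M / \<alpha>" by simp
    ultimately show "\<bar>g 0 (real j) - g 0 0\<bar> \<le> 3 * M / \<alpha>" by (metis order.trans)
  qed
  finally show ?thesis by simp
qed

lemma cell_error_deriv_first: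
  assumes "1 \<le> N" "s \<in> {0<..1}"
  shows "\<bar>cell_error_deriv 1 s\<bar> \<le> M * s powr (\<alpha> - 1) + 42 * M / \<alpha>"
proof -
  have "\<bar>g 1 s\<bar> \<le> M * s powr (\<alpha> - 1)" using bd[of 1 s] assms by simp
  moreover have "\<bar>newton_slope (\<lambda>j. g 0 (real j)) 1 (real 1 - s)\<bar> \<le> 42 * M / \<alpha>"
    by (rule slope_small) (use assms in auto)
  ultimately show ?thesis unfolding cell_error_deriv_def by linarith
qed

text \<open>For k > 3 the cubic Taylor polynomial at \<open>k\<close> is subtracted; its slope is
  exact, so only remainders are left. Both 3^4 / 6 and 3^3 / 2 equal 13.5, rounded up to 14, and 14
  + 14 * 14 = 210 is covered by 200 + 42 / \<alpha>. For k = 2, 3 the cell lies in s >= 1, where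
  \<open>g 1\<close> is bounded by \<open>M\<close>.\<close>

lemma cell_error_deriv_le:
  assumes k: "2 \<le> k" "k \<le> N" and s: "s \<in> {real k - 1..real k}"
  shows "\<bar>cell_error_deriv k s\<bar> \<le> (200 + 42 / \<alpha>) * M * node_factor \<alpha> k"
proof (cases "k \<le> 3")
  case True
  have s1: "1 \<le> s" "s \<le> real N" using k s by auto
  then have "s powr (\<alpha> - 1) \<le> 1" using powr_mono2'[of "\<alpha> - 1" 1 s] \<alpha> by simp
  then have "M * s powr (\<alpha> - 1) \<le> M" using M by (simp add: mult_left_le)
  then have "\<bar>g 1 s\<bar> \<le> M" using bd[of 1 s] s1 by simp
  moreover have "\<bar>newton_slope (\<lambda>j. g 0 (real j)) k (real k - s)\<bar> \<le> 42 * M / \<alpha>"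
    by (rule slope_small) (use True k s in auto)
  ultimately have "\<bar>cell_error_deriv k s\<bar> \<le> M + 42 * M / \<alpha>"
    unfolding cell_error_deriv_def by linarith
  also have "\<dots> \<le> (200 + 42 / \<alpha>) * M" using M by (simp add: algebra_simps)
  finally show ?thesis using True by (simp add: node_factor_def)
next
  case False
  define a where "a = real (k - 3)"
  have a: "1 \<le> a" "a = real k - 3" using False by (auto simp: a_def of_nat_diff)
  define S where "S = {a..real k}"
  define B where "B = M * a powr (\<alpha> - 4)"
  have S: "S \<subseteq> {0<..real N}" using a k by (auto simp: S_def)
  have B0: "0 \<le> B" using M by (simp add: B_def)
  have d: "(g l has_real_derivative g (Suc l) x) (at x within S)" if "x \<in> S" "l < 4" for l x
    by (rule DERIV_subset[OF der S]) (use that S in auto)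
  have b4: "\<bar>g 4 x\<bar> \<le> B" if "x \<in> S" for x
  proof -
    have "\<bar>g 4 x\<bar> \<le> M * x powr (\<alpha> - 4)" using bd[of 4 x] that S by auto
    also have "\<dots> \<le> B" unfolding B_def using that a M \<alpha> by (intro mult_left_mono powr_mono2') (auto simp: S_def)
    finally show ?thesis .
  qed
  have kS: "real k \<in> S" using a by (simp add: S_def)
  define p where "p x = g 0 (real k) + g 1 (real k) * (x - real k) + g 2 (real k) * (x - real k)\<^sup>2 / 2 + g 3 (real k) * (x - real k) ^ 3 / 6" for x
  define p' where "p' x = g 1 (real k) + g 2 (real k) * (x - real k) + g 3 (real k) * (x - real k)\<^sup>2 / 2" for x
  have T0: "\<bar>g 0 x - p x\<bar> \<le> 14 * B" if x: "x \<in> S" for x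
  proof -
    have "norm (g 0 x - (\<Sum>i\<le>3. g i (real k) * (x - real k) ^ i / fact i)) \<le> B * norm (x - real k) ^ Suc 3 / fact 3"
      by (rule field_Taylor[where S = S]) (use d b4 kS x in \<open>auto simp: S_def numeral_eq_Suc\<close>)
    also have "(\<Sum>i\<le>3. g i (real k) * (x - real k) ^ i / fact i) = p x"
      by (simp add: p_def numeral_eq_Suc)
    also have "B * norm (x - real k) ^ Suc 3 / fact 3 \<le> B * 3 ^ 4 / 6"
    proof -
      have "norm (x - real k) ^ 4 \<le> 3 ^ 4" using x a by (intro power_mono) (auto simp: S_def)
      then have "B * norm (x - real k) ^ 4 \<le> B * 3 ^ 4" using B0 by (intro mult_left_mono) auto
      then show ?thesis by (simp add: fact_numeral divide_right_mono)
    qed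
    finally show ?thesis using B0 by simp
  qed
  have T1: "\<bar>g 1 x - p' x\<bar> \<le> 14 * B" if x: "x \<in> S" for x
  proof -
    have "norm (g (Suc 0) x - (\<Sum>i\<le>2. g (Suc i) (real k) * (x - real k) ^ i / fact i)) \<le> B * norm (x - real k) ^ Suc 2 / fact 2"
      by (rule field_Taylor[where S = S and f = "\<lambda>i. g (Suc i)"]) (use d b4 kS x in \<open>auto simp: S_def numeral_eq_Suc\<close>)
    also have "(\<Sum>i\<le>2. g (Suc i) (real k) * (x - real k) ^ i / fact i) = p' x"
      by (simp add: p'_def numeral_eq_Suc)
    also have "B * norm (x - real k) ^ Suc 2 / fact 2 \<le> B * 3 ^ 3 / 2"
    proof -
      have "norm (x - real k) ^ 3 \<le> 3 ^ 3" using x a by (intro power_mono) (auto simp: S_def)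
      then have "B * norm (x - real k) ^ 3 \<le> B * 3 ^ 3" using B0 by (intro mult_left_mono) auto
      then show ?thesis by (simp add: divide_right_mono numeral_eq_Suc)
    qed
    finally show ?thesis using B0 by simp
  qed
  have sl: "newton_slope (\<lambda>j. p (real j)) k (real k - s) = p' s"
    unfolding p_def using newton_slope_cubic[of k "g 0 (real k)" "g 1 (real k)" "g 2 (real k)" "g 3 (real k)" "real k - s"] False
    by (simp add: p'_def power2_eq_square algebra_simps)
  have "cell_error_deriv k s = (g 1 s - p' s) - newton_slope (\<lambda>j. g 0 (real j) - p (real j)) k (real k - s)"
    unfolding cell_error_deriv_def newton_slope_diff sl by simp
  moreover have "\<bar>newton_slope (\<lambda>j. g 0 (real j) - p (real j)) k (real k - s)\<bar> \<le> 14 * (14 * B)"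
  proof (rule abs_newton_slope_le)
    fix j assume "k - 3 \<le> j" "j \<le> k"
    then show "\<bar>g 0 (real j) - p (real j)\<bar> \<le> 14 * B"
      by (intro T0) (auto simp: S_def a_def)
  qed (use s in auto)
  moreover have "\<bar>g 1 s - p' s\<bar> \<le> 14 * B" by (rule T1) (use s a in \<open>auto simp: S_def\<close>)
  ultimately have "\<bar>cell_error_deriv k s\<bar> \<le> 210 * B" by linarith
  also have "\<dots> \<le> (200 + 42 / \<alpha>) * B"
  proof (rule mult_right_mono)
    have "1 \<le> 1 / \<alpha>" using \<alpha> by simp
    then show "210 \<le> 200 + 42 / \<alpha>" by simp
  qed (rule B0)
  finally show ?thesis using False by (simp add: node_factor_def B_def a_def mult.assoc)
qed

end

lemma Beta_nonneg: "0 < a \<Longrightarrow> 0 < b \<Longrightarrow> 0 \<le> Beta a (b :: real)"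
  by (rule has_integral_nonneg[OF has_integral_Beta_real]) auto

context weakly_singular
begin

abbreviation cell_const :: real where "cell_const \<equiv> 200 + 42 / \<alpha>"

lemma cell_const_pos: "0 < cell_const"
  using \<alpha> by (simp add: add_pos_pos)

lemma cell_error_has_derivative:
  assumes "0 < s" "s < real N"
  shows "(cell_error k has_real_derivative cell_error_deriv k s) (at s)"
  unfolding cell_error_def[abs_def] cell_error_deriv_def One_nat_def
  by (intro DERIV_diff newton_value_deriv der_at) (use assms in auto)

lemma continuous_newton_value: "continuous_on S (\<lambda>s. newton_value v k (c - s))"
  by (intro DERIV_continuous_on[OF has_field_derivative_at_within[OF newton_value_deriv]])

lemma continuous_cell_error:
  assumes "1 \<le> k" "k \<le> N"
  shows "continuous_on {real k - 1..real k} (cell_error k)"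
  unfolding cell_error_def[abs_def]
  by (intro continuous_on_diff continuous_newton_value continuous_on_subset[OF cont]) (use assms in auto)

lemma cell_error_nodes:
  assumes "1 \<le> k"
  shows "cell_error k (real k) = 0" "cell_error k (real k - 1) = 0"
  using assms by (simp_all add: cell_error_def newton_value_nodes of_nat_diff)

text \<open>From the second cell on, the derivative bound is integrated from node \<open>k\<close>,
  where the error vanishes. In the first cell the available bound on the derivative is singular, and
  the increment of \<open>g 0\<close> is estimated instead.\<close>

lemma cell_error_le:
  assumes k: "1 \<le> k" "k \<le> N" and s: "s \<in> {real k - 1..real k}"
  shows "\<bar>cell_error k s\<bar> \<le> cell_const * M * node_factor \<alpha> k"
proof (cases "k = 1")
  case True
  have M\<alpha>: "0 \<le> M / \<alpha>" using M \<alpha> by simp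
  have s1: "0 \<le> s" "s \<le> 1" "s \<le> real N" using s k True by auto
  have "\<bar>g 0 s - g 0 0\<bar> \<le> M / \<alpha> * s powr \<alpha>" by (rule g_increment) (use s1 in auto)
  also have "\<dots> \<le> M / \<alpha> * 1"
  proof (rule mult_left_mono[OF _ M\<alpha>])
    show "s powr \<alpha> \<le> 1" using powr_mono2[of \<alpha> s 1] s1 \<alpha> by simp
  qed
  finally have a: "\<bar>g 0 s - g 0 0\<bar> \<le> M / \<alpha>" by simp
  have "\<bar>g 0 1 - g 0 0\<bar> \<le> M / \<alpha> * 1 powr \<alpha>" by (rule g_increment) (use k True in auto)
  then have "s * \<bar>g 0 1 - g 0 0\<bar> \<le> 1 * (M / \<alpha>)" using s1 by (intro mult_mono) auto
  then have b: "\<bar>s * (g 0 1 - g 0 0)\<bar> \<le> M / \<alpha>" using s1 by (simp add: abs_mult)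
  have "cell_error k s = (g 0 s - g 0 0) - s * (g 0 1 - g 0 0)"
    using True by (simp add: cell_error_def newton_value_def algebra_simps)
  then have "\<bar>cell_error k s\<bar> \<le> 2 * (M / \<alpha>)" using a b by linarith
  also have "\<dots> \<le> 200 * M + 42 * (M / \<alpha>)" using M M\<alpha> by simp
  finally show ?thesis using True by (simp add: node_factor_def algebra_simps)
next
  case False
  then have k2: "2 \<le> k" using k by simp
  have "norm (cell_error k s - cell_error k (real k)) \<le> cell_const * M * node_factor \<alpha> k * norm (s - real k)"
  proof (rule field_differentiable_bound[of "{real k - 1..real k}"])
    fix z assume z: "z \<in> {real k - 1..real k}"
    have "(g 0 has_real_derivative g (Suc 0) z) (at z within {real k - 1..real k})"
      by (rule DERIV_subset[OF der]) (use z k2 k in auto)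
    then show "(cell_error k has_real_derivative cell_error_deriv k z) (at z within {real k - 1..real k})"
      unfolding cell_error_def[abs_def] cell_error_deriv_def One_nat_def
      by (intro DERIV_diff has_field_derivative_at_within[OF newton_value_deriv])
    show "norm (cell_error_deriv k z) \<le> cell_const * M * node_factor \<alpha> k"
      using cell_error_deriv_le[OF k2 k(2) z] by simp
  qed (use s in auto)
  also have "\<dots> \<le> cell_const * M * node_factor \<alpha> k * 1"
    using s cell_const_pos M node_factor_nonneg by (intro mult_left_mono mult_nonneg_nonneg) auto
  finally show ?thesis using cell_error_nodes[OF k(1)] by simp
qed

text \<open>Away from the singularity of the kernel the interpolation error is integrated by parts.\<close>

lemma cell_integral_interior:
  assumes k: "1 \<le> k" "k < n" "n \<le> N"
  obtains J where "((\<lambda>s. (real n - s) powr (-\<alpha>) * cell_error_deriv k s) has_integral J) {real k - 1..real k}"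
    "\<bar>J\<bar> \<le> cell_const * M * (real (n - k) powr (-1 - \<alpha>) * node_factor \<alpha> k)"
proof -
  let ?I = "{real k - 1..real k}"
  define w where "w s = (real n - s) powr (-\<alpha>)" for s
  define w' where "w' s = \<alpha> * (real n - s) powr (-\<alpha> - 1)" for s
  have pos: "0 < real n - s" if "s \<in> ?I" for s using that k by auto
  have wd: "(w has_real_derivative w' s) (at s)" if "s \<in> ?I" for s
  proof -
    have "((\<lambda>s. (real n - s) powr (-\<alpha>)) has_real_derivative (-\<alpha> * (real n - s) powr (-\<alpha> - 1)) * (-1)) (at s)"
      by (rule DERIV_chain2[where f = "\<lambda>z. z powr (-\<alpha>)" and g = "\<lambda>s. real n - s" and x = s, OF has_real_derivative_powr[OF pos[OF that], of "-\<alpha>"]])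
         (auto intro!: derivative_eq_intros)
    then show ?thesis by (simp add: w_def[abs_def] w'_def)
  qed
  have cw: "continuous_on ?I w"
    by (rule DERIV_continuous_on[OF has_field_derivative_at_within[OF wd]])
  have cw': "continuous_on ?I w'"
    unfolding w'_def using pos by (intro continuous_intros) force+
  have ce: "continuous_on ?I (cell_error k)" by (rule continuous_cell_error) (use k in auto)
  define I where "I = integral ?I (\<lambda>s. cell_error k s * w' s)"
  have I: "((\<lambda>s. cell_error k s * w' s) has_integral I) ?I"
    unfolding I_def by (intro integrable_integral integrable_continuous_interval continuous_on_mult ce cw')
  \<comment> \<open>The boundary terms vanish because interpolation is exact at both nodes. The rule
    asks for derivatives in the open cell only: for k = 1 there need not be one at 0.\<close>
  have "((\<lambda>s. cell_error_deriv k s * w s) has_integral - I) ?I"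
  proof (rule integration_by_parts_interior[OF bounded_bilinear_mult _ ce cw])
    fix x assume x: "x \<in> {real k - 1<..<real k}"
    show "(cell_error k has_vector_derivative cell_error_deriv k x) (at x)"
      using cell_error_has_derivative[of x k] x k by (simp add: has_real_derivative_iff_has_vector_derivative)
    show "(w has_vector_derivative w' x) (at x)"
      using wd[of x] x by (simp add: has_real_derivative_iff_has_vector_derivative)
  qed (use I cell_error_nodes[OF k(1)] in auto)
  then have J: "((\<lambda>s. (real n - s) powr (-\<alpha>) * cell_error_deriv k s) has_integral - I) ?I"
    by (simp add: w_def mult.commute)
  have c0: "0 \<le> cell_const * M * node_factor \<alpha> k"
    using cell_const_pos M node_factor_nonneg by simp
  have p0: "0 \<le> cell_const * M * node_factor \<alpha> k * real (n - k) powr (-1 - \<alpha>)"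
    using c0 by (rule mult_nonneg_nonneg) simp
  have "norm I \<le> (cell_const * M * node_factor \<alpha> k * real (n - k) powr (-1 - \<alpha>)) * measure lborel (cbox (real k - 1) (real k))"
  proof (rule has_integral_bound[OF p0 I[unfolded box_real[symmetric]]])
    fix s assume "s \<in> cbox (real k - 1) (real k)"
    then have s: "s \<in> ?I" by simp
    have "(real n - s) powr (-\<alpha> - 1) \<le> real (n - k) powr (-\<alpha> - 1)"
      using s k \<alpha> by (intro powr_mono2') (auto simp: of_nat_diff)
    then have "\<alpha> * (real n - s) powr (-\<alpha> - 1) \<le> 1 * real (n - k) powr (-\<alpha> - 1)"
      using \<alpha> by (intro mult_mono) auto
    moreover have "real (n - k) powr (-\<alpha> - 1) = real (n - k) powr (-1 - \<alpha>)"
      by (rule arg_cong[where f = "(powr) (real (n - k))"]) simp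
    moreover have "\<bar>w' s\<bar> = \<alpha> * (real n - s) powr (-\<alpha> - 1)" using \<alpha> by (simp add: w'_def)
    ultimately have "\<bar>w' s\<bar> \<le> real (n - k) powr (-1 - \<alpha>)" by linarith
    moreover have "\<bar>cell_error k s\<bar> \<le> cell_const * M * node_factor \<alpha> k"
      by (rule cell_error_le[OF k(1) _ s]) (use k in auto)
    ultimately show "norm (cell_error k s * w' s) \<le> cell_const * M * node_factor \<alpha> k * real (n - k) powr (-1 - \<alpha>)"
      using c0 by (simp only: real_norm_def abs_mult) (intro mult_mono, auto)
  qed
  then have "\<bar>- I\<bar> \<le> cell_const * M * (real (n - k) powr (-1 - \<alpha>) * node_factor \<alpha> k)"
    by (simp add: mult_ac)
  with J show ?thesis by (rule that)
qed

lemma kernel_has_integral: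
  "((\<lambda>s. (real n - s) powr (-\<alpha>)) has_integral cell_moment \<alpha> (\<lambda>_. 1) 0) {real n - 1..real n}"
  using has_integral_reflect_unit[OF cell_moment_has_integral[OF \<alpha>, of "\<lambda>_. 1" 0], of "real n"] by simp

text \<open>The derivative of the kernel is not integrable at \<open>n\<close>, so the derivative of
  the error is estimated directly here. For n = 1 its singularity at 0 and that of the kernel share
  one cell, which produces a Beta integral.\<close>

lemma cell_integral_last:
  assumes n: "1 \<le> n" "n \<le> N"
  defines "f \<equiv> \<lambda>s. (real n - s) powr (-\<alpha>) * cell_error_deriv n s"
  shows "f integrable_on {real n - 1..real n}"
    "\<bar>integral {real n - 1..real n} f\<bar>
      \<le> cell_const * M * (cell_moment \<alpha> (\<lambda>_. 1) 0 + Beta \<alpha> (1 - \<alpha>)) * node_factor \<alpha> n"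
proof -
  have cf: "continuous_on {real n - 1<..<real n} f"
  proof -
    have "continuous_on {real n - 1<..<real n} (g 1)"
      by (rule continuous_on_subset[OF continuous_g]) (use n in auto)
    moreover have "continuous_on {real n - 1<..<real n} (\<lambda>s. newton_slope (\<lambda>j. g 0 (real j)) n (real n - s))"
      by (rule continuous_on_compose2[OF continuous_newton_slope[of UNIV]]) (auto intro!: continuous_intros)
    ultimately show ?thesis unfolding f_def cell_error_deriv_def by (intro continuous_intros) auto
  qed
  have a0: "0 \<le> cell_moment \<alpha> (\<lambda>_. 1) 0" using cell_moment_one_ge[OF \<alpha>] by simp
  have Beta: "0 \<le> Beta \<alpha> (1 - \<alpha>)" by (rule Beta_nonneg) (use \<alpha> in auto)
  have "\<exists>h H. (h has_integral H) {real n - 1..real n} \<and> (\<forall>s\<in>{real n - 1<..<real n}. \<bar>f s\<bar> \<le> h s) \<and>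
      H \<le> cell_const * M * (cell_moment \<alpha> (\<lambda>_. 1) 0 + Beta \<alpha> (1 - \<alpha>)) * node_factor \<alpha> n"
  proof (cases "n = 1")
    case True
    define h where "h s = M * (s powr (\<alpha> - 1) * (1 - s) powr ((1 - \<alpha>) - 1)) + 42 * M / \<alpha> * (real n - s) powr (-\<alpha>)" for s
    have "(h has_integral (M * Beta \<alpha> (1 - \<alpha>) + 42 * M / \<alpha> * cell_moment \<alpha> (\<lambda>_. 1) 0)) {real n - 1..real n}"
      unfolding h_def
      by (intro has_integral_add has_integral_mult_right kernel_has_integral)
         (use has_integral_Beta_real[of \<alpha> "1 - \<alpha>"] \<alpha> True in simp)
    moreover have "\<bar>f s\<bar> \<le> h s" if s: "s \<in> {real n - 1<..<real n}" for s
    proof -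
      have "\<bar>cell_error_deriv n s\<bar> \<le> M * s powr (\<alpha> - 1) + 42 * M / \<alpha>"
        unfolding True by (rule cell_error_deriv_first) (use s n True in auto)
      then have "(real n - s) powr (-\<alpha>) * \<bar>cell_error_deriv n s\<bar> \<le> (real n - s) powr (-\<alpha>) * (M * s powr (\<alpha> - 1) + 42 * M / \<alpha>)"
        by (intro mult_left_mono) auto
      also have "\<dots> = h s" using True by (simp add: h_def algebra_simps)
      finally show ?thesis by (simp add: f_def abs_mult)
    qed
    moreover have "M * Beta \<alpha> (1 - \<alpha>) + 42 * M / \<alpha> * cell_moment \<alpha> (\<lambda>_. 1) 0
      \<le> cell_const * M * (cell_moment \<alpha> (\<lambda>_. 1) 0 + Beta \<alpha> (1 - \<alpha>)) * node_factor \<alpha> n"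
    proof -
      have 1: "M * Beta \<alpha> (1 - \<alpha>) \<le> cell_const * M * Beta \<alpha> (1 - \<alpha>)"
      proof (rule mult_right_mono[OF _ Beta])
        have "1 \<le> cell_const" using \<alpha> by (simp add: add_increasing2)
        from mult_right_mono[OF this M] show "M \<le> cell_const * M" by simp
      qed
      have 2: "42 * M / \<alpha> * cell_moment \<alpha> (\<lambda>_. 1) 0 \<le> cell_const * M * cell_moment \<alpha> (\<lambda>_. 1) 0"
        by (rule mult_right_mono[OF _ a0]) (use M in \<open>simp add: distrib_right\<close>)
      show ?thesis using 1 2 True by (simp add: node_factor_def distrib_left)
    qed
    ultimately show ?thesis by blast
  next
    case False
    then have n2: "2 \<le> n" using n by simp
    define h where "h s = cell_const * M * node_factor \<alpha> n * (real n - s) powr (-\<alpha>)" for s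
    have "(h has_integral (cell_const * M * node_factor \<alpha> n * cell_moment \<alpha> (\<lambda>_. 1) 0)) {real n - 1..real n}"
      unfolding h_def by (intro has_integral_mult_right kernel_has_integral)
    moreover have "\<bar>f s\<bar> \<le> h s" if s: "s \<in> {real n - 1<..<real n}" for s
    proof -
      have "\<bar>cell_error_deriv n s\<bar> \<le> cell_const * M * node_factor \<alpha> n"
        by (rule cell_error_deriv_le[OF n2 n(2)]) (use s in auto)
      then have "(real n - s) powr (-\<alpha>) * \<bar>cell_error_deriv n s\<bar> \<le> (real n - s) powr (-\<alpha>) * (cell_const * M * node_factor \<alpha> n)"
        by (intro mult_left_mono) auto
      then show ?thesis by (simp add: f_def h_def abs_mult mult_ac)
    qed
    moreover have "cell_const * M * node_factor \<alpha> n * cell_moment \<alpha> (\<lambda>_. 1) 0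
      \<le> cell_const * M * (cell_moment \<alpha> (\<lambda>_. 1) 0 + Beta \<alpha> (1 - \<alpha>)) * node_factor \<alpha> n"
    proof -
      have "0 \<le> cell_const * M * node_factor \<alpha> n * Beta \<alpha> (1 - \<alpha>)"
        using cell_const_pos M node_factor_nonneg Beta by (intro mult_nonneg_nonneg) auto
      moreover have "c * (x + y) * z = c * z * x + c * z * y" for c x y z :: real
        by (simp add: algebra_simps)
      ultimately show ?thesis by (metis add_increasing2 order.refl)
    qed
    ultimately show ?thesis by blast
  qed
  then obtain h H where h: "(h has_integral H) {real n - 1..real n}" "\<forall>s\<in>{real n - 1<..<real n}. \<bar>f s\<bar> \<le> h s"
    "H \<le> cell_const * M * (cell_moment \<alpha> (\<lambda>_. 1) 0 + Beta \<alpha> (1 - \<alpha>)) * node_factor \<alpha> n" by blast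
  have hi: "h integrable_on {real n - 1..real n}" using h(1) by blast
  show "f integrable_on {real n - 1..real n}"
    by (rule dominated_integral_le(1)[OF cf hi]) (use h(2) in auto)
  have "\<bar>integral {real n - 1..real n} f\<bar> \<le> integral {real n - 1..real n} h"
    by (rule dominated_integral_le(2)[OF cf hi]) (use h(2) in auto)
  also have "\<dots> = H" using h(1) by (rule integral_unique)
  finally show "\<bar>integral {real n - 1..real n} f\<bar>
      \<le> cell_const * M * (cell_moment \<alpha> (\<lambda>_. 1) 0 + Beta \<alpha> (1 - \<alpha>)) * node_factor \<alpha> n" using h(3) by simp
qed

text \<open>The integral against \<open>g 1\<close> is singular at both ends; its existence is
  obtained cell by cell, as the sum of the interpolant's part and the error's part.\<close>

lemma truncation_error:
  assumes n: "1 \<le> n" "n \<le> N"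
  obtains I where "((\<lambda>s. (real n - s) powr (-\<alpha>) * g 1 s) has_integral I) {0..real n}"
    "\<bar>I - (\<Sum>k=1..n. weighted_diff \<alpha> n (\<lambda>j. g 0 (real j)) k)\<bar>
      \<le> cell_const * (1 + cell_moment \<alpha> (\<lambda>_. 1) 0 + Beta \<alpha> (1 - \<alpha>)) * M * truncation_bound \<alpha> n"
proof -
  let ?f = "\<lambda>s. (real n - s) powr (-\<alpha>) * g 1 s"
  let ?wd = "weighted_diff \<alpha> n (\<lambda>j. g 0 (real j))"
  define B where "B k = (if k < n then cell_const * M * (real (n - k) powr (-1 - \<alpha>) * node_factor \<alpha> k)
     else cell_const * M * (cell_moment \<alpha> (\<lambda>_. 1) 0 + Beta \<alpha> (1 - \<alpha>)) * node_factor \<alpha> n)" for k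
  have "\<exists>J. ((\<lambda>s. (real n - s) powr (-\<alpha>) * cell_error_deriv k s) has_integral J) {real k - 1..real k} \<and> \<bar>J\<bar> \<le> B k"
    if k: "k \<in> {1..n}" for k
  proof (cases "k < n")
    case True
    obtain J where "((\<lambda>s. (real n - s) powr (-\<alpha>) * cell_error_deriv k s) has_integral J) {real k - 1..real k}"
      "\<bar>J\<bar> \<le> cell_const * M * (real (n - k) powr (-1 - \<alpha>) * node_factor \<alpha> k)"
      by (rule cell_integral_interior[of k n]) (use k True n in auto)
    then show ?thesis using True unfolding B_def by auto
  next
    case False
    then have "k = n" using k by simp
    then show ?thesis using cell_integral_last[OF n] unfolding B_def by (auto intro: integrable_integral)
  qed
  then obtain J where J: "\<And>k. k \<in> {1..n} \<Longrightarrow> ((\<lambda>s. (real n - s) powr (-\<alpha>) * cell_error_deriv k s) has_integral J k) {real k - 1..real k}"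
    "\<And>k. k \<in> {1..n} \<Longrightarrow> \<bar>J k\<bar> \<le> B k" by metis
  have cell: "(?f has_integral (J k + ?wd k)) {real k - 1..real k}" if k: "k \<in> {1..n}" for k
  proof -
    have "((\<lambda>s. (real (n - k) + (real k - s)) powr (-\<alpha>) * newton_slope (\<lambda>j. g 0 (real j)) k (real k - s)) has_integral ?wd k) {real k - 1..real k}"
      using has_integral_reflect_unit[OF newton_slope_has_integral[OF \<alpha>]] by simp
    moreover have "real (n - k) + (real k - s) = real n - s" for s using k by (simp add: of_nat_diff)
    ultimately have "((\<lambda>s. (real n - s) powr (-\<alpha>) * newton_slope (\<lambda>j. g 0 (real j)) k (real k - s)) has_integral ?wd k) {real k - 1..real k}"
      by (simp only:)
    from has_integral_add[OF J(1)[OF k] this] show ?thesis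
      by (simp add: cell_error_deriv_def algebra_simps)
  qed
  have "(?f has_integral (\<Sum>k=1..m. J k + ?wd k)) {0..real m}" if "m \<le> n" for m
    using that
  proof (induction m)
    case 0
    show ?case by (simp add: has_integral_refl)
  next
    case (Suc m)
    have "(?f has_integral ((\<Sum>k=1..m. J k + ?wd k) + (J (Suc m) + ?wd (Suc m)))) {0..real (Suc m)}"
    proof (rule has_integral_combine[where c = "real m"])
      show "(?f has_integral (\<Sum>k=1..m. J k + ?wd k)) {0..real m}" using Suc by simp
      show "(?f has_integral (J (Suc m) + ?wd (Suc m))) {real m..real (Suc m)}" using cell[of "Suc m"] Suc.prems by simp
    qed auto
    then show ?case by simp
  qed
  then have I: "(?f has_integral (\<Sum>k=1..n. J k + ?wd k)) {0..real n}" by simp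
  have "\<bar>(\<Sum>k=1..n. J k + ?wd k) - (\<Sum>k=1..n. ?wd k)\<bar> = \<bar>\<Sum>k=1..n. J k\<bar>"
    by (simp add: sum.distrib)
  also have "\<dots> \<le> (\<Sum>k=1..n. B k)"
    using J(2) by (intro order.trans[OF sum_abs] sum_mono) auto
  also have "(\<Sum>k=1..n. B k) = B n + (\<Sum>k=1..<n. B k)"
    using n by (simp add: sum.last_plus atLeastLessThanSuc_atLeastAtMost[symmetric] sum.atLeastLessThan_Suc del: sum.op_ivl_Suc)
  also have "(\<Sum>k=1..<n. B k) = cell_const * M * (\<Sum>k=1..<n. real (n - k) powr (-1 - \<alpha>) * node_factor \<alpha> k)"
    by (simp add: B_def sum_distrib_left)
  also have "B n + \<dots> \<le> cell_const * (1 + cell_moment \<alpha> (\<lambda>_. 1) 0 + Beta \<alpha> (1 - \<alpha>)) * M * truncation_bound \<alpha> n"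
  proof -
    define S where "S = (\<Sum>k=1..<n. real (n - k) powr (-1 - \<alpha>) * node_factor \<alpha> k)"
    define q where "q = cell_moment \<alpha> (\<lambda>_. 1) 0 + Beta \<alpha> (1 - \<alpha>)"
    have q: "0 \<le> q" using cell_moment_one_ge[OF \<alpha>] Beta_nonneg[of \<alpha> "1 - \<alpha>"] \<alpha> by (simp add: q_def)
    have S0: "0 \<le> S" unfolding S_def using node_factor_nonneg by (intro sum_nonneg mult_nonneg_nonneg) auto
    have cM: "0 \<le> cell_const * M" using cell_const_pos M by simp
    have "q * node_factor \<alpha> n + S \<le> (1 + q) * (node_factor \<alpha> n + S)"
      using q S0 node_factor_nonneg[of \<alpha> n] by (simp add: algebra_simps)
    from mult_left_mono[OF this cM]
    have "cell_const * M * (q * node_factor \<alpha> n + S) \<le> cell_const * M * ((1 + q) * truncation_bound \<alpha> n)"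
      by (simp add: truncation_bound_def S_def)
    moreover have "B n = cell_const * M * q * node_factor \<alpha> n"
      unfolding B_def q_def by (simp only: less_irrefl if_False)
    moreover have "c * q * x + c * S = c * (q * x + S)" "c * ((1 + q) * x) = c' * (1 + q) * M * x"
      if "c = c' * M" for c c' x :: real
      using that by (simp_all add: algebra_simps)
    ultimately have "B n + cell_const * M * S \<le> cell_const * (1 + q) * M * truncation_bound \<alpha> n"
      by (simp only:)
    then show ?thesis unfolding S_def q_def by (simp only: add.assoc)
  qed
  finally show ?thesis by (rule that[OF I])
qed

end

text \<open>After exchanging the order of summation the double sum is bounded by a product of two
  convergent series, the exponents -1 - \<alpha> and \<alpha> - 4 being below -1. The 3 in
  \<open>G\<close> counts the nodes with factor 1.\<close>

lemma sum_truncation_bound: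
  assumes \<alpha>: "0 < \<alpha>" "\<alpha> < 1"
  obtains S where "0 < S" "\<And>m. (\<Sum>n=1..m. truncation_bound \<alpha> n) \<le> S"
proof -
  have s1: "summable (\<lambda>i. real i powr (-1 - \<alpha>))" using \<alpha> by (simp add: summable_real_powr_iff)
  have s2: "summable (\<lambda>i. real i powr (\<alpha> - 4))" using \<alpha> by (simp add: summable_real_powr_iff)
  define F where "F = (\<Sum>i. real i powr (-1 - \<alpha>))"
  define G where "G = 3 + (\<Sum>i. real i powr (\<alpha> - 4))"
  have F: "(\<Sum>i\<in>A. real i powr (-1 - \<alpha>)) \<le> F" if "finite A" for A
    unfolding F_def by (rule sum_le_suminf[OF s1 that]) auto
  have F0: "0 \<le> F" using F[of "{}"] by simp
  have G: "(\<Sum>k=1..m. node_factor \<alpha> k) \<le> G" for m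
  proof -
    have "(\<Sum>k=1..m. node_factor \<alpha> k) \<le> (\<Sum>k=1..m. (if k \<le> 3 then 1 else 0) + (if 3 < k then real (k - 3) powr (\<alpha> - 4) else 0))"
      by (intro sum_mono) (simp add: node_factor_def)
    also have "\<dots> = real (card ({1..m} \<inter> {k. k \<le> 3})) + (\<Sum>k\<in>{1..m} \<inter> {k. 3 < k}. real (k - 3) powr (\<alpha> - 4))"
      by (simp add: sum.distrib sum.If_cases)
    also have "card ({1..m} \<inter> {k. k \<le> 3}) \<le> card {1..3::nat}" by (intro card_mono) auto
    also have "(\<Sum>k\<in>{1..m} \<inter> {k. 3 < k}. real (k - 3) powr (\<alpha> - 4)) = (\<Sum>i\<in>(\<lambda>k. k - 3) ` ({1..m} \<inter> {k. 3 < k}). real i powr (\<alpha> - 4))"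
      by (subst sum.reindex) (auto simp: inj_on_def)
    also have "\<dots> \<le> (\<Sum>i. real i powr (\<alpha> - 4))" by (rule sum_le_suminf[OF s2]) auto
    finally show ?thesis by (simp add: G_def)
  qed
  have G0: "0 \<le> G" using G[of 0] by simp
  show ?thesis
  proof (rule that[of "G + F * G + 1"])
    show "0 < G + F * G + 1" using F0 G0 by (simp add: add_nonneg_pos)
    fix m
    have "(\<Sum>n=1..m. \<Sum>k=1..<n. real (n - k) powr (-1 - \<alpha>) * node_factor \<alpha> k)
      = (\<Sum>n=1..m. \<Sum>k | k \<in> {1..m} \<and> k < n. real (n - k) powr (-1 - \<alpha>) * node_factor \<alpha> k)"
      by (intro sum.cong) auto
    also have "\<dots> = (\<Sum>k=1..m. \<Sum>n | n \<in> {1..m} \<and> k < n. real (n - k) powr (-1 - \<alpha>) * node_factor \<alpha> k)"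
      by (rule sum.swap_restrict) auto
    also have "\<dots> \<le> (\<Sum>k=1..m. F * node_factor \<alpha> k)"
    proof (rule sum_mono)
      fix k
      have "(\<Sum>n | n \<in> {1..m} \<and> k < n. real (n - k) powr (-1 - \<alpha>)) = (\<Sum>i\<in>(\<lambda>n. n - k) ` {n. n \<in> {1..m} \<and> k < n}. real i powr (-1 - \<alpha>))"
        by (subst sum.reindex) (auto simp: inj_on_def)
      also have "\<dots> \<le> F" by (rule F) auto
      finally have "(\<Sum>n | n \<in> {1..m} \<and> k < n. real (n - k) powr (-1 - \<alpha>)) * node_factor \<alpha> k \<le> F * node_factor \<alpha> k"
        by (intro mult_right_mono node_factor_nonneg)
      then show "(\<Sum>n | n \<in> {1..m} \<and> k < n. real (n - k) powr (-1 - \<alpha>) * node_factor \<alpha> k) \<le> F * node_factor \<alpha> k"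
        by (simp add: sum_distrib_right)
    qed
    also have "\<dots> \<le> F * G" unfolding sum_distrib_left[symmetric] using G F0 by (intro mult_left_mono)
    finally show "(\<Sum>n=1..m. truncation_bound \<alpha> n) \<le> G + F * G + 1"
      using G[of m] by (simp add: truncation_bound_def sum.distrib)
  qed
qed

lemma weighted_diff_diff: "weighted_diff \<alpha> n (\<lambda>j. v j - w j) k = weighted_diff \<alpha> n v k - weighted_diff \<alpha> n w k"
  by (simp add: weighted_diff_def algebra_simps)

lemma weighted_diff_cong: "(\<And>j. v j = w j) \<Longrightarrow> weighted_diff \<alpha> n v k = weighted_diff \<alpha> n w k"
  by (simp add: weighted_diff_def)

section \<open>Return from the unit mesh to the given time mesh\<close>

lemma higher_deriv_within_has_derivative:
  assumes "C_k_on k S v" "l < k" "t \<in> S"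
  shows "(higher_deriv_within S l v has_real_derivative higher_deriv_within S (Suc l) v t) (at t within S)"
proof -
  have "higher_deriv_within S l v differentiable (at t within S)"
    using assms by (simp add: C_k_on_def differentiable_on_def)
  then have "(higher_deriv_within S l v has_vector_derivative vector_derivative (higher_deriv_within S l v) (at t within S)) (at t within S)"
    by (simp add: vector_derivative_works)
  then show ?thesis
    by (simp add: has_real_derivative_iff_has_vector_derivative higher_deriv_within_def)
qed

definition truncation_const :: "real \<Rightarrow> real" where
  "truncation_const \<alpha> = (200 + 42 / \<alpha>) * (1 + cell_moment \<alpha> (\<lambda>_. 1) 0 + Beta \<alpha> (1 - \<alpha>))"

text \<open>In \<tau> ^ l * (\<tau> s) powr (\<alpha> - l) = \<tau> powr \<alpha> * s powr (\<alpha>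
  - l) the power of \<tau> on the right does not depend on \<open>l\<close>, so one constant serves
  all orders.\<close>

lemma weakly_singular_rescale:
  fixes v :: "real \<Rightarrow> real"
  assumes \<alpha>: "0 < \<alpha>" "\<alpha> < 1" and T: "0 < T" and K: "0 < K" and M: "0 \<le> M"
    and cont: "continuous_on {0..T} v" and Ck: "C_k_on 4 {0<..T} v"
    and bd: "\<And>l t. 1 \<le> l \<Longrightarrow> l \<le> 4 \<Longrightarrow> t \<in> {0<..T} \<Longrightarrow> \<bar>higher_deriv_within {0<..T} l v t\<bar> \<le> M * t powr (\<alpha> - real l)"
  defines "\<tau> \<equiv> T / real K"
  shows "weakly_singular \<alpha> (M * \<tau> powr \<alpha>) K (\<lambda>l s. \<tau> ^ l * higher_deriv_within {0<..T} l v (\<tau> * s))"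
proof
  have \<tau>: "0 < \<tau>" "\<tau> * real K = T" using T K by (auto simp: \<tau>_def)
  have dom: "\<tau> * s \<in> {0<..T}" if "s \<in> {0<..real K}" for s
  proof -
    have "\<tau> * s \<le> \<tau> * real K" using that \<tau> by (intro mult_left_mono) auto
    then show ?thesis using that \<tau> by simp
  qed
  show "0 < \<alpha>" "\<alpha> < 1" "0 \<le> M * \<tau> powr \<alpha>" using \<alpha> M by auto
  have "continuous_on {0..real K} (\<lambda>s. v (\<tau> * s))"
  proof (rule continuous_on_compose2[OF cont])
    show "(\<lambda>s. \<tau> * s) ` {0..real K} \<subseteq> {0..T}"
      using \<tau> by (auto intro: mult_left_mono[of _ "real K" \<tau>, simplified \<tau>(2)])
  qed (intro continuous_intros)
  then show "continuous_on {0..real K} (\<lambda>s. \<tau> ^ 0 * higher_deriv_within {0<..T} 0 v (\<tau> * s))"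
    by (simp add: higher_deriv_within_def)
  fix l :: nat and s :: real
  assume s: "s \<in> {0<..real K}"
  show "((\<lambda>s. \<tau> ^ l * higher_deriv_within {0<..T} l v (\<tau> * s)) has_real_derivative
      \<tau> ^ Suc l * higher_deriv_within {0<..T} (Suc l) v (\<tau> * s)) (at s within {0<..real K})" if l: "l < 4"
  proof -
    have "(higher_deriv_within {0<..T} l v has_real_derivative higher_deriv_within {0<..T} (Suc l) v (\<tau> * s)) (at (\<tau> * s) within {0<..T})"
      by (rule higher_deriv_within_has_derivative[OF Ck l dom[OF s]])
    then have "(higher_deriv_within {0<..T} l v has_real_derivative higher_deriv_within {0<..T} (Suc l) v (\<tau> * s))
        (at (\<tau> * s) within (\<lambda>s. \<tau> * s) ` {0<..real K})"
      by (rule DERIV_subset) (use dom in auto)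
    moreover have "((\<lambda>s. \<tau> * s) has_real_derivative \<tau>) (at s within {0<..real K})"
      by (auto intro!: derivative_eq_intros)
    ultimately have "(higher_deriv_within {0<..T} l v \<circ> (\<lambda>s. \<tau> * s) has_real_derivative higher_deriv_within {0<..T} (Suc l) v (\<tau> * s) * \<tau>) (at s within {0<..real K})"
      by (rule DERIV_image_chain)
    from DERIV_cmult[OF this, of "\<tau> ^ l"] show ?thesis by (simp add: o_def mult_ac)
  qed
  show "\<bar>\<tau> ^ l * higher_deriv_within {0<..T} l v (\<tau> * s)\<bar> \<le> M * \<tau> powr \<alpha> * s powr (\<alpha> - real l)" if l: "1 \<le> l" "l \<le> 4"
  proof -
    have "\<bar>\<tau> ^ l * higher_deriv_within {0<..T} l v (\<tau> * s)\<bar> = \<tau> ^ l * \<bar>higher_deriv_within {0<..T} l v (\<tau> * s)\<bar>"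
      using \<tau> by (simp add: abs_mult)
    also have "\<dots> \<le> \<tau> ^ l * (M * (\<tau> * s) powr (\<alpha> - real l))"
      using bd[OF l dom[OF s]] \<tau> by (intro mult_left_mono) auto
    also have "\<dots> = M * \<tau> powr \<alpha> * s powr (\<alpha> - real l)"
    proof -
      have "(\<tau> * s) powr (\<alpha> - real l) = \<tau> powr \<alpha> / \<tau> ^ l * s powr (\<alpha> - real l)"
        using \<tau> s by (simp add: powr_mult powr_diff powr_realpow)
      then show ?thesis using \<tau> by simp
    qed
    finally show ?thesis .
  qed
qed

text \<open>The factor \<tau> powr \<alpha> of the rescaled bounds cancels the \<tau> powr
  (-\<alpha>) of the Caputo kernel, which leaves a bound in terms of the level alone.\<close>

lemma caputo_truncation:
  fixes v :: "real \<Rightarrow> real"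
  assumes \<alpha>: "0 < \<alpha>" "\<alpha> < 1" and T: "0 < T" and K: "0 < K" and M: "0 \<le> M"
    and cont: "continuous_on {0..T} v" and Ck: "C_k_on 4 {0<..T} v"
    and bd: "\<And>l t. 1 \<le> l \<Longrightarrow> l \<le> 4 \<Longrightarrow> t \<in> {0<..T} \<Longrightarrow> \<bar>higher_deriv_within {0<..T} l v t\<bar> \<le> M * t powr (\<alpha> - real l)"
    and n: "1 \<le> n" "n \<le> K"
  shows "\<bar>caputo_deriv \<alpha> v (mesh T K n) - discrete_caputo \<alpha> (mesh T K) n (\<lambda>j. v (mesh T K j))\<bar>
    \<le> truncation_const \<alpha> * M / Gamma (1 - \<alpha>) * truncation_bound \<alpha> n"
proof -
  define \<tau> where "\<tau> = T / real K"
  have \<tau>: "0 < \<tau>" "\<tau> * real K = T" using T K by (auto simp: \<tau>_def)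
  have mesh: "mesh T K = (\<lambda>j. real j * \<tau>)" by (simp add: mesh_def \<tau>_def fun_eq_iff)
  define g where "g l s = \<tau> ^ l * higher_deriv_within {0<..T} l v (\<tau> * s)" for l s
  have ws: "weakly_singular \<alpha> (M * \<tau> powr \<alpha>) K g"
    using weakly_singular_rescale[OF \<alpha> T K M cont Ck bd] by (simp add: g_def[abs_def] \<tau>_def)
  obtain I where I: "((\<lambda>s. (real n - s) powr (-\<alpha>) * g 1 s) has_integral I) {0..real n}"
    "\<bar>I - (\<Sum>k=1..n. weighted_diff \<alpha> n (\<lambda>j. g 0 (real j)) k)\<bar>
      \<le> truncation_const \<alpha> * (M * \<tau> powr \<alpha>) * truncation_bound \<alpha> n"
    unfolding truncation_const_def by (rule weakly_singular.truncation_error[OF ws n])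
  define t where "t = real n * \<tau>"
  have t: "0 < t" "t \<le> T"
  proof -
    show "0 < t" using \<tau> n by (simp add: t_def)
    have "real n * \<tau> \<le> real K * \<tau>" using \<tau> n by (intro mult_right_mono) auto
    then show "t \<le> T" using \<tau> by (simp add: t_def mult.commute)
  qed
  have "((\<lambda>x. (real n - (1 / \<tau>) * x) powr (-\<alpha>) * g 1 ((1 / \<tau>) * x)) has_integral \<tau> * I) {0..t}"
  proof -
    have "((\<lambda>x. (real n - ((1 / \<tau>) * x + 0)) powr (-\<alpha>) * g 1 ((1 / \<tau>) * x + 0)) has_integral (1 / \<bar>1 / \<tau>\<bar> ^ DIM(real)) *\<^sub>R I)
      ((\<lambda>x. (1 / (1 / \<tau>)) *\<^sub>R x + - ((1 / (1 / \<tau>)) *\<^sub>R 0)) ` cbox 0 (real n))"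
      using has_integral_affinity[OF I(1)[unfolded box_real[symmetric]], of "1 / \<tau>" 0] \<tau> by simp
    moreover have "(\<lambda>x. \<tau> * x) ` {0..real n} = {0..t}"
      using image_affinity_atLeastAtMost[of \<tau> 0 0 "real n"] \<tau> by (simp add: t_def mult.commute)
    ultimately show ?thesis using \<tau> by simp
  qed
  then have "((\<lambda>x. (\<tau> powr (-\<alpha>) / \<tau>) * ((real n - (1 / \<tau>) * x) powr (-\<alpha>) * g 1 ((1 / \<tau>) * x))) has_integral
     (\<tau> powr (-\<alpha>) / \<tau>) * (\<tau> * I)) {0..t}"
    by (rule has_integral_mult_right)
  \<comment> \<open>Both end points are exempt: \<open>deriv\<close> is two-sided, while at 0, and
    at \<open>t\<close> if it is the final time, two-sided differentiability is not given.\<close>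
  then have "((\<lambda>x. (t - x) powr (-\<alpha>) * deriv v x) has_integral (\<tau> powr (-\<alpha>) / \<tau>) * (\<tau> * I)) {0..t}"
  proof (rule has_integral_spike_finite[of "{0, t}", rotated 2])
    fix x assume x: "x \<in> {0..t} - {0, t}"
    then have xT: "x \<in> {0<..T}" "0 < x" "x < T" using t by auto
    have "(higher_deriv_within {0<..T} 0 v has_real_derivative higher_deriv_within {0<..T} (Suc 0) v x) (at x within {0<..T})"
      by (rule higher_deriv_within_has_derivative[OF Ck _ xT(1)]) simp
    then have "(v has_real_derivative higher_deriv_within {0<..T} 1 v x) (at x within {0<..T})"
      by (simp add: higher_deriv_within_def)
    then have "(v has_real_derivative higher_deriv_within {0<..T} 1 v x) (at x within {0<..<T})"
      by (rule DERIV_subset) auto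
    moreover have "at x within {0<..<T} = at x" by (rule at_within_open) (use xT in auto)
    ultimately have d: "deriv v x = higher_deriv_within {0<..T} 1 v x" by (metis DERIV_imp_deriv)
    have "real n - (1 / \<tau>) * x = (t - x) / \<tau>" using \<tau> by (simp add: t_def field_simps)
    then have "(real n - (1 / \<tau>) * x) powr (-\<alpha>) = (t - x) powr (-\<alpha>) / \<tau> powr (-\<alpha>)"
      using \<tau> x by (simp add: powr_divide)
    moreover have "g 1 ((1 / \<tau>) * x) = \<tau> * deriv v x" using \<tau> by (simp add: g_def d)
    ultimately show "(t - x) powr (-\<alpha>) * deriv v x = (\<tau> powr (-\<alpha>) / \<tau>) * ((real n - (1 / \<tau>) * x) powr (-\<alpha>) * g 1 ((1 / \<tau>) * x))"
      using \<tau> by simp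
  qed simp
  then have c: "caputo_deriv \<alpha> v t = \<tau> powr (-\<alpha>) / Gamma (1 - \<alpha>) * I"
    using \<tau> by (simp add: caputo_deriv_def integral_unique)
  have d: "discrete_caputo \<alpha> (mesh T K) n (\<lambda>j. v (mesh T K j))
     = \<tau> powr (-\<alpha>) / Gamma (1 - \<alpha>) * (\<Sum>k=1..n. weighted_diff \<alpha> n (\<lambda>j. g 0 (real j)) k)"
    unfolding mesh discrete_caputo_mesh[OF \<alpha> \<tau>(1)] by (simp add: g_def higher_deriv_within_def mult.commute)
  have G: "0 < Gamma (1 - \<alpha>)" using \<alpha> by (intro Gamma_real_pos) auto
  have "\<bar>caputo_deriv \<alpha> v t - discrete_caputo \<alpha> (mesh T K) n (\<lambda>j. v (mesh T K j))\<bar>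
    = \<tau> powr (-\<alpha>) / Gamma (1 - \<alpha>) * \<bar>I - (\<Sum>k=1..n. weighted_diff \<alpha> n (\<lambda>j. g 0 (real j)) k)\<bar>"
    unfolding c d right_diff_distrib[symmetric] abs_mult using G by simp
  also have "\<dots> \<le> \<tau> powr (-\<alpha>) / Gamma (1 - \<alpha>) * (truncation_const \<alpha> * (M * \<tau> powr \<alpha>) * truncation_bound \<alpha> n)"
    using G by (intro mult_left_mono I(2)) auto
  also have "\<dots> = truncation_const \<alpha> * M / Gamma (1 - \<alpha>) * truncation_bound \<alpha> n"
  proof -
    have "\<tau> powr (-\<alpha>) * \<tau> powr \<alpha> = 1" using \<tau> by (simp flip: powr_add)
    then have "\<tau> powr (-\<alpha>) / \<gamma> * (c * (M * \<tau> powr \<alpha>) * b) = c * M / \<gamma> * b" for c b \<gamma> :: real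
      by (simp add: mult.left_commute[of "\<tau> powr (-\<alpha>)"] mult.commute mult.assoc)
    then show ?thesis .
  qed
  finally show ?thesis by (simp add: mesh t_def)
qed

text \<open>On (0, T] the product T powr (l - \<alpha>) * t powr (\<alpha> - l) is at least 1, so
  the singular part absorbs the regular one; the sum over \<open>l\<close> yields one constant for
  all orders.\<close>

lemma singular_bound:
  fixes T \<alpha> t :: real
  assumes "0 < \<alpha>" "\<alpha> < 1" "0 < T" "t \<in> {0<..T}" "1 \<le> l" "l \<le> (4::nat)"
    and b: "y \<le> C * (1 + t powr (\<alpha> - real l))"
  shows "y \<le> \<bar>C\<bar> * (1 + (\<Sum>l=1..4. T powr (real l - \<alpha>))) * t powr (\<alpha> - real l)"
proof -
  have "T powr (\<alpha> - real l) \<le> t powr (\<alpha> - real l)" using assms by (intro powr_mono2') auto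
  then have "T powr (real l - \<alpha>) * T powr (\<alpha> - real l) \<le> T powr (real l - \<alpha>) * t powr (\<alpha> - real l)"
    by (intro mult_left_mono) auto
  then have "1 \<le> T powr (real l - \<alpha>) * t powr (\<alpha> - real l)" using assms(3) by (simp flip: powr_add)
  also have "\<dots> \<le> (\<Sum>l=1..4. T powr (real l - \<alpha>)) * t powr (\<alpha> - real l)"
    by (intro mult_right_mono member_le_sum) (use assms in auto)
  finally have "1 + t powr (\<alpha> - real l) \<le> (1 + (\<Sum>l=1..4. T powr (real l - \<alpha>))) * t powr (\<alpha> - real l)"
    by (simp add: distrib_right)
  then have "\<bar>C\<bar> * (1 + t powr (\<alpha> - real l)) \<le> \<bar>C\<bar> * ((1 + (\<Sum>l=1..4. T powr (real l - \<alpha>))) * t powr (\<alpha> - real l))"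
    by (intro mult_left_mono) auto
  moreover have "C * (1 + t powr (\<alpha> - real l)) \<le> \<bar>C\<bar> * (1 + t powr (\<alpha> - real l))"
    by (intro mult_right_mono) (auto intro: add_nonneg_nonneg)
  ultimately show ?thesis using b by (simp add: mult.assoc)
qed

section \<open>Convergence\<close>

theorem theorem3:
  fixes \<alpha> T L \<rho> C :: real
    and f :: "real \<Rightarrow> real \<Rightarrow> real" and \<phi> :: "real \<Rightarrow> real" and u :: "real \<Rightarrow> real \<Rightarrow> real"
  assumes "0 < \<alpha>" "\<alpha> < 1" "0 < T" "0 < L" "0 < \<rho>"
    and "continuous_on ({0..L} \<times> {0..T}) (\<lambda>(x, t). f x t)"
    and "continuous_on {0..L} \<phi>"
    and "subdiffusion_solution \<alpha> \<rho> L T f \<phi> u"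
    and "\<forall>x\<in>{0..L}. continuous_on {0..T} (u x) \<and> C_k_on 4 {0<..T} (u x)"
    and "\<forall>x\<in>{0..L}. \<forall>t\<in>{0<..T}. \<forall>l\<in>{0..4}.
           \<bar>higher_deriv_within {0<..T} l (u x) t\<bar> \<le> C * (1 + t powr (\<alpha> - real l))"
    and "central_diff_second_order L T u"
  shows "\<exists>M h\<^sub>0 \<tau>\<^sub>0. 0 < h\<^sub>0 \<and> 0 < \<tau>\<^sub>0 \<and>
    (\<forall>K\<^sub>x K\<^sub>t U. 0 < K\<^sub>x \<longrightarrow> 0 < K\<^sub>t \<longrightarrow> L / real K\<^sub>x \<le> h\<^sub>0 \<longrightarrow> T / real K\<^sub>t \<le> \<tau>\<^sub>0 \<longrightarrow>
       scheme_solution \<alpha> \<rho> L T f \<phi> K\<^sub>x K\<^sub>t U \<longrightarrow>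
       (\<forall>n\<in>{1..K\<^sub>t}. \<forall>i\<in>{1..K\<^sub>x - 1}.
          \<bar>u (mesh L K\<^sub>x i) (mesh T K\<^sub>t n) - U i n\<bar>
          \<le> M * ((L / real K\<^sub>x)\<^sup>2 + (T / real K\<^sub>t) powr \<alpha>)))"
proof -
  note \<alpha> = assms(1,2) and T = assms(3) and L = assms(4) and \<rho> = assms(5)
  note sol = assms(8)[unfolded subdiffusion_solution_def]
  obtain A h\<^sub>0 where A: "0 < h\<^sub>0 \<and>
       (\<forall>K\<^sub>x K\<^sub>t. 0 < K\<^sub>x \<longrightarrow> 0 < K\<^sub>t \<longrightarrow> L / real K\<^sub>x \<le> h\<^sub>0 \<longrightarrow>
         (\<forall>i\<in>{1..K\<^sub>x - 1}. \<forall>n\<in>{1..K\<^sub>t}.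
            \<bar>second_deriv_x u (mesh L K\<^sub>x i) (mesh T K\<^sub>t n)
              - central_diff (\<lambda>k. u (mesh L K\<^sub>x k) (mesh T K\<^sub>t n)) (L / real K\<^sub>x) i\<bar>
            \<le> A * (L / real K\<^sub>x)\<^sup>2))"
    using assms(11)[unfolded central_diff_second_order_def] by (elim exE)
  note h\<^sub>0 = A[THEN conjunct1] and cd = A[THEN conjunct2, rule_format]
  obtain Cs where Cs: "0 < Cs" and stab: "\<And>K N \<mu> (e :: nat \<Rightarrow> nat \<Rightarrow> real) R b n i. 0 < K \<Longrightarrow> 0 < \<mu> \<Longrightarrow>
      (\<And>i. e i 0 = 0) \<Longrightarrow> (\<And>n. n \<le> N \<Longrightarrow> e 0 n = 0 \<and> e K n = 0) \<Longrightarrow>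
      (\<And>i n. 1 \<le> i \<Longrightarrow> i < K \<Longrightarrow> 1 \<le> n \<Longrightarrow> n \<le> N \<Longrightarrow>
        (\<Sum>k=1..n. weighted_diff \<alpha> n (e i) k) + \<mu> * (2 * e i n - e (i + 1) n - e (i - 1) n) = R i n) \<Longrightarrow>
      (\<And>i n. 1 \<le> i \<Longrightarrow> i < K \<Longrightarrow> 1 \<le> n \<Longrightarrow> n \<le> N \<Longrightarrow> \<bar>R i n\<bar> \<le> b n) \<Longrightarrow>
      (\<And>n. 0 \<le> b n) \<Longrightarrow> n \<le> N \<Longrightarrow> i \<le> K \<Longrightarrow>
      \<bar>e i n\<bar> \<le> Cs * ((\<Sum>j=1..n. real (n - j + 1) powr (\<alpha> - 1) * b j) + b 1 + b 2)"
    using weighted_scheme_stability[OF \<alpha>] by blast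
  obtain S where S: "0 < S" "\<And>m. (\<Sum>n=1..m. truncation_bound \<alpha> n) \<le> S"
    using sum_truncation_bound[OF \<alpha>] by blast
  define M where "M = \<bar>C\<bar> * (1 + (\<Sum>l=1..4. T powr (real l - \<alpha>)))"
  have M: "0 \<le> M" unfolding M_def by (intro mult_nonneg_nonneg add_nonneg_nonneg sum_nonneg) auto
  \<comment> \<open>Multiplication by \<open>G\<close> and \<tau> powr \<alpha> turns the discrete
    derivative into the plain sum of \<open>weighted_diff\<close>.\<close>
  define G where "G = Gamma (1 - \<alpha>)"
  have G: "0 < G" using \<alpha> by (auto simp: G_def intro!: Gamma_real_pos)
  define P where "P = truncation_const \<alpha> * M / G"
  have tc: "0 \<le> truncation_const \<alpha>"
  proof -
    have "0 \<le> Beta \<alpha> (1 - \<alpha>)" by (rule Beta_nonneg) (use \<alpha> in auto)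
    then show ?thesis
      unfolding truncation_const_def using \<alpha> cell_moment_one_ge[OF \<alpha>]
      by (intro mult_nonneg_nonneg add_nonneg_nonneg) auto
  qed
  have P: "0 \<le> P" using tc M G by (simp add: P_def)
  have tb: "0 \<le> truncation_bound \<alpha> n" for n
    unfolding truncation_bound_def
    by (intro add_nonneg_nonneg sum_nonneg mult_nonneg_nonneg node_factor_nonneg) auto
  \<comment> \<open>Spatial part: 1 / \<alpha> from the sum over time and 2 from
    \<open>b 1 + b 2\<close>. Temporal part: \<open>S\<close> once from that sum and once from
    \<open>b 1 + b 2\<close>.\<close>
  define M' where "M' = Cs * (G * \<rho> * \<bar>A\<bar> * T powr \<alpha> * (1 / \<alpha> + 2) + 2 * (G * P * S))"
  show ?thesis
  proof (intro exI conjI allI impI ballI)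
    show "0 < h\<^sub>0" by (rule h\<^sub>0)
    show "(0::real) < 1" by simp
    fix K\<^sub>x K\<^sub>t :: nat and U :: "nat \<Rightarrow> nat \<Rightarrow> real" and n i
    assume Kx: "0 < K\<^sub>x" and Kt: "0 < K\<^sub>t" and h: "L / real K\<^sub>x \<le> h\<^sub>0"
      and sch: "scheme_solution \<alpha> \<rho> L T f \<phi> K\<^sub>x K\<^sub>t U" and n: "n \<in> {1..K\<^sub>t}" and i: "i \<in> {1..K\<^sub>x - 1}"
    define H where "H = L / real K\<^sub>x"
    define \<tau> where "\<tau> = T / real K\<^sub>t"
    have H: "0 < H" using L Kx by (simp add: H_def)
    have \<tau>: "0 < \<tau>" using T Kt by (simp add: \<tau>_def)
    have \<tau>T: "\<tau> powr \<alpha> \<le> T powr \<alpha>"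
    proof (rule powr_mono2)
      have "T * 1 \<le> T * real K\<^sub>t" using T Kt by (intro mult_left_mono) auto
      then show "\<tau> \<le> T" using Kt by (simp add: \<tau>_def field_simps)
    qed (use \<alpha> \<tau> in auto)
    have mesh: "mesh T K\<^sub>t = (\<lambda>j. real j * \<tau>)" by (simp add: mesh_def \<tau>_def fun_eq_iff)
    have mt: "mesh T K\<^sub>t m \<in> {0<..T}" if "1 \<le> m" "m \<le> K\<^sub>t" for m
    proof -
      have "real m * \<tau> \<le> real K\<^sub>t * \<tau>" using that \<tau> by (intro mult_right_mono) auto
      moreover have "real K\<^sub>t * \<tau> = T" using Kt by (simp add: \<tau>_def)
      moreover have "0 < real m * \<tau>" using that \<tau> by simp
      ultimately show ?thesis by (simp add: mesh)
    qed
    have mx: "mesh L K\<^sub>x l \<in> {0..L}" if "l \<le> K\<^sub>x" for l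
    proof -
      have "real l * H \<le> real K\<^sub>x * H" using that H by (intro mult_right_mono) auto
      moreover have "real K\<^sub>x * H = L" using Kx by (simp add: H_def)
      moreover have "0 \<le> real l * H" using H by simp
      ultimately show ?thesis by (simp add: mesh_def H_def[symmetric])
    qed
    have mx': "mesh L K\<^sub>x l \<in> {0<..<L}" if "1 \<le> l" "l < K\<^sub>x" for l
    proof -
      have "real l * H < real K\<^sub>x * H" using that H by (intro mult_strict_right_mono) auto
      moreover have "real K\<^sub>x * H = L" using Kx by (simp add: H_def)
      moreover have "0 < real l * H" using that H by simp
      ultimately show ?thesis by (simp add: mesh_def H_def[symmetric])
    qed
    define w where "w l m = u (mesh L K\<^sub>x l) (mesh T K\<^sub>t m)" for l m
    \<comment> \<open>Zero beyond the last node, as the stability estimate asks for vanishing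
      initial errors at every index.\<close>
    define e where "e l m = (if l \<le> K\<^sub>x then w l m - U l m else 0)" for l m
    define \<mu> where "\<mu> = G * \<tau> powr \<alpha> * \<rho> / H\<^sup>2"
    define B0 where "B0 = G * \<tau> powr \<alpha> * \<rho> * \<bar>A\<bar> * H\<^sup>2"
    define B1 where "B1 = G * \<tau> powr \<alpha> * P"
    define b where "b m = B0 + B1 * truncation_bound \<alpha> m" for m
    have B0: "0 \<le> B0" using G \<rho> by (simp add: B0_def)
    have B1: "0 \<le> B1" using G P by (simp add: B1_def)
    \<comment> \<open>Taken as the residual itself: the error equation holds by definition, and the
      consistency of the scheme is the content of \<open>Rb\<close>.\<close>
    define R where "R l m = (\<Sum>k=1..m. weighted_diff \<alpha> m (e l) k) + \<mu> * (2 * e l m - e (l + 1) m - e (l - 1) m)" for l m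
    have e0: "e l 0 = 0" for l
    proof (cases "l \<le> K\<^sub>x")
      case True
      then have "w l 0 = \<phi> (mesh L K\<^sub>x l)" using sol mx[OF True] by (simp add: w_def mesh)
      moreover have "U l 0 = \<phi> (mesh L K\<^sub>x l)" using sch True by (simp add: scheme_solution_def)
      ultimately show ?thesis by (simp add: e_def)
    qed (simp add: e_def)
    have eb: "e 0 m = 0 \<and> e K\<^sub>x m = 0" if m: "m \<le> K\<^sub>t" for m
    proof (cases "m = 0")
      case False
      then have m1: "1 \<le> m" by simp
      have "mesh L K\<^sub>x 0 = 0" "mesh L K\<^sub>x K\<^sub>x = L" using Kx by (simp_all add: mesh_def)
      then have "w 0 m = 0" "w K\<^sub>x m = 0" using sol mt[OF m1 m] by (simp_all add: w_def)
      moreover have "U 0 m = 0" "U K\<^sub>x m = 0" using sch m1 m by (simp_all add: scheme_solution_def)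
      ultimately show ?thesis by (simp add: e_def)
    qed (simp add: e0)
    have Rb: "\<bar>R l m\<bar> \<le> b m" if l: "1 \<le> l" "l < K\<^sub>x" and m: "1 \<le> m" "m \<le> K\<^sub>t" for l m
    proof -
      define x t where "x = mesh L K\<^sub>x l" and "t = mesh T K\<^sub>t m"
      define dw where "dw = discrete_caputo \<alpha> (mesh T K\<^sub>t) m (w l)"
      define dU where "dU = discrete_caputo \<alpha> (mesh T K\<^sub>t) m (U l)"
      define cw where "cw = central_diff (\<lambda>k. w k m) H l"
      define cU where "cU = central_diff (\<lambda>k. U k m) H l"
      have xL: "x \<in> {0<..<L}" "x \<in> {0..L}" using mx'[OF l] by (auto simp: x_def)
      have tT: "t \<in> {0<..T}" using mt[OF m] by (simp add: t_def)
      have "is_caputo_coeffs \<alpha> (mesh T K\<^sub>t) m (caputo_coeff \<alpha> (mesh T K\<^sub>t) m)"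
        by (rule caputo_coeff[OF \<alpha>(2) strict_mono_on_mesh[OF T Kt]])
      then have "1 / Gamma (2 - \<alpha>) * (\<Sum>j=0..m. caputo_coeff \<alpha> (mesh T K\<^sub>t) m j * U l (m - j)) = dU"
        by (simp add: is_caputo_coeffs_def dU_def)
      moreover have "1 / Gamma (2 - \<alpha>) * (\<Sum>j=0..m. caputo_coeff \<alpha> (mesh T K\<^sub>t) m j * U l (m - j)) = \<rho> * cU + f x t"
        using sch[unfolded scheme_solution_def, THEN conjunct1, rule_format, of l m] l m
        unfolding cU_def x_def t_def H_def by simp
      ultimately have dU: "dU = \<rho> * cU + f x t" by simp
      have cap: "caputo_deriv \<alpha> (u x) t = \<rho> * second_deriv_x u x t + f x t"
      proof -
        have "caputo_deriv \<alpha> (u x) t - \<rho> * second_deriv_x u x t = f x t" using sol xL(1) tT by blast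
        then show ?thesis by simp
      qed
      have tr: "\<bar>caputo_deriv \<alpha> (u x) t - dw\<bar> \<le> P * truncation_bound \<alpha> m"
        unfolding dw_def w_def P_def G_def t_def x_def
      proof (rule caputo_truncation[OF \<alpha> T Kt M _ _ _ m])
        show "continuous_on {0..T} (u (mesh L K\<^sub>x l))" "C_k_on 4 {0<..T} (u (mesh L K\<^sub>x l))"
          using assms(9) xL(2) unfolding x_def by blast+
        fix d s assume d: "1 \<le> d" "d \<le> (4::nat)" and s: "s \<in> {0<..T}"
        show "\<bar>higher_deriv_within {0<..T} d (u (mesh L K\<^sub>x l)) s\<bar> \<le> M * s powr (\<alpha> - real d)"
          unfolding M_def
        proof (rule singular_bound[OF \<alpha> T s d])
          show "\<bar>higher_deriv_within {0<..T} d (u (mesh L K\<^sub>x l)) s\<bar> \<le> C * (1 + s powr (\<alpha> - real d))"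
            using assms(10) xL(2) s d unfolding x_def by auto
        qed
      qed
      have cd': "\<bar>second_deriv_x u x t - cw\<bar> \<le> \<bar>A\<bar> * H\<^sup>2"
      proof -
        have "\<bar>second_deriv_x u x t - cw\<bar> \<le> A * H\<^sup>2"
          unfolding x_def t_def cw_def w_def H_def
          by (rule cd[OF Kx Kt h]) (use l m in auto)
        also have "\<dots> \<le> \<bar>A\<bar> * H\<^sup>2" by (intro mult_right_mono) auto
        finally show ?thesis .
      qed
      have wd: "(\<Sum>k=1..m. weighted_diff \<alpha> m v k) = G * \<tau> powr \<alpha> * discrete_caputo \<alpha> (mesh T K\<^sub>t) m v" for v
      proof -
        have "\<tau> powr \<alpha> * \<tau> powr (-\<alpha>) = 1" using \<tau> by (simp flip: powr_add)
        then show ?thesis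
          unfolding mesh discrete_caputo_mesh[OF \<alpha> \<tau>] G_def[symmetric] using G by (simp add: mult.assoc)
      qed
      have "(\<Sum>k=1..m. weighted_diff \<alpha> m (e l) k) = (\<Sum>k=1..m. weighted_diff \<alpha> m (\<lambda>j. w l j - U l j) k)"
        using l by (intro sum.cong weighted_diff_cong) (auto simp: e_def)
      also have "\<dots> = G * \<tau> powr \<alpha> * (dw - dU)"
        unfolding weighted_diff_diff sum_subtractf wd dw_def dU_def by (simp add: right_diff_distrib)
      finally have 1: "(\<Sum>k=1..m. weighted_diff \<alpha> m (e l) k) = G * \<tau> powr \<alpha> * (dw - dU)" .
      have "\<mu> * (2 * e l m - e (l + 1) m - e (l - 1) m) = G * \<tau> powr \<alpha> * \<rho> * (cU - cw)"
      proof -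
        have "2 * e l m - e (l + 1) m - e (l - 1) m = H\<^sup>2 * (cU - cw)"
        proof -
          have "e l m = w l m - U l m" "e (l + 1) m = w (l + 1) m - U (l + 1) m"
            "e (l - 1) m = w (l - 1) m - U (l - 1) m" using l by (auto simp: e_def)
          moreover have "H\<^sup>2 * cU = U (l + 1) m - 2 * U l m + U (l - 1) m"
            "H\<^sup>2 * cw = w (l + 1) m - 2 * w l m + w (l - 1) m"
            using H by (simp_all add: cU_def cw_def central_diff_def)
          ultimately show ?thesis by (simp add: right_diff_distrib)
        qed
        then show ?thesis using H by (simp add: \<mu>_def)
      qed
      then have "R l m = G * \<tau> powr \<alpha> * ((dw - dU) + \<rho> * (cU - cw))"
        unfolding R_def 1 by (simp add: algebra_simps)
      \<comment> \<open>The exact and the discrete equation are subtracted: \<open>f\<close> cancels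
        and the two consistency errors remain.\<close>
      also have "(dw - dU) + \<rho> * (cU - cw) = \<rho> * (second_deriv_x u x t - cw) - (caputo_deriv \<alpha> (u x) t - dw)"
        unfolding dU cap by (simp add: algebra_simps)
      finally have "\<bar>R l m\<bar> = G * \<tau> powr \<alpha> * \<bar>\<rho> * (second_deriv_x u x t - cw) - (caputo_deriv \<alpha> (u x) t - dw)\<bar>"
        using G by (simp add: abs_mult)
      also have "\<dots> \<le> G * \<tau> powr \<alpha> * (\<rho> * (\<bar>A\<bar> * H\<^sup>2) + P * truncation_bound \<alpha> m)"
      proof (rule mult_left_mono)
        have "\<bar>\<rho> * (second_deriv_x u x t - cw)\<bar> \<le> \<rho> * (\<bar>A\<bar> * H\<^sup>2)"
          unfolding abs_mult using \<rho> cd' by (simp add: mult_left_mono)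
        then show "\<bar>\<rho> * (second_deriv_x u x t - cw) - (caputo_deriv \<alpha> (u x) t - dw)\<bar> \<le> \<rho> * (\<bar>A\<bar> * H\<^sup>2) + P * truncation_bound \<alpha> m"
          using tr by linarith
      qed (use G in auto)
      also have "\<dots> = b m" by (simp add: b_def B0_def B1_def algebra_simps)
      finally show ?thesis .
    qed
    have iK: "i < K\<^sub>x" "i \<le> K\<^sub>x" using i by auto
    have nK: "n \<le> K\<^sub>t" using n by simp
    have "\<bar>e i n\<bar> \<le> Cs * ((\<Sum>j=1..n. real (n - j + 1) powr (\<alpha> - 1) * b j) + b 1 + b 2)"
    proof (rule stab[where K = "K\<^sub>x" and N = "K\<^sub>t" and \<mu> = \<mu> and R = R and e = e])
      show "0 < \<mu>" using G \<tau> \<rho> H by (simp add: \<mu>_def)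
      show "0 \<le> b m" for m using B0 B1 tb by (simp add: b_def)
      show "e l 0 = 0" for l by (rule e0)
      show "e 0 m = 0 \<and> e K\<^sub>x m = 0" if "m \<le> K\<^sub>t" for m by (rule eb[OF that])
      show "\<bar>R l m\<bar> \<le> b m" if "1 \<le> l" "l < K\<^sub>x" "1 \<le> m" "m \<le> K\<^sub>t" for l m by (rule Rb[OF that])
    qed (use Kx iK nK in \<open>auto simp: R_def\<close>)
    also have "\<dots> \<le> Cs * (G * \<rho> * \<bar>A\<bar> * T powr \<alpha> * (1 / \<alpha> + 2) * H\<^sup>2 + 2 * (G * P * S) * \<tau> powr \<alpha>)"
    proof (rule mult_left_mono)
      have "(\<Sum>j=1..n. real (n - j + 1) powr (\<alpha> - 1) * b j)
        = (\<Sum>j=1..n. real (n - j + 1) powr (\<alpha> - 1)) * B0 + (\<Sum>j=1..n. real (n - j + 1) powr (\<alpha> - 1) * (B1 * truncation_bound \<alpha> j))"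
        by (simp add: b_def distrib_left sum.distrib sum_distrib_right)
      also have "(\<Sum>j=1..n. real (n - j + 1) powr (\<alpha> - 1)) = (\<Sum>j=1..n. real j powr (\<alpha> - 1))"
        by (rule sum.reindex_bij_witness[of _ "\<lambda>j. n - j + 1" "\<lambda>j. n - j + 1"]) auto
      also have "\<dots> * B0 \<le> real n powr \<alpha> / \<alpha> * B0" by (intro mult_right_mono sum_powr_le \<alpha> B0)
      also have "real n powr \<alpha> / \<alpha> * B0 \<le> G * \<rho> * \<bar>A\<bar> * T powr \<alpha> * (1 / \<alpha>) * H\<^sup>2"
      proof -
        \<comment> \<open>The normalising factor \<tau> powr \<alpha> inside \<open>B0\<close>
          compensates the growth n powr \<alpha>, since n \<tau> <= T.\<close>
        have "real n powr \<alpha> * \<tau> powr \<alpha> \<le> T powr \<alpha>"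
          using mt[of n] n \<alpha> \<tau> by (simp add: mesh powr_mult[symmetric] powr_mono2)
        then have "(real n powr \<alpha> * \<tau> powr \<alpha>) * (G * \<rho> * \<bar>A\<bar> * (1 / \<alpha>) * H\<^sup>2) \<le> T powr \<alpha> * (G * \<rho> * \<bar>A\<bar> * (1 / \<alpha>) * H\<^sup>2)"
          using G \<rho> \<alpha> by (intro mult_right_mono) auto
        then show ?thesis by (simp add: B0_def mult_ac)
      qed
      \<comment> \<open>For the temporal errors the response is simply bounded by 1, as their bounds
        have a finite sum; the rate comes from the factor \<tau> powr \<alpha> in
        \<open>B1\<close>.\<close>
      also have "(\<Sum>j=1..n. real (n - j + 1) powr (\<alpha> - 1) * (B1 * truncation_bound \<alpha> j)) \<le> (\<Sum>j=1..n. 1 * (B1 * truncation_bound \<alpha> j))"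
      proof (intro sum_mono mult_right_mono)
        fix j show "real (n - j + 1) powr (\<alpha> - 1) \<le> 1"
          using powr_mono2'[of "\<alpha> - 1" 1 "real (n - j + 1)"] \<alpha> by simp
      qed (use B1 tb in auto)
      also have "\<dots> = B1 * (\<Sum>j=1..n. truncation_bound \<alpha> j)" by (simp add: sum_distrib_left)
      also have "\<dots> \<le> B1 * S" using S(2) B1 by (rule mult_left_mono)
      finally have 1: "(\<Sum>j=1..n. real (n - j + 1) powr (\<alpha> - 1) * b j) \<le> G * \<rho> * \<bar>A\<bar> * T powr \<alpha> * (1 / \<alpha>) * H\<^sup>2 + B1 * S"
        by simp
      have "B1 * (truncation_bound \<alpha> 1 + truncation_bound \<alpha> 2) \<le> B1 * S"
        using S(2)[of 2] B1 by (intro mult_left_mono) (simp_all add: numeral_2_eq_2)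
      then have 2: "b 1 + b 2 \<le> 2 * B0 + B1 * S" by (simp add: b_def algebra_simps)
      have 3: "2 * B0 \<le> G * \<rho> * \<bar>A\<bar> * T powr \<alpha> * 2 * H\<^sup>2"
      proof -
        have "\<tau> powr \<alpha> * (2 * (G * \<rho> * \<bar>A\<bar> * H\<^sup>2)) \<le> T powr \<alpha> * (2 * (G * \<rho> * \<bar>A\<bar> * H\<^sup>2))"
          using \<tau>T G \<rho> by (intro mult_right_mono) auto
        then show ?thesis by (simp add: B0_def mult_ac)
      qed
      have "G * \<rho> * \<bar>A\<bar> * T powr \<alpha> * (1 / \<alpha>) * H\<^sup>2 + G * \<rho> * \<bar>A\<bar> * T powr \<alpha> * 2 * H\<^sup>2
        = G * \<rho> * \<bar>A\<bar> * T powr \<alpha> * (1 / \<alpha> + 2) * H\<^sup>2" by (simp add: algebra_simps)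
      moreover have "B1 * S + B1 * S = 2 * (G * P * S) * \<tau> powr \<alpha>" by (simp add: B1_def)
      ultimately show "(\<Sum>j=1..n. real (n - j + 1) powr (\<alpha> - 1) * b j) + b 1 + b 2
        \<le> G * \<rho> * \<bar>A\<bar> * T powr \<alpha> * (1 / \<alpha> + 2) * H\<^sup>2 + 2 * (G * P * S) * \<tau> powr \<alpha>"
        using 1 2 3 by linarith
    qed (use Cs in simp)
    also have "\<dots> \<le> M' * (H\<^sup>2 + \<tau> powr \<alpha>)"
    proof -
      define p where "p = G * \<rho> * \<bar>A\<bar> * T powr \<alpha> * (1 / \<alpha> + 2)"
      define q where "q = 2 * (G * P * S)"
      have "0 \<le> p" unfolding p_def using G \<rho> \<alpha> by (intro mult_nonneg_nonneg add_nonneg_nonneg) auto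
      moreover have "0 \<le> q" using G P S by (simp add: q_def)
      ultimately have "p * H\<^sup>2 + q * \<tau> powr \<alpha> \<le> (p + q) * (H\<^sup>2 + \<tau> powr \<alpha>)"
        by (simp add: algebra_simps)
      then have "Cs * (p * H\<^sup>2 + q * \<tau> powr \<alpha>) \<le> Cs * ((p + q) * (H\<^sup>2 + \<tau> powr \<alpha>))"
        using Cs by (intro mult_left_mono) auto
      then show ?thesis by (simp only: M'_def p_def q_def mult.assoc)
    qed
    finally show "\<bar>u (mesh L K\<^sub>x i) (mesh T K\<^sub>t n) - U i n\<bar> \<le> M' * ((L / real K\<^sub>x)\<^sup>2 + (T / real K\<^sub>t) powr \<alpha>)"
      using iK by (simp add: e_def w_def H_def \<tau>_def)
  qed
qed

end
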